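(* Let $p\ge 5$ be a prime and let $\mathbb{F}$ be a field of characteristic $0$ or greater than $p$. Then $\beta(H_p)<p^2$.
   Context: For an odd prime $p$, the Heisenberg group $H_p$ is the extraspecial group of order $p^3$ and exponent $p$; it has the presentation with generators $a,b,c$ and relations $a^p=b^p=c^p=1$, $[a,b]=c$, $[a,c]=[b,c]=1$, where $[a,b]=a^{-1}b^{-1}ab$. For a finite group $G$ and a finite-dimensional $G$-module $V$ over $\mathbb{F}$ (characteristic not dividing $|G|$), $G$ acts on the coordinate ring $\mathbb{F}[V]$ (the polynomial ring on $V$) by $f^g(v)=f(g\cdot v)$, and $\mathbb{F}[V]^G$ is the graded ring of polynomial invariants. The Noether number $\beta(G,V)$ is the maximal degree of an element in a minimal homogeneous generating set of the $\mathbb{F}$-algebra $\mathbb{F}[V]^G$. $\beta(G):=\sup_V \beta(G,V)$, where $V$ runs over all $G$-modules over the base field $\mathbb{F}$. *)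

theory Defs
  imports
    "HOL-Computational_Algebra.Primes"
    "HOL-Library.Poly_Mapping"
    "HOL-Library.Extended_Nat"
    "HOL-Algebra.Algebra"
    "Jordan_Normal_Form.Matrix"
begin

definition group_center :: "('g, 'b) monoid_scheme \<Rightarrow> 'g set" where
  "group_center G = {z \<in> carrier G. \<forall>x \<in> carrier G. z \<otimes>\<^bsub>G\<^esub> x = x \<otimes>\<^bsub>G\<^esub> z}"

definition group_exponent :: "('g, 'b) monoid_scheme \<Rightarrow> nat" where
  "group_exponent G = (LEAST n. 0 < n \<and> (\<forall>x \<in> carrier G. x [^]\<^bsub>G\<^esub> n = \<one>\<^bsub>G\<^esub>))"

definition elementary_abelian :: "nat \<Rightarrow> ('g, 'b) monoid_scheme \<Rightarrow> bool" where
  "elementary_abelian p G \<longleftrightarrow>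
     comm_group G \<and> (\<forall>x \<in> carrier G. x [^]\<^bsub>G\<^esub> p = \<one>\<^bsub>G\<^esub>)"

definition extraspecial :: "nat \<Rightarrow> ('g, 'b) monoid_scheme \<Rightarrow> bool" where
  "extraspecial p G \<longleftrightarrow>
     Factorial_Ring.prime p \<and> group G \<and> (\<exists>k. order G = p ^ k) \<and>
     card (group_center G) = p \<and>
     elementary_abelian p (G Mod group_center G) \<and> \<not> trivial_group (G Mod group_center G)"

text \<open>For odd \<open>p\<close> this determines \<open>G\<close> up to isomorphism; the link with the usual
  presentation is \<open>heisenberg_group_presentation\<close> below, and a concrete model is given in
  \<open>heisenberg_model\<close>.\<close>

definition heisenberg_group :: "nat \<Rightarrow> ('g, 'b) monoid_scheme \<Rightarrow> bool" where
  "heisenberg_group p G \<longleftrightarrow> extraspecial p G \<and> order G = p ^ 3 \<and> group_exponent G = p"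

lemma group_exponent_pow:
  fixes G (structure) assumes "group G" and "finite (carrier G)" and "x \<in> carrier G"
  shows "x [^]\<^bsub>G\<^esub> group_exponent G = \<one>\<^bsub>G\<^esub>"
proof -
  interpret group G by fact
  have "0 < order G \<and> (\<forall>x \<in> carrier G. x [^] order G = \<one>)"
    using assms(2) order_gt_0_iff_finite pow_order_eq_1 by auto
  from LeastI[where P = "\<lambda>n. 0 < n \<and> (\<forall>x \<in> carrier G. x [^] n = \<one>)", OF this]
  show ?thesis using assms(3) unfolding group_exponent_def by blast
qed

lemma (in group) inv_commute:
  assumes "x \<in> carrier G" "y \<in> carrier G" "x \<otimes> y = y \<otimes> x"
  shows "inv x \<otimes> y = y \<otimes> inv x"
  using assms by (metis inv_closed inv_solve_left inv_solve_right m_assoc m_closed)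

lemma (in group) mult_commute:
  assumes "x \<in> carrier G" "y \<in> carrier G" "z \<in> carrier G" "x \<otimes> z = z \<otimes> x" "y \<otimes> z = z \<otimes> y"
  shows "x \<otimes> y \<otimes> z = z \<otimes> (x \<otimes> y)"
  using assms by (metis m_assoc)

lemma group_center_subgroup:
  fixes G (structure) assumes "group G" shows "subgroup (group_center G) G"
proof -
  interpret group G by fact
  show ?thesis
  proof (rule subgroupI)
    fix z assume z: "z \<in> group_center G"
    show "inv z \<in> group_center G"
      unfolding group_center_def
    proof safe
      show "inv z \<in> carrier G" using z by (simp add: group_center_def)
      fix x assume x: "x \<in> carrier G"
      have "z \<otimes> x = x \<otimes> z" "z \<in> carrier G" using z x by (auto simp: group_center_def)
      thus "inv z \<otimes> x = x \<otimes> inv z"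
        using x by (metis inv_closed inv_solve_left inv_solve_right m_assoc m_closed)
    qed
  next
    fix y z assume "y \<in> group_center G" "z \<in> group_center G"
    then have yz: "y \<in> carrier G" "z \<in> carrier G"
      and c: "\<And>x. x \<in> carrier G \<Longrightarrow> y \<otimes> x = x \<otimes> y" "\<And>x. x \<in> carrier G \<Longrightarrow> z \<otimes> x = x \<otimes> z"
      by (auto simp: group_center_def)
    have "y \<otimes> z \<otimes> x = x \<otimes> (y \<otimes> z)" if "x \<in> carrier G" for x
      using that yz c by (metis m_assoc)
    thus "y \<otimes> z \<in> group_center G" using yz by (simp add: group_center_def)
  qed (auto simp: group_center_def intro!: exI[of _ \<one>])
qed

lemma group_center_normal:
  fixes G (structure) assumes "group G" shows "group_center G \<lhd> G"
proof -
  interpret group G by fact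
  have "x \<otimes> h \<otimes> inv x \<in> group_center G" if "x \<in> carrier G" "h \<in> group_center G" for x h
  proof -
    have "x \<otimes> h \<otimes> inv x = h \<otimes> x \<otimes> inv x" using that by (auto simp: group_center_def)
    also have "\<dots> = h"
      using that by (subst inv_solve_right') (auto simp: group_center_def)
    finally show ?thesis using that by simp
  qed
  thus ?thesis using group_center_subgroup[OF assms] by (simp add: normal_inv_iff)
qed

lemma heisenberg_group_presentation:
  fixes G (structure)
  assumes "heisenberg_group p G"
  obtains a b c where
    "a \<in> carrier G" "b \<in> carrier G" "c \<in> carrier G" "generate G {a, b, c} = carrier G"
    "a [^]\<^bsub>G\<^esub> p = \<one>\<^bsub>G\<^esub>" "b [^]\<^bsub>G\<^esub> p = \<one>\<^bsub>G\<^esub>" "c [^]\<^bsub>G\<^esub> p = \<one>\<^bsub>G\<^esub>"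
    "inv\<^bsub>G\<^esub> a \<otimes>\<^bsub>G\<^esub> inv\<^bsub>G\<^esub> b \<otimes>\<^bsub>G\<^esub> a \<otimes>\<^bsub>G\<^esub> b = c"
    "inv\<^bsub>G\<^esub> a \<otimes>\<^bsub>G\<^esub> inv\<^bsub>G\<^esub> c \<otimes>\<^bsub>G\<^esub> a \<otimes>\<^bsub>G\<^esub> c = \<one>\<^bsub>G\<^esub>"
    "inv\<^bsub>G\<^esub> b \<otimes>\<^bsub>G\<^esub> inv\<^bsub>G\<^esub> c \<otimes>\<^bsub>G\<^esub> b \<otimes>\<^bsub>G\<^esub> c = \<one>\<^bsub>G\<^esub>"
proof -
  have ex: "extraspecial p G" and ord: "order G = p ^ 3" and ep: "group_exponent G = p"
    using assms by (auto simp: heisenberg_group_def)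
  then have p: "Factorial_Ring.prime p" and "group G" and cz: "card (group_center G) = p"
    and ea: "elementary_abelian p (G Mod group_center G)"
    by (auto simp: extraspecial_def)
  interpret group G by fact
  define Z where "Z = group_center G"
  interpret Z: normal Z G unfolding Z_def by (rule group_center_normal) fact
  have p1: "1 < p" using p by (rule prime_gt_1_nat)
  have fin: "finite (carrier G)" using ord p1 order_gt_0_iff_finite by simp
  have pow: "x [^] p = \<one>" if "x \<in> carrier G" for x
    using group_exponent_pow[OF \<open>group G\<close> fin that] ep by simp
  have "p ^ 1 < p ^ 3" using p1 by (subst power_strict_increasing_iff) auto
  then have "Z \<noteq> carrier G" using cz ord unfolding Z_def order_def by (metis less_irrefl power_one_right)
  then obtain a where a: "a \<in> carrier G" "a \<notin> Z" using Z.subset by blast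
  then obtain b where b: "b \<in> carrier G" "a \<otimes> b \<noteq> b \<otimes> a"
    unfolding Z_def group_center_def by blast
  define c where "c = inv a \<otimes> inv b \<otimes> a \<otimes> b"
  have c: "c \<in> carrier G" using a b by (simp add: c_def)
  have bac: "a \<otimes> b = b \<otimes> a \<otimes> c"
    using a b unfolding c_def
    by (metis inv_closed inv_mult_group inv_solve_left m_assoc m_closed)
  have c1: "c \<noteq> \<one>" using bac a b by (metis m_closed r_one)
  have "Z #> (a \<otimes> b) = Z #> (b \<otimes> a)"
  proof -
    interpret Q: comm_group "G Mod Z" using ea by (simp add: elementary_abelian_def Z_def)
    have "(Z #> a) \<otimes>\<^bsub>G Mod Z\<^esub> (Z #> b) = (Z #> b) \<otimes>\<^bsub>G Mod Z\<^esub> (Z #> a)"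
      using a b by (intro Q.m_comm) (auto simp: FactGroup_def RCOSETS_def)
    thus ?thesis using a b by (simp add: FactGroup_def Z.rcos_sum)
  qed
  moreover have "a \<otimes> b \<in> Z #> (a \<otimes> b)"
    using a b Z.subgroup_axioms by (intro rcos_self) auto
  ultimately obtain z where z: "z \<in> Z" "a \<otimes> b = z \<otimes> (b \<otimes> a)"
    by (auto simp: r_coset_def)
  have Zcomm: "y \<otimes> x = x \<otimes> y" if "y \<in> Z" "x \<in> carrier G" for x y
    using that by (unfold Z_def group_center_def) blast
  have "b \<otimes> a \<otimes> c = b \<otimes> a \<otimes> z"
    using Zcomm[OF z(1) m_closed[OF b(1) a(1)]] bac z(2) by metis
  then have "c = z" using z(1) a(1) b(1) c by (subst (asm) l_cancel) auto
  with z have cZ: "c \<in> Z" by simp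
  have lag: "\<exists>i\<le>3. card K = p ^ i" if "subgroup K G" for K
    using lagrange[OF that] ord divides_primepow_nat[OF p, of "card K" 3]
    by (metis dvd_triv_right)
  define H where "H = generate G {a, b, c}"
  have sH: "subgroup H G" unfolding H_def using a b c by (intro generate_is_subgroup) auto
  then interpret H: subgroup H G .
  have abcH: "a \<in> H" "b \<in> H" "c \<in> H" by (auto simp: H_def generate.incl)
  have ZH: "Z \<subseteq> H"
  proof -
    have sZH: "subgroup (Z \<inter> H) G"
      by (intro subgroups_Inter_pair Z.subgroup_axioms sH)
    obtain i where i: "card (Z \<inter> H) = p ^ i" using lag[OF sZH] by blast
    have finZ: "finite Z" using finite_subset[OF Z.subset fin] .
    have "card {\<one>, c} \<le> card (Z \<inter> H)"
      using finZ cZ abcH by (intro card_mono) auto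
    then have "i \<noteq> 0" using i c1 by (cases i) auto
    then have "p \<le> card (Z \<inter> H)" using i p1 by (simp add: self_le_power)
    then have "Z \<inter> H = Z" using cz finZ by (intro card_seteq) (auto simp: Z_def)
    thus ?thesis by blast
  qed
  define C where "C = {x \<in> H. x \<otimes> a = a \<otimes> x}"
  have sC: "subgroup C G"
  proof (rule subgroupI)
    show "C \<subseteq> carrier G" by (auto simp: C_def)
    show "C \<noteq> {}" using abcH by (auto simp: C_def)
  next
    fix x assume "x \<in> C"
    then have x: "x \<in> H" "x \<otimes> a = a \<otimes> x" unfolding C_def by blast+
    have "inv x \<otimes> a = a \<otimes> inv x" by (rule inv_commute[OF H.mem_carrier[OF x(1)] a(1) x(2)])
    thus "inv x \<in> C" using H.m_inv_closed[OF x(1)] unfolding C_def by blast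
  next
    fix x y assume "x \<in> C" "y \<in> C"
    then have x: "x \<in> H" "x \<otimes> a = a \<otimes> x" and y: "y \<in> H" "y \<otimes> a = a \<otimes> y"
      unfolding C_def by blast+
    have "x \<otimes> y \<otimes> a = a \<otimes> (x \<otimes> y)"
      by (rule mult_commute[OF H.mem_carrier[OF x(1)] H.mem_carrier[OF y(1)] a(1) x(2) y(2)])
    thus "x \<otimes> y \<in> C" using H.m_closed[OF x(1) y(1)] unfolding C_def by blast
  qed
  have finH: "finite H" using fin H.subset finite_subset by blast
  have "insert a Z \<subseteq> C" using ZH abcH(1) a(1) Zcomm unfolding C_def by blast
  moreover have "finite C" using finH by (auto simp: C_def)
  ultimately have "card (insert a Z) \<le> card C" by (intro card_mono)
  then have "p ^ 1 < card C"
    using a cz finite_subset[OF Z.subset fin] by (simp add: Z_def)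
  moreover obtain i where i: "card C = p ^ i" using lag[OF sC] by blast
  ultimately have i1: "1 < i" using p1 power_less_imp_less_exp by metis
  have "b \<notin> C" using b(2) unfolding C_def by (simp add: eq_commute)
  then have "C \<subset> H" using abcH(2) unfolding C_def by blast
  then have "card C < card H" using finH by (rule psubset_card_mono[rotated])
  moreover obtain j where j: "j \<le> 3" "card H = p ^ j" using lag[OF sH] by blast
  ultimately have "i < j" using i p1 power_less_imp_less_exp by metis
  with i1 j have "j = 3" by linarith
  with j have "card H = p ^ 3" by simp
  then have HG: "H = carrier G" using ord fin H.subset by (intro card_subset_eq) (auto simp: order_def)
  have comm1: "inv x \<otimes> inv c \<otimes> x \<otimes> c = \<one>" if "x \<in> carrier G" for x
  proof -
    have "inv x \<otimes> inv c \<otimes> x \<otimes> c = inv (c \<otimes> x) \<otimes> (x \<otimes> c)"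
      using that c by (simp add: inv_mult_group m_assoc)
    thus ?thesis using Zcomm[OF cZ that, symmetric] that c by (simp only: l_inv m_closed)
  qed
  show ?thesis
    by (rule that[of a b c]) (use a b c HG pow comm1 in \<open>auto simp: H_def c_def\<close>)
qed

definition heisenberg_model :: "nat \<Rightarrow> (int \<times> int \<times> int) monoid" where
  "heisenberg_model p =
     \<lparr>carrier = {0..<int p} \<times> {0..<int p} \<times> {0..<int p},
      Group.monoid.mult = (\<lambda>(x, y, z) (x', y', z').
        ((x + x') mod int p, (y + y') mod int p, (z + z' + x * y') mod int p)),
      one = (0, 0, 0)\<rparr>"

lemma heisenberg_model:
  assumes p: "Factorial_Ring.prime p" and odd: "odd p"
  shows "heisenberg_group p (heisenberg_model p)"
proof -
  define G where "G = heisenberg_model p"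
  define q where "q = int p"
  have p1: "1 < p" using p by (rule prime_gt_1_nat)
  then have q: "1 < q" by (simp add: q_def)
  have carr: "carrier G = {0..<q} \<times> {0..<q} \<times> {0..<q}"
    and one: "\<one>\<^bsub>G\<^esub> = (0, 0, 0)"
    and mul: "\<And>x y z x' y' z'. (x, y, z) \<otimes>\<^bsub>G\<^esub> (x', y', z') =
       ((x + x') mod q, (y + y') mod q, (z + z' + x * y') mod q)"
    by (simp_all add: G_def heisenberg_model_def q_def)
  have red: "(s mod q + t + (u mod q) * v) mod q = (s + t + u * v) mod q"
    "(t + s mod q + v * (u mod q)) mod q = (t + s + v * u) mod q" for s t u v
    by (intro mod_add_cong mod_mult_cong; simp)+
  have grp: "group G"
  proof (rule groupI)
    fix u v w assume "u \<in> carrier G" "v \<in> carrier G" "w \<in> carrier G"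
    thus "u \<otimes>\<^bsub>G\<^esub> v \<otimes>\<^bsub>G\<^esub> w = u \<otimes>\<^bsub>G\<^esub> (v \<otimes>\<^bsub>G\<^esub> w)"
      by (cases u; cases v; cases w) (simp add: mul red mod_simps, simp add: algebra_simps)
  next
    fix u assume u: "u \<in> carrier G"
    obtain x y z where xyz: "u = (x, y, z)" by (cases u)
    have "((- x) mod q, (- y) mod q, (- z + x * y) mod q) \<otimes>\<^bsub>G\<^esub> u = \<one>\<^bsub>G\<^esub>"
      by (simp add: xyz mul one red mod_simps)
    moreover have "((- x) mod q, (- y) mod q, (- z + x * y) mod q) \<in> carrier G"
      using q by (simp add: carr)
    ultimately show "\<exists>v\<in>carrier G. v \<otimes>\<^bsub>G\<^esub> u = \<one>\<^bsub>G\<^esub>" by blast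
  next
    fix u v assume "u \<in> carrier G" "v \<in> carrier G"
    thus "u \<otimes>\<^bsub>G\<^esub> v \<in> carrier G" using q by (cases u; cases v) (simp add: mul carr)
  qed (use q in \<open>auto simp: carr mul one\<close>)
  interpret group G by fact
  have pow: "(x, y, z) [^]\<^bsub>G\<^esub> n =
      ((int n * x) mod q, (int n * y) mod q, (int n * z + int (n choose 2) * (x * y)) mod q)"
    for x y z and n :: nat
  proof (induction n)
    case (Suc n)
    have "int (Suc n choose 2) = int (n choose 2) + int n" by (simp add: numeral_2_eq_2)
    thus ?case by (simp add: Suc mul red mod_simps) (simp add: algebra_simps)
  qed (simp add: one numeral_2_eq_2)
  have "p choose 2 = p * ((p - 1) div 2)"
    using odd p1 by (simp add: choose_two div_mult_swap)
  then have "q dvd int (p choose 2)" by (simp add: q_def)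
  then have powp: "u [^]\<^bsub>G\<^esub> p = \<one>\<^bsub>G\<^esub>" for u
    by (cases u) (auto simp: pow one q_def mod_eq_0_iff_dvd)
  have ord: "order G = p ^ 3"
    by (simp add: order_def carr card_cartesian_product q_def power3_eq_cube)
  have expo: "group_exponent G = p"
    unfolding group_exponent_def
  proof (rule Least_equality)
    fix n :: nat assume n: "0 < n \<and> (\<forall>x\<in>carrier G. x [^]\<^bsub>G\<^esub> n = \<one>\<^bsub>G\<^esub>)"
    have "(1, 0, 0) \<in> carrier G" using q by (simp add: carr)
    with n have "(1, 0, 0) [^]\<^bsub>G\<^esub> n = \<one>\<^bsub>G\<^esub>" by blast
    then have "q dvd int n" by (simp add: pow one mod_eq_0_iff_dvd)
    with n show "p \<le> n" by (simp add: q_def dvd_imp_le)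
  qed (use p1 powp in auto)
  define Z where "Z = {0 :: int} \<times> {0 :: int} \<times> {0..<q}"
  have cen: "group_center G = Z"
  proof
    show "group_center G \<subseteq> Z"
    proof
      fix u assume u: "u \<in> group_center G"
      obtain x y z where xyz: "u = (x, y, z)" by (cases u)
      have c: "u \<in> carrier G" "\<And>v. v \<in> carrier G \<Longrightarrow> u \<otimes>\<^bsub>G\<^esub> v = v \<otimes>\<^bsub>G\<^esub> u"
        using u by (auto simp: group_center_def)
      have "u \<otimes>\<^bsub>G\<^esub> (1, 0, 0) = (1, 0, 0) \<otimes>\<^bsub>G\<^esub> u" "u \<otimes>\<^bsub>G\<^esub> (0, 1, 0) = (0, 1, 0) \<otimes>\<^bsub>G\<^esub> u"
        using q by (auto intro!: c simp: carr)
      then have "z mod q = (z + y) mod q" "(z + x) mod q = z mod q"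
        by (simp_all add: xyz mul)
      then have "q dvd y" "q dvd x" by (simp_all add: mod_eq_dvd_iff)
      with c(1) show "u \<in> Z" by (auto simp: xyz carr Z_def dest: zdvd_imp_le)
    qed
    show "Z \<subseteq> group_center G"
      using q by (auto simp: Z_def group_center_def carr mul ac_simps)
  qed
  interpret Z: normal Z G using group_center_normal[OF grp] cen by simp
  have coset: "Z #>\<^bsub>G\<^esub> (x, y, z) = {x} \<times> {y} \<times> {0..<q}" if "(x, y, z) \<in> carrier G" for x y z
  proof
    show "Z #>\<^bsub>G\<^esub> (x, y, z) \<subseteq> {x} \<times> {y} \<times> {0..<q}"
      using that q by (auto simp: r_coset_def Z_def mul carr)
    show "{x} \<times> {y} \<times> {0..<q} \<subseteq> Z #>\<^bsub>G\<^esub> (x, y, z)"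
    proof safe
      fix w assume "w \<in> {0..<q}"
      then have "(x, y, w) = (0, 0, (w - z) mod q) \<otimes>\<^bsub>G\<^esub> (x, y, z)"
        using that by (simp add: mul carr mod_simps)
      moreover have "(0, 0, (w - z) mod q) \<in> Z" using q by (simp add: Z_def)
      ultimately show "(x, y, w) \<in> Z #>\<^bsub>G\<^esub> (x, y, z)" unfolding r_coset_def by blast
    qed
  qed
  have Qgrp: "group (G Mod Z)" by (rule Z.factorgroup_is_group)
  have Qcarr: "carrier (G Mod Z) = (\<lambda>u. Z #>\<^bsub>G\<^esub> u) ` carrier G"
    by (auto simp: FactGroup_def RCOSETS_def)
  have Qmul: "(Z #>\<^bsub>G\<^esub> u) \<otimes>\<^bsub>G Mod Z\<^esub> (Z #>\<^bsub>G\<^esub> v) = Z #>\<^bsub>G\<^esub> (u \<otimes>\<^bsub>G\<^esub> v)"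
    if "u \<in> carrier G" "v \<in> carrier G" for u v
    using that by (simp add: FactGroup_def Z.rcos_sum)
  have Qone: "\<one>\<^bsub>G Mod Z\<^esub> = Z" by (simp add: FactGroup_def)
  have comm: "comm_group (G Mod Z)"
  proof (rule group.group_comm_groupI[OF Qgrp])
    fix A B assume "A \<in> carrier (G Mod Z)" "B \<in> carrier (G Mod Z)"
    then obtain u v where uv: "u \<in> carrier G" "v \<in> carrier G" "A = Z #>\<^bsub>G\<^esub> u" "B = Z #>\<^bsub>G\<^esub> v"
      by (auto simp: Qcarr)
    obtain x y z x' y' z' where [simp]: "u = (x, y, z)" "v = (x', y', z')" by (cases u; cases v)
    have "Z #>\<^bsub>G\<^esub> (u \<otimes>\<^bsub>G\<^esub> v) = Z #>\<^bsub>G\<^esub> (v \<otimes>\<^bsub>G\<^esub> u)"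
      using m_closed[OF uv(1,2)] m_closed[OF uv(2,1)] by (simp add: mul coset add.commute)
    thus "A \<otimes>\<^bsub>G Mod Z\<^esub> B = B \<otimes>\<^bsub>G Mod Z\<^esub> A" using uv by (simp add: Z.rcos_sum)
  qed
  have Qpow: "(Z #>\<^bsub>G\<^esub> u) [^]\<^bsub>G Mod Z\<^esub> n = Z #>\<^bsub>G\<^esub> (u [^]\<^bsub>G\<^esub> n)" if "u \<in> carrier G" for u and n :: nat
    using that by (induction n) (simp_all add: Z.rcos_sum Qone Z.rcos_const coset_mult_one Z.subset)
  have elem: "elementary_abelian p (G Mod Z)"
    unfolding elementary_abelian_def using comm
    by (auto simp: Qcarr Qpow powp Qone coset_mult_one Z.subset)
  have e: "(1, 0, 0) \<in> carrier G" using q by (simp add: carr)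
  have "(1, 0, 0) \<in> Z #>\<^bsub>G\<^esub> (1, 0, 0)" using q by (simp add: coset[OF e])
  moreover have "(1, 0, 0) \<notin> Z" by (simp add: Z_def)
  ultimately have "Z #>\<^bsub>G\<^esub> (1, 0, 0) \<noteq> Z" by metis
  moreover have "Z #>\<^bsub>G\<^esub> (1, 0, 0) \<in> carrier (G Mod Z)" using e by (simp only: Qcarr imageI)
  ultimately
  have nontriv: "\<not> trivial_group (G Mod Z)" by (auto simp: trivial_group_def Qone)
  have "card Z = p" by (simp add: Z_def card_cartesian_product q_def)
  then have "extraspecial p G"
    unfolding extraspecial_def using p grp ord cen elem nontriv by auto
  with ord expo show ?thesis by (simp add: heisenberg_group_def G_def)
qed

type_synonym 'a mpoly = "(nat \<Rightarrow>\<^sub>0 nat) \<Rightarrow>\<^sub>0 'a"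

definition Const :: "'a::zero \<Rightarrow> 'a mpoly" where
  "Const c = Poly_Mapping.single 0 c"

definition Var :: "nat \<Rightarrow> 'a::zero_neq_one mpoly" where
  "Var i = Poly_Mapping.single (Poly_Mapping.single i 1) 1"

definition polynomials :: "nat \<Rightarrow> 'a::zero mpoly set" where
  "polynomials n = {f. \<forall>m \<in> Poly_Mapping.keys f. Poly_Mapping.keys m \<subseteq> {..<n}}"

definition monomial_degree :: "(nat \<Rightarrow>\<^sub>0 nat) \<Rightarrow> nat" where
  "monomial_degree m = (\<Sum>i \<in> Poly_Mapping.keys m. Poly_Mapping.lookup m i)"

definition total_degree :: "'a::zero mpoly \<Rightarrow> nat" where
  "total_degree f = Max (insert 0 (monomial_degree ` Poly_Mapping.keys f))"

definition homogeneous :: "'a::zero mpoly \<Rightarrow> bool" where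
  "homogeneous f \<longleftrightarrow> (\<exists>d. \<forall>m \<in> Poly_Mapping.keys f. monomial_degree m = d)"

definition poly_subst :: "(nat \<Rightarrow> 'a mpoly) \<Rightarrow> 'a::comm_ring_1 mpoly \<Rightarrow> 'a mpoly" where
  "poly_subst \<sigma> f =
     (\<Sum>m \<in> Poly_Mapping.keys f. Const (Poly_Mapping.lookup f m) *
        (\<Prod>i \<in> Poly_Mapping.keys m. \<sigma> i ^ Poly_Mapping.lookup m i))"

inductive_set generated_algebra :: "'a::comm_ring_1 mpoly set \<Rightarrow> 'a mpoly set"
  for S :: "'a mpoly set" where
  const: "Const c \<in> generated_algebra S"
| gen: "f \<in> S \<Longrightarrow> f \<in> generated_algebra S"
| add: "f \<in> generated_algebra S \<Longrightarrow> g \<in> generated_algebra S \<Longrightarrow> f + g \<in> generated_algebra S"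
| mult: "f \<in> generated_algebra S \<Longrightarrow> g \<in> generated_algebra S \<Longrightarrow> f * g \<in> generated_algebra S"

text \<open>A finite-dimensional \<open>G\<close>-module is, after a choice of basis, the space of column
  vectors of length \<open>n\<close> with \<open>G\<close> acting through a homomorphism into the invertible
  \<open>n \<times> n\<close> matrices.\<close>

definition representation ::
    "('g, 'b) monoid_scheme \<Rightarrow> nat \<Rightarrow> ('g \<Rightarrow> 'a::field mat) \<Rightarrow> bool" where
  "representation G n \<rho> \<longleftrightarrow> \<rho> \<in> hom G (units_of (ring_mat TYPE('a) n ()))"

text \<open>\<open>Var i\<close> is the \<open>i\<close>-th coordinate function, so \<open>v \<mapsto> f (A v)\<close> is obtained from \<open>f\<close> by
  replacing \<open>Var i\<close> with the \<open>i\<close>-th coordinate of \<open>A v\<close>.\<close>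

definition mat_act :: "'a::comm_ring_1 mat \<Rightarrow> 'a mpoly \<Rightarrow> 'a mpoly" where
  "mat_act A f = poly_subst (\<lambda>i. \<Sum>j<dim_col A. Const (A $$ (i, j)) * Var j) f"

definition invariants ::
    "('g, 'b) monoid_scheme \<Rightarrow> nat \<Rightarrow> ('g \<Rightarrow> 'a::field mat) \<Rightarrow> 'a mpoly set" where
  "invariants G n \<rho> = {f \<in> polynomials n. \<forall>g \<in> carrier G. mat_act (\<rho> g) f = f}"

definition homogeneous_generating_set :: "'a::field mpoly set \<Rightarrow> 'a mpoly set \<Rightarrow> bool" where
  "homogeneous_generating_set R S \<longleftrightarrow> (\<forall>f \<in> S. homogeneous f) \<and> generated_algebra S = R"

definition minimal_homogeneous_generating_set ::
    "'a::field mpoly set \<Rightarrow> 'a mpoly set \<Rightarrow> bool" where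
  "minimal_homogeneous_generating_set R S \<longleftrightarrow>
     homogeneous_generating_set R S \<and> (\<forall>T. T \<subset> S \<longrightarrow> \<not> homogeneous_generating_set R T)"

text \<open>The degrees occurring in a minimal homogeneous generating set do not depend on the set,
  so the supremum over all such sets is the maximal degree in any one of them (and \<open>0\<close> if the
  empty set generates). Suprema are taken in \<^typ>\<open>enat\<close>, so that an unbounded family has
  supremum \<open>\<infinity>\<close>.\<close>

definition module_noether_number ::
    "('g, 'b) monoid_scheme \<Rightarrow> nat \<Rightarrow> ('g \<Rightarrow> 'a::field mat) \<Rightarrow> enat" where
  "module_noether_number G n \<rho> =
     (SUP S \<in> {S. minimal_homogeneous_generating_set (invariants G n \<rho>) S}.
        SUP f \<in> S. enat (total_degree f))"

definition noether_number :: "'a::field itself \<Rightarrow> ('g, 'b) monoid_scheme \<Rightarrow> enat" where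
  "noether_number ty G =
     (SUP (n, \<rho> :: 'g \<Rightarrow> 'a mat) \<in> {(n, \<rho>). representation G n \<rho>}. module_noether_number G n \<rho>)"

end

theory Submission
  imports Defs "HOL-Number_Theory.Number_Theory" "HOL-Algebra.Algebraic_Closure_Type"
begin

text \<open>Every element of a minimal homogeneous generating set is an indecomposable invariant: it does not
lie in the subalgebra generated by the other generators, which contains all invariants of smaller
degree. So let \<open>f\<close> be an invariant form of degree \<open>N \<ge> p\<^sup>2\<close>, and suppose that it is not a
polynomial in invariants of smaller degree. Some linear functional vanishes on these polynomials
but not at \<open>f\<close>. Composed with the sum over the group, it becomes a functional \<open>\<phi>\<close> on forms that is
constant on orbits and kills \<open>u * v\<close> whenever \<open>u\<close> is an invariant form, \<open>u\<close> and \<open>v\<close> have positive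
degree, and the degrees add up to \<open>N\<close>. It suffices to show that such a functional vanishes on every
product of \<open>N\<close> linear forms (\<open>product_of_linear_forms\<close>). This may be done over the algebraic
closure, which contains a primitive \<open>p\<close>-th root of unity \<open>\<zeta>\<close>.

Choose generators \<open>g\<close> and \<open>h\<close> whose commutator \<open>c\<close> is central. By multilinearity all factors \<open>v t\<close>
may be taken to be joint eigenvectors of \<open>g\<close> and \<open>c\<close>, with eigenvalues \<open>\<zeta>\<close> to the powers \<open>s t\<close> and
\<open>- k t\<close>. Then \<open>h\<close> moves the weight \<open>(s, k)\<close> to \<open>(s + k, k)\<close>. Let \<open>F j\<close> be the value of \<open>\<phi>\<close> at the product of
the vectors obtained from \<open>v t\<close> by applying \<open>h\<close> exactly \<open>j t\<close> times. Three properties of \<open>F\<close>, collected in the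
locale \<open>shear_system\<close>, reduce the problem to combinatorics modulo \<open>p\<close>. The value \<open>F j\<close> vanishes
unless the weights \<open>(s t + j t * k t, k t)\<close> add up to zero. If the factors are cut into \<open>p\<close> blocks
with zero sum, then the effect of applying powers of \<open>h\<close> to the blocks depends only on the sum of
the exponents; the reason is that a zero-sum sequence of length \<open>p\<close> in the integers modulo \<open>p\<close>
without shorter zero-sum subsequences is constant. Finally the sum of \<open>F\<close> over the \<open>p\<close> shifts of a
proper zero-sum block is zero, because it contains the orbit sum of that block.

It follows that \<open>F\<close> vanishes as soon as there are \<open>p + 1\<close> zero-sum blocks. Olson's theorem on
zero-sum subsequences (\<open>zero_sum_subset_exists\<close>) always provides \<open>p\<close> blocks, most of them short,
meaning that they have at most \<open>p\<close> elements. If \<open>p \<ge> 5\<close>, for any two short zero-sum sets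
there is a third one disjoint from both, and hence shifting a short block has the same effect for all of them (\<open>shift_short\<close>).

Assume first that no \<open>k t\<close> vanishes modulo \<open>p\<close>. If a set with vanishing \<open>k\<close>-sum crosses two blocks, a
shift of one of the blocks turns it into a zero-sum block, along which the two can be cut anew
(\<open>recut_crossing\<close>). A partition with one block as large as possible and all others short is so
rigid that all blocks have \<open>p\<close> elements and all \<open>k t\<close> agree. In that case a cyclic exchange of the
elements of a transversal shows that shifting a short block has no effect at all
(\<open>constant_weight_not_nonvanishing\<close>), whereas the \<open>p\<close> shifts add up to zero; so \<open>F\<close> vanishes.

If \<open>k t\<close> vanishes for some \<open>t\<close>, then \<open>v t\<close> may be taken to be an eigenvector of the whole group, and the pair
\<open>(g, h)\<close> can be replaced by \<open>(g\<^sup>n h, g\<^sup>-\<^sup>1)\<close> so that its first member fixes \<open>v t\<close>. Fixed vectors are blocks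
of size one. Either two of them occur for the same pair, which yields \<open>p + 1\<close> blocks, or there are
so few that \<open>invariant_element_structure\<close> determines them: \<open>N = p\<^sup>2\<close>, exactly \<open>p\<close> of the \<open>k t\<close> vanish,
and all but one of these factors have the same weight under \<open>g\<close>. A third choice of the pair then
cuts this class into two zero-sum blocks, and there are \<open>p + 1\<close> blocks again.\<close>

section \<open>Zero-sum subsets modulo a prime\<close>

text \<open>Pairing \<open>W\<close> with \<open>insert x W\<close> replaces a product of \<open>card I\<close> affine factors by a combination of shorter
products. The alternating sum is thus an iterated difference, of order larger than the degree.\<close>

lemma alternating_sum_prod_eq_0:
  fixes a :: "'c \<Rightarrow> 'i \<Rightarrow> int"
  assumes "finite B" "finite I" "card I < card B"
  shows "(\<Sum>W\<in>Pow B. (-1) ^ card W * (\<Prod>i\<in>I. c i + (\<Sum>t\<in>W. a i t))) = 0"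
  using assms
proof (induction B arbitrary: c I rule: finite_induct)
  case empty
  then show ?case by simp
next
  case (insert x B)
  define L where "L W i = c i + (\<Sum>t\<in>W. a i t)" for W i
  have finW: "finite W" "x \<notin> W" if "W \<in> Pow B" for W
    using that insert.hyps by (auto intro: finite_subset)
  have disj: "Pow B \<inter> insert x ` Pow B = {}" using insert.hyps by auto
  have inj: "inj_on (insert x) (Pow B)" using insert.hyps by (auto simp: inj_on_def)
  have step: "(\<Prod>i\<in>I. L W i) - (\<Prod>i\<in>I. L W i + a i x)
      = - (\<Sum>J\<in>Pow I - {I}. (\<Prod>i\<in>I - J. a i x) * (\<Prod>i\<in>J. L W i))" for W
  proof -
    have "(\<Prod>i\<in>I. L W i + a i x) = (\<Sum>J\<in>Pow I. (\<Prod>i\<in>J. L W i) * (\<Prod>i\<in>I - J. a i x))"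
      using insert.prems by (intro prod_add) auto
    also have "\<dots> = (\<Prod>i\<in>I. L W i) + (\<Sum>J\<in>Pow I - {I}. (\<Prod>i\<in>J. L W i) * (\<Prod>i\<in>I - J. a i x))"
      using insert.prems by (subst sum.remove[of _ I]) auto
    finally show ?thesis by (simp add: mult.commute)
  qed
  have "(\<Sum>W\<in>Pow (insert x B). (-1) ^ card W * (\<Prod>i\<in>I. L W i))
      = (\<Sum>W\<in>Pow B. (-1) ^ card W * (\<Prod>i\<in>I. L W i))
        + (\<Sum>W\<in>Pow B. (-1) ^ card (insert x W) * (\<Prod>i\<in>I. L (insert x W) i))"
    unfolding Pow_insert using insert.hyps disj
    by (subst sum.union_disjoint) (auto simp: sum.reindex[OF inj])
  also have "\<dots> = (\<Sum>W\<in>Pow B. (-1) ^ card W * ((\<Prod>i\<in>I. L W i) - (\<Prod>i\<in>I. L W i + a i x)))"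
    unfolding sum.distrib[symmetric]
  proof (rule sum.cong[OF refl])
    fix W assume W: "W \<in> Pow B"
    have "L (insert x W) i = L W i + a i x" for i
      using finW[OF W] by (simp add: L_def)
    then show "(-1) ^ card W * (\<Prod>i\<in>I. L W i) + (-1) ^ card (insert x W) * (\<Prod>i\<in>I. L (insert x W) i)
        = (-1) ^ card W * ((\<Prod>i\<in>I. L W i) - (\<Prod>i\<in>I. L W i + a i x))"
      using finW[OF W] by (simp add: algebra_simps)
  qed
  also have "\<dots> = - (\<Sum>J\<in>Pow I - {I}. (\<Prod>i\<in>I - J. a i x)
        * (\<Sum>W\<in>Pow B. (-1) ^ card W * (\<Prod>i\<in>J. L W i)))"
    unfolding step sum_distrib_left sum_negf[symmetric]
    by (subst sum.swap) (auto intro!: sum.cong)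
  also have "\<dots> = 0"
  proof -
    have "(\<Sum>W\<in>Pow B. (-1) ^ card W * (\<Prod>i\<in>J. L W i)) = 0" if "J \<in> Pow I - {I}" for J
    proof -
      have "card J < card I" using that insert.prems by (auto intro: psubset_card_mono)
      then show ?thesis unfolding L_def
        using insert that by (intro insert.IH) (auto intro: finite_subset)
    qed
    then show ?thesis by simp
  qed
  finally show ?case unfolding L_def .
qed

text \<open>Olson's theorem for elementary abelian groups, where \<open>I\<close> indexes the coordinates. The indicator of the subsets
with vanishing sums is, modulo \<open>p\<close>, a polynomial of degree \<open>card I * (p - 1)\<close> in the indicator of
the subset. Its alternating sum over all subsets vanishes, so the empty set is not the only one.\<close>

lemma zero_sum_subset_exists:
  fixes a :: "'c \<Rightarrow> 'i \<Rightarrow> int"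
  assumes p: "Factorial_Ring.prime (p::nat)" and B: "finite B" and I: "finite I"
    and large: "card I * (p - 1) < card B"
  shows "\<exists>W\<subseteq>B. W \<noteq> {} \<and> (\<forall>c\<in>I. int p dvd (\<Sum>t\<in>W. a c t))"
proof (rule ccontr)
  assume no: "\<not> ?thesis"
  have p1: "p > 1" using p prime_gt_1_nat by blast
  define L where "L W c = (\<Sum>t\<in>W. a c t)" for W c
  \<comment> \<open>By Fermat's little theorem, \<open>P W\<close> is 1 modulo \<open>p\<close> if all sums over \<open>W\<close> vanish, and 0 otherwise.\<close>
  define P where "P W = (\<Prod>c\<in>I. 1 - L W c ^ (p - 1))" for W
  have expand: "P W = (\<Sum>C\<in>Pow I. (-1) ^ card C * (\<Prod>i\<in>C \<times> {..<p-1}. 0 + (\<Sum>t\<in>W. a (fst i) t)))" for W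
  proof -
    have "P W = (\<Prod>c\<in>I. - (L W c ^ (p - 1)) + 1)"
      by (simp add: P_def)
    also have "\<dots> = (\<Sum>C\<in>Pow I. (\<Prod>c\<in>C. - (L W c ^ (p - 1))) * (\<Prod>c\<in>I - C. 1))"
      using I by (rule prod_add)
    also have "\<dots> = (\<Sum>C\<in>Pow I. (-1) ^ card C * (\<Prod>i\<in>C \<times> {..<p-1}. 0 + (\<Sum>t\<in>W. a (fst i) t)))"
    proof (rule sum.cong[OF refl])
      fix C assume "C \<in> Pow I"
      then have C: "finite C" using I finite_subset by auto
      have "(\<Prod>c\<in>C. - (L W c ^ (p - 1))) = (-1) ^ card C * (\<Prod>c\<in>C. L W c ^ (p - 1))"
        by (simp add: prod_uminus)
      also have "(\<Prod>c\<in>C. L W c ^ (p - 1)) = (\<Prod>c\<in>C. \<Prod>i<p-1. L W c)" by simp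
      also have "\<dots> = (\<Prod>(c,i)\<in>C \<times> {..<p-1}. L W c)"
        by (rule prod.cartesian_product)
      also have "\<dots> = (\<Prod>i\<in>C \<times> {..<p-1}. 0 + (\<Sum>t\<in>W. a (fst i) t))"
        by (rule prod.cong) (auto simp: L_def)
      finally show "(\<Prod>c\<in>C. - (L W c ^ (p - 1))) * (\<Prod>c\<in>I - C. 1)
        = (-1) ^ card C * (\<Prod>i\<in>C \<times> {..<p-1}. 0 + (\<Sum>t\<in>W. a (fst i) t))" by simp
    qed
    finally show ?thesis .
  qed
  have zero: "(\<Sum>W\<in>Pow B. (-1) ^ card W * P W) = 0"
  proof -
    have "(\<Sum>W\<in>Pow B. (-1) ^ card W * P W) = (\<Sum>C\<in>Pow I. (-1) ^ card C *
        (\<Sum>W\<in>Pow B. (-1) ^ card W * (\<Prod>i\<in>C \<times> {..<p-1}. 0 + (\<Sum>t\<in>W. a (fst i) t))))"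
      unfolding expand sum_distrib_left by (subst sum.swap) (simp add: mult.left_commute)
    also have "\<dots> = 0"
    proof (rule sum.neutral, rule ballI)
      fix C assume "C \<in> Pow I"
      then have C: "finite C" "card C \<le> card I" using I by (auto intro: finite_subset card_mono)
      have "card (C \<times> {..<p-1}) < card B"
        using C large by (metis card_cartesian_product card_lessThan le_less_trans mult_le_mono1)
      then show "(-1) ^ card C * (\<Sum>W\<in>Pow B. (-1) ^ card W *
          (\<Prod>i\<in>C \<times> {..<p-1}. 0 + (\<Sum>t\<in>W. a (fst i) t))) = 0"
        using C B by (subst alternating_sum_prod_eq_0) auto
    qed
    finally show ?thesis .
  qed
  have dvd: "int p dvd (-1) ^ card W * P W" if W: "W \<in> Pow B - {{}}" for W
  proof -
    obtain c where c: "c \<in> I" "\<not> int p dvd L W c" using no W unfolding L_def by blast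
    have "int p dvd L W c ^ (p - 1) - 1"
    proof -
      define r where "r = nat (L W c mod int p)"
      have r: "int r = L W c mod int p" using p1 by (simp add: r_def)
      have "\<not> p dvd r" using c(2) r
        by (metis dvd_imp_mod_0 int_dvd_int_iff mod_0_imp_dvd mod_mod_trivial)
      then have "[r ^ (p - 1) = 1] (mod p)" using p by (rule fermat_theorem[rotated])
      then have "[int r ^ (p - 1) = 1] (mod int p)"
        by (metis cong_int_iff of_nat_1 of_nat_power)
      moreover have "[int r ^ (p - 1) = L W c ^ (p - 1)] (mod int p)"
        unfolding r by (intro cong_pow) (simp add: cong_def)
      ultimately show ?thesis by (metis cong_iff_dvd_diff cong_sym cong_trans)
    qed
    then have "int p dvd 1 - L W c ^ (p - 1)" by (simp add: dvd_diff_commute)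
    then have "int p dvd P W" unfolding P_def using c I by (meson dvd_prodI dvd_trans)
    then show ?thesis by simp
  qed
  have "P {} = 1" using p1 by (simp add: P_def L_def power_0_left)
  then have "(\<Sum>W\<in>Pow B. (-1) ^ card W * P W) = 1 + (\<Sum>W\<in>Pow B - {{}}. (-1) ^ card W * P W)"
    using B by (subst sum.remove[of _ "{}"]) auto
  with zero have "1 = - (\<Sum>W\<in>Pow B - {{}}. (-1) ^ card W * P W)" by linarith
  moreover have "int p dvd (\<Sum>W\<in>Pow B - {{}}. (-1) ^ card W * P W)"
    using dvd by (rule dvd_sum)
  ultimately have "int p dvd 1" by (metis dvd_minus_iff)
  then show False using p1 by simp
qed

definition shifted_subset_sums :: "nat \<Rightarrow> int set \<Rightarrow> ('i \<Rightarrow> int) \<Rightarrow> 'i set \<Rightarrow> int set" where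
  "shifted_subset_sums p A f Q = {(a + sum f E) mod int p | a E. a \<in> A \<and> E \<subseteq> Q}"

text \<open>A set of residues that is stable under the translation by \<open>x\<close> contains all multiples of \<open>x\<close>, hence
everything. This is the Cauchy--Davenport inequality for the summand \<open>{0, x}\<close>.\<close>

lemma translate_union_card:
  assumes p: "Factorial_Ring.prime (p::nat)" and A: "A \<subseteq> {0..<int p}" "A \<noteq> {}" and x: "\<not> int p dvd x"
  shows "card (A \<union> (\<lambda>a. (a + x) mod int p) ` A) \<ge> min p (card A + 1)"
proof (cases "(\<lambda>a. (a + x) mod int p) ` A \<subseteq> A")
  case False
  then obtain y where y: "y \<in> (\<lambda>a. (a + x) mod int p) ` A" "y \<notin> A" by blast
  have "finite A" using A finite_subset by blast
  then have "card (insert y A) \<le> card (A \<union> (\<lambda>a. (a + x) mod int p) ` A)"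
    using y by (intro card_mono) auto
  then show ?thesis using y \<open>finite A\<close> by simp
next
  case True
  have p0: "int p > 0" using p prime_gt_0_nat by simp
  obtain a where a: "a \<in> A" using A by blast
  have mem: "(a + int n * x) mod int p \<in> A" for n
  proof (induction n)
    case 0
    then show ?case using a A by (simp add: subset_iff)
  next
    case (Suc n)
    have "((a + int n * x) mod int p + x) mod int p \<in> A" using True Suc by blast
    then show ?case by (simp add: mod_simps algebra_simps)
  qed
  have "{0..<int p} \<subseteq> A"
  proof
    fix y assume y: "y \<in> {0..<int p}"
    have "coprime x (int p)" using x p
      by (metis coprime_commute prime_imp_coprime prime_nat_int_transfer)
    then obtain z where z: "[x * z = y - a] (mod int p)"
      by (metis cong_solve_coprime_int cong_scalar_right mult.assoc mult.commute mult_1)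
    define n where "n = nat (z mod int p)"
    have n: "int n = z mod int p" using p0 by (simp add: n_def)
    have "[a + int n * x = a + (y - a)] (mod int p)"
      unfolding n using z by (intro cong_add cong_refl) (simp add: cong_def mod_simps mult.commute)
    then have "(a + int n * x) mod int p = y" using y by (simp add: cong_def)
    then show "y \<in> A" using mem by metis
  qed
  then have "card {0..<int p} \<le> card (A \<union> (\<lambda>a. (a + x) mod int p) ` A)"
    using A finite_subset[OF A(1)] by (intro card_mono) auto
  then show ?thesis by simp
qed

lemma card_shifted_subset_sums:
  assumes p: "Factorial_Ring.prime (p::nat)" and A: "A \<subseteq> {0..<int p}" "A \<noteq> {}"
    and Q: "finite Q" "\<And>t. t \<in> Q \<Longrightarrow> \<not> int p dvd f t"
  shows "card (shifted_subset_sums p A f Q) \<ge> min p (card A + card Q)"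
  using Q
proof (induction Q rule: finite_induct)
  case empty
  have "shifted_subset_sums p A f {} = A"
    using A unfolding shifted_subset_sums_def by (auto simp: subset_iff) (metis atLeastLessThan_iff mod_pos_pos_trivial)
  then show ?case by simp
next
  case (insert x Q)
  define S where "S = shifted_subset_sums p A f Q"
  have p0: "int p > 0" using p prime_gt_0_nat by simp
  have S: "S \<subseteq> {0..<int p}" using p0 by (auto simp: S_def shifted_subset_sums_def)
  have "S \<noteq> {}" using A by (auto simp: S_def shifted_subset_sums_def)
  have "S \<union> (\<lambda>a. (a + f x) mod int p) ` S \<subseteq> shifted_subset_sums p A f (insert x Q)"
  proof
    fix y assume "y \<in> S \<union> (\<lambda>a. (a + f x) mod int p) ` S"
    then consider "y \<in> S" | z where "z \<in> S" "y = (z + f x) mod int p" by blast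
    then show "y \<in> shifted_subset_sums p A f (insert x Q)"
    proof cases
      case 1
      then show ?thesis unfolding S_def shifted_subset_sums_def by blast
    next
      case 2
      then obtain a E where E: "a \<in> A" "E \<subseteq> Q" "z = (a + sum f E) mod int p"
        unfolding S_def shifted_subset_sums_def by blast
      have "finite E" "x \<notin> E" using E insert.hyps finite_subset by auto
      then have "y = (a + sum f (insert x E)) mod int p"
        using 2 E by (simp add: mod_simps algebra_simps)
      then show ?thesis using E unfolding shifted_subset_sums_def by blast
    qed
  qed
  moreover have "finite (shifted_subset_sums p A f (insert x Q))"
    by (rule finite_subset[of _ "{0..<int p}"]) (use p0 in \<open>auto simp: shifted_subset_sums_def\<close>)
  ultimately have "card (S \<union> (\<lambda>a. (a + f x) mod int p) ` S) \<le> card (shifted_subset_sums p A f (insert x Q))"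
    by (rule card_mono[rotated])
  moreover have "card (S \<union> (\<lambda>a. (a + f x) mod int p) ` S) \<ge> min p (card S + 1)"
    using S \<open>S \<noteq> {}\<close> insert.prems by (intro translate_union_card[OF p]) auto
  moreover have "card S \<ge> min p (card A + card Q)"
    unfolding S_def using insert by auto
  ultimately show ?case using insert.hyps by simp
qed

lemma shifted_subset_sums_everything:
  assumes p: "Factorial_Ring.prime (p::nat)" and A: "A \<subseteq> {0..<int p}" "A \<noteq> {}"
    and Q: "finite Q" "\<And>t. t \<in> Q \<Longrightarrow> \<not> int p dvd f t"
    and large: "card A + card Q \<ge> p"
  shows "\<exists>a\<in>A. \<exists>E\<subseteq>Q. int p dvd a + sum f E - y"
proof -
  have p0: "int p > 0" using p prime_gt_0_nat by simp
  have "card (shifted_subset_sums p A f Q) \<ge> p"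
    using card_shifted_subset_sums[OF p A Q] large by simp
  moreover have "shifted_subset_sums p A f Q \<subseteq> {0..<int p}"
    using p0 by (auto simp: shifted_subset_sums_def)
  ultimately have "shifted_subset_sums p A f Q = {0..<int p}"
    by (intro card_seteq) auto
  then have "y mod int p \<in> shifted_subset_sums p A f Q" using p0 by simp
  then show ?thesis unfolding shifted_subset_sums_def
    by clarsimp (metis mod_eq_dvd_iff)
qed

text \<open>If \<open>f x\<close> and \<open>f y\<close> differed, then \<open>0\<close>, \<open>f x\<close> and \<open>f y\<close> would be three attainable sums using at most
one of \<open>x\<close> and \<open>y\<close>. The elements other than \<open>x\<close>, \<open>y\<close> and a reserved element \<open>z\<close> enlarge them to all
residues, among them \<open>- f z\<close>; adding \<open>z\<close> gives a proper zero-sum subset.\<close>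

lemma minimal_zero_sum_constant:
  assumes p: "Factorial_Ring.prime (p::nat)" "p \<ge> 3" and B: "finite B" "card B = p"
    and min: "\<And>W. W \<subseteq> B \<Longrightarrow> W \<noteq> {} \<Longrightarrow> W \<noteq> B \<Longrightarrow> \<not> int p dvd sum f W"
    and x: "x \<in> B" and y: "y \<in> B"
  shows "int p dvd f x - f y"
proof (rule ccontr)
  assume neq: "\<not> int p dvd f x - f y"
  then have "x \<noteq> y" by auto
  have p0: "int p > 0" using p by simp
  have nz: "\<not> int p dvd f t" if "t \<in> B" for t
  proof -
    have "{t} \<noteq> B" using B p by auto
    then show ?thesis using min[of "{t}"] that by simp
  qed
  have "card (B - {x, y}) = p - 2" using B x y \<open>x \<noteq> y\<close> by (simp add: card_Diff_subset)
  then have "B - {x, y} \<noteq> {}" using p by (intro notI) simp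
  then obtain z where z: "z \<in> B - {x, y}" by blast
  define A where "A = {0, f x mod int p, f y mod int p}"
  have "card A = 3"
  proof -
    have "f x mod int p \<noteq> 0" "f y mod int p \<noteq> 0" using nz x y by (auto simp: dvd_eq_mod_eq_0)
    moreover have "f x mod int p \<noteq> f y mod int p" using neq by (simp add: mod_eq_dvd_iff)
    ultimately show ?thesis by (simp add: A_def)
  qed
  define Q where "Q = B - {x, y, z}"
  have "card Q = p - 3" unfolding Q_def using B x y z \<open>x \<noteq> y\<close>
    by (subst card_Diff_subset) auto
  have "\<exists>a\<in>A. \<exists>E\<subseteq>Q. int p dvd a + sum f E - (- f z)"
    using p0 B nz \<open>card A = 3\<close> \<open>card Q = p - 3\<close> p
    by (intro shifted_subset_sums_everything[OF p(1)]) (auto simp: A_def Q_def)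
  then obtain a E where E: "a \<in> A" "E \<subseteq> Q" "int p dvd a + sum f E + f z" by auto
  have fE: "finite E" "x \<notin> E" "y \<notin> E" "z \<notin> E" "E \<subseteq> B" using E B finite_subset unfolding Q_def by auto
  have zz: "z \<in> B" "z \<noteq> x" "z \<noteq> y" using z by auto
  consider "a = 0" | "a = f x mod int p" | "a = f y mod int p" using E A_def by auto
  then show False
  proof cases
    case 1
    then have "int p dvd sum f (insert z E)" using E fE by (simp add: add.commute)
    moreover have "insert z E \<noteq> B" using x fE zz by auto
    ultimately show False using min[of "insert z E"] fE zz by auto
  next
    case 2
    then have "int p dvd f x mod int p + (sum f E + f z)" using E by (simp add: add.assoc)
    then have "int p dvd f x + (sum f E + f z)"
      by (metis dvd_eq_mod_eq_0 mod_add_left_eq)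
    then have "int p dvd sum f (insert x (insert z E))" using fE zz by (simp add: algebra_simps)
    moreover have "insert x (insert z E) \<noteq> B" using y \<open>x \<noteq> y\<close> fE zz by auto
    ultimately show False using min[of "insert x (insert z E)"] fE zz x by auto
  next
    case 3
    then have "int p dvd f y mod int p + (sum f E + f z)" using E by (simp add: add.assoc)
    then have "int p dvd f y + (sum f E + f z)"
      by (metis dvd_eq_mod_eq_0 mod_add_left_eq)
    then have "int p dvd sum f (insert y (insert z E))" using fE zz by (simp add: algebra_simps)
    moreover have "insert y (insert z E) \<noteq> B" using x \<open>x \<noteq> y\<close> fE zz by auto
    ultimately show False using min[of "insert y (insert z E)"] fE zz y by auto
  qed
qed

section \<open>Shear systems: shifting zero-sum blocks\<close>

text \<open>The second generator of the group maps a vector of weight \<open>(s, k)\<close> to one of weight \<open>(s + k, k)\<close>; the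
exponent \<open>j t\<close> says how often it has been applied to the factor \<open>t\<close>.\<close>

definition sheared_weight :: "('i \<Rightarrow> int) \<Rightarrow> ('i \<Rightarrow> int) \<Rightarrow> ('i \<Rightarrow> int) \<Rightarrow> 'i \<Rightarrow> int" where
  "sheared_weight s k j t = s t + j t * k t"

definition zero_sum :: "nat \<Rightarrow> ('i \<Rightarrow> int) \<Rightarrow> ('i \<Rightarrow> int) \<Rightarrow> ('i \<Rightarrow> int) \<Rightarrow> 'i set \<Rightarrow> bool" where
  "zero_sum p s k j W \<longleftrightarrow> int p dvd sum k W \<and> int p dvd sum (sheared_weight s k j) W"

definition fibre :: "'i set \<Rightarrow> ('i \<Rightarrow> nat) \<Rightarrow> nat \<Rightarrow> 'i set" where
  "fibre R \<pi> i = {t \<in> R. \<pi> t = i}"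

definition zero_sum_colouring ::
    "nat \<Rightarrow> ('i \<Rightarrow> int) \<Rightarrow> ('i \<Rightarrow> int) \<Rightarrow> ('i \<Rightarrow> int) \<Rightarrow> 'i set \<Rightarrow> nat \<Rightarrow> ('i \<Rightarrow> nat) \<Rightarrow> bool" where
  "zero_sum_colouring p s k j R q \<pi> \<longleftrightarrow>
     (\<forall>t\<in>R. \<pi> t < q) \<and> (\<forall>i<q. fibre R \<pi> i \<noteq> {} \<and> zero_sum p s k j (fibre R \<pi> i))"

definition shift :: "('i \<Rightarrow> int) \<Rightarrow> 'i set \<Rightarrow> int \<Rightarrow> 'i \<Rightarrow> int" where
  "shift j W c = (\<lambda>t. if t \<in> W then j t + c else j t)"

lemma dvd_diff_imp_dvd_iff: "(d::int) dvd a - b \<Longrightarrow> d dvd a \<longleftrightarrow> d dvd b"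
  using dvd_add[of d "a - b" b] dvd_diff[of d a "a - b"] by auto

text \<open>Here \<open>F j\<close> stands for the value of a functional at the product of the factors \<open>t \<in> T\<close>, the factor \<open>t\<close>
having initial weight \<open>(s t, k t)\<close> and having been moved \<open>j t\<close> times. The functional is constant on orbits
and vanishes on decomposable forms; \<open>shear_system_monomials\<close> derives the axioms from this.\<close>

locale shear_system =
  fixes p :: nat and T :: "'i set" and s k :: "'i \<Rightarrow> int" and F :: "('i \<Rightarrow> int) \<Rightarrow> 'k::field"
  assumes p_prime: "Factorial_Ring.prime p" and p_ge_5: "5 \<le> p"
    and finite_T: "finite T" and card_T: "p\<^sup>2 \<le> card T"
    and p_nonzero: "of_nat p \<noteq> (0::'k)"
    and F_cong: "\<And>j j'. (\<And>t. t \<in> T \<Longrightarrow> int p dvd j t - j' t) \<Longrightarrow> F j = F j'"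
    and F_zero_sum: "\<And>j. F j \<noteq> 0 \<Longrightarrow> zero_sum p s k j T"
    and F_total_shift: "\<And>j \<pi> d d'. zero_sum_colouring p s k j T p \<pi> \<Longrightarrow>
      int p dvd (\<Sum>i<p. d i) - (\<Sum>i<p. d' i) \<Longrightarrow> F (\<lambda>t. j t + d (\<pi> t)) = F (\<lambda>t. j t + d' (\<pi> t))"
    and F_shift_sum: "\<And>j W. W \<subseteq> T \<Longrightarrow> W \<noteq> {} \<Longrightarrow> W \<noteq> T \<Longrightarrow> zero_sum p s k j W \<Longrightarrow>
      (\<Sum>c<p. F (shift j W (int c))) = 0"
begin

abbreviation "zs \<equiv> zero_sum p s k"
abbreviation "colouring \<equiv> zero_sum_colouring p s k"
abbreviation "weight \<equiv> sheared_weight s k"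

lemma finite_sub: "W \<subseteq> T \<Longrightarrow> finite W"
  using finite_T finite_subset by blast

lemma zs_diff: "zs j W \<Longrightarrow> zs j U \<Longrightarrow> U \<subseteq> W \<Longrightarrow> W \<subseteq> T \<Longrightarrow> zs j (W - U)"
  unfolding zero_sum_def by (simp add: sum_diff finite_sub)

lemma zs_union: "zs j W \<Longrightarrow> zs j U \<Longrightarrow> U \<inter> W = {} \<Longrightarrow> U \<subseteq> T \<Longrightarrow> W \<subseteq> T \<Longrightarrow> zs j (U \<union> W)"
  unfolding zero_sum_def by (simp add: sum.union_disjoint finite_sub)

lemma zs_cong: "zs j W \<Longrightarrow> (\<And>t. t \<in> W \<Longrightarrow> j' t = j t) \<Longrightarrow> zs j' W"
  unfolding zero_sum_def by (simp add: sheared_weight_def cong: sum.cong)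

lemma zs_cong_mod:
  assumes "\<And>t. t \<in> W \<Longrightarrow> int p dvd j t - j' t"
  shows "zs j W \<longleftrightarrow> zs j' W"
proof -
  have "(\<Sum>t\<in>W. weight j t) - (\<Sum>t\<in>W. weight j' t) = (\<Sum>t\<in>W. (j t - j' t) * k t)"
    unfolding sum_subtractf[symmetric]
    by (rule sum.cong) (simp_all add: sheared_weight_def algebra_simps)
  moreover have "int p dvd (\<Sum>t\<in>W. (j t - j' t) * k t)"
  proof (rule dvd_sum)
    fix t assume "t \<in> W"
    then show "int p dvd (j t - j' t) * k t" using assms dvd_mult2 by blast
  qed
  ultimately have "int p dvd (\<Sum>t\<in>W. weight j t) \<longleftrightarrow> int p dvd (\<Sum>t\<in>W. weight j' t)"
    by (intro dvd_diff_imp_dvd_iff) (simp only:)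
  then show ?thesis by (simp add: zero_sum_def)
qed

lemma zs_shift_const:
  assumes "zs j W" "\<And>t. t \<in> W \<Longrightarrow> j' t = j t + c"
  shows "zs j' W"
proof -
  have "(\<Sum>t\<in>W. weight j' t) = (\<Sum>t\<in>W. weight j t) + c * sum k W"
    using assms(2) by (simp add: sheared_weight_def algebra_simps sum.distrib sum_distrib_left)
  then show ?thesis using assms(1) unfolding zero_sum_def by simp
qed

lemma weight_sum_shift:
  assumes "finite D"
  shows "(\<Sum>t\<in>D. weight (shift j W c) t) = (\<Sum>t\<in>D. weight j t) + c * sum k (D \<inter> W)"
proof -
  have "(\<Sum>t\<in>D. weight (shift j W c) t) = (\<Sum>t\<in>D. weight j t + (if t \<in> W then c * k t else 0))"
    by (rule sum.cong) (auto simp: sheared_weight_def shift_def algebra_simps)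
  also have "\<dots> = (\<Sum>t\<in>D. weight j t) + (\<Sum>t\<in>D \<inter> W. c * k t)"
    using assms by (simp only: sum.distrib sum.inter_restrict)
  also have "(\<Sum>t\<in>D \<inter> W. c * k t) = c * sum k (D \<inter> W)"
    by (rule sum_distrib_left[symmetric])
  finally show ?thesis .
qed

lemma colouring_shift:
  assumes "colouring j R q \<pi>"
  shows "colouring (\<lambda>t. j t + d (\<pi> t)) R q \<pi>"
proof -
  have "zs (\<lambda>t. j t + d (\<pi> t)) (fibre R \<pi> i)" if "zs j (fibre R \<pi> i)" for i
    using that by (rule zs_shift_const[where c = "d i"]) (simp add: fibre_def)
  then show ?thesis using assms unfolding zero_sum_colouring_def by blast
qed

lemma colouring_extend:
  assumes "colouring j (R - W) q \<pi>" "W \<subseteq> R" "W \<noteq> {}" "zs j W"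
  shows "colouring j R (Suc q) (\<lambda>t. if t \<in> W then q else \<pi> t)"
    and "fibre R (\<lambda>t. if t \<in> W then q else \<pi> t) q = W"
    and "\<And>i. i < q \<Longrightarrow> fibre R (\<lambda>t. if t \<in> W then q else \<pi> t) i = fibre (R - W) \<pi> i"
proof -
  let ?\<rho> = "\<lambda>t. if t \<in> W then q else \<pi> t"
  have lt: "\<pi> t < q" if "t \<in> R - W" for t
    using assms(1) that unfolding zero_sum_colouring_def by blast
  show A: "fibre R ?\<rho> q = W" using assms(2) lt by (force simp: fibre_def)
  show B: "fibre R ?\<rho> i = fibre (R - W) \<pi> i" if "i < q" for i using that by (auto simp: fibre_def)
  show "colouring j R (Suc q) ?\<rho>"
    unfolding zero_sum_colouring_def
  proof (intro conjI ballI allI impI)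
    fix t assume "t \<in> R" then show "?\<rho> t < Suc q" using lt by (auto simp: less_Suc_eq)
  next
    fix i assume "i < Suc q"
    then consider "i = q" | "i < q" by linarith
    then show "fibre R ?\<rho> i \<noteq> {}" "zs j (fibre R ?\<rho> i)"
      using A B assms by (cases; auto simp: zero_sum_colouring_def)+
  qed
qed

lemma colouring_zs:
  assumes "colouring j R q \<pi>" "R \<subseteq> T"
  shows "zs j R"
proof -
  have fR: "finite R" using assms finite_sub by blast
  have img: "\<pi> ` R \<subseteq> {..<q}" using assms by (auto simp: zero_sum_colouring_def)
  have "sum h R = (\<Sum>i<q. sum h (fibre R \<pi> i))" for h :: "'i \<Rightarrow> int"
    using sum.group[OF fR finite_lessThan img, of h] by (simp add: fibre_def)
  moreover have "int p dvd (\<Sum>i<q. sum k (fibre R \<pi> i))" "int p dvd (\<Sum>i<q. sum (weight j) (fibre R \<pi> i))"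
    by (rule dvd_sum, use assms in \<open>simp add: zero_sum_def zero_sum_colouring_def\<close>)+
  ultimately show ?thesis unfolding zero_sum_def by metis
qed

lemma fibre_sub: "fibre R \<pi> i \<subseteq> R" by (auto simp: fibre_def)

lemma zs_exists:
  assumes "R \<subseteq> T" "card R \<ge> 2 * p - 1"
  shows "\<exists>W\<subseteq>R. W \<noteq> {} \<and> zs j W"
proof -
  have "\<exists>W\<subseteq>R. W \<noteq> {} \<and> (\<forall>c\<in>{True, False}. int p dvd (\<Sum>t\<in>W. (if c then k t else weight j t)))"
    using assms p_ge_5 by (intro zero_sum_subset_exists[OF p_prime]) (auto simp: finite_sub)
  then show ?thesis by (auto simp: zero_sum_def)
qed

text \<open>Counting elements is a third coordinate, so there is a zero-sum subset whose size is \<open>p\<close> or \<open>2 * p\<close>.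
In the second case removing an element leaves \<open>2 * p - 1\<close> elements, enough for a proper zero-sum
subset; this subset or its complement is short.\<close>

lemma short_zs_exists:
  assumes "R \<subseteq> T" "card R \<ge> 3 * p - 2"
  shows "\<exists>W\<subseteq>R. W \<noteq> {} \<and> card W \<le> p \<and> zs j W"
proof -
  obtain R' where R': "R' \<subseteq> R" "card R' = 3 * p - 2"
    using obtain_subset_with_card_n[OF assms(2)] by blast
  have RT: "R' \<subseteq> T" using R' assms by blast
  have "\<exists>W\<subseteq>R'. W \<noteq> {} \<and> (\<forall>c\<in>{0,1,2::nat}. int p dvd
      (\<Sum>t\<in>W. (if c = 0 then k t else if c = 1 then weight j t else 1)))"
    using R' p_ge_5 RT by (intro zero_sum_subset_exists[OF p_prime]) (auto simp: finite_sub)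
  then obtain W where W: "W \<subseteq> R'" "W \<noteq> {}" "zs j W" "int p dvd int (card W)"
    by (auto simp: zero_sum_def)
  have fW: "finite W" using W RT finite_sub by blast
  have "p dvd card W" using W by (simp only: int_dvd_int_iff)
  then obtain m where m: "card W = p * m" by blast
  have "card W \<le> 3 * p - 2" using W R' RT finite_sub by (metis card_mono)
  then have "p * m < p * 3" using m p_ge_5 by linarith
  then have "m < 3" by simp
  show ?thesis
  proof (cases "card W \<le> p")
    case True
    then show ?thesis using W R' by blast
  next
    case False
    then have "m \<noteq> 0" "m \<noteq> 1" using m by auto
    then have "m = 2" using \<open>m < 3\<close> by linarith
    then have "card W = 2 * p" using m by simp
    obtain x where x: "x \<in> W" using W by blast
    have "card (W - {x}) = 2 * p - 1" using \<open>card W = 2 * p\<close> x fW by simp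
    moreover have WT: "W \<subseteq> T" using W RT by blast
    ultimately obtain U where U: "U \<subseteq> W - {x}" "U \<noteq> {}" "zs j U"
      using zs_exists[of "W - {x}" j] by (metis Diff_subset dual_order.trans order_refl)
    have UW: "U \<subseteq> W" "W - U \<noteq> {}" using U x by blast+
    have "card U + card (W - U) = 2 * p"
      using \<open>card W = 2 * p\<close> UW fW by (metis card_Diff_subset card_mono finite_subset le_add_diff_inverse)
    then consider "card U \<le> p" | "card (W - U) \<le> p" by linarith
    then show ?thesis
    proof cases
      case 1
      moreover have "U \<subseteq> R" using UW W(1) R'(1) by (meson subset_trans)
      ultimately show ?thesis using U(2,3) by (intro exI[of _ U]) simp
    next
      case 2
      moreover have "zs j (W - U)" using W(3) U(3) UW(1) WT by (rule zs_diff)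
      moreover have "W - U \<subseteq> R" using W(1) R'(1) by (meson Diff_subset subset_trans)
      ultimately show ?thesis using UW(2) by (intro exI[of _ "W - U"]) simp
    qed
  qed
qed

text \<open>Short blocks are split off as long as at least \<open>3 * p - 2\<close> elements remain. The last cut, into the
blocks \<open>0\<close> and \<open>1\<close>, rests on \<open>zs_exists\<close>, which gives no bound on the sizes of these two.\<close>

lemma colouring_exists:
  assumes "R \<subseteq> T" "zs j R" "1 \<le> q" "q * p \<le> card R"
  shows "\<exists>\<pi>. colouring j R q \<pi> \<and> (\<forall>i. 2 \<le> i \<longrightarrow> i < q \<longrightarrow> card (fibre R \<pi> i) \<le> p)"
  using assms(3,1,2,4)
proof (induction q arbitrary: R rule: dec_induct)
  case base
  have "R \<noteq> {}" using base(3) p_ge_5 by auto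
  moreover have "fibre R (\<lambda>_. 0) 0 = R" by (auto simp: fibre_def)
  ultimately show ?case using base(2)
    by (intro exI[of _ "\<lambda>_. 0"]) (simp add: zero_sum_colouring_def)
next
  case (step q)
  have fR: "finite R" using step.prems(1) by (rule finite_sub)
  have "\<exists>W. W \<subseteq> R \<and> W \<noteq> {} \<and> zs j W \<and>
     (q * p \<le> card (R - W) \<and> (q \<ge> 2 \<longrightarrow> card W \<le> p) \<or> W \<noteq> R \<and> q = 1)"
  proof (cases "q \<ge> 2")
    case True
    have "3 * p \<le> Suc q * p" using True by (intro mult_right_mono) auto
    then have "card R \<ge> 3 * p - 2" using step.prems(3) by linarith
    then obtain W where W: "W \<subseteq> R" "W \<noteq> {}" "card W \<le> p" "zs j W"
      using short_zs_exists[OF step.prems(1)] by blast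
    moreover have "card (R - W) = card R - card W"
      using W(1) fR by (simp add: card_Diff_subset finite_subset)
    moreover have "q * p + p \<le> card R" using step.prems(3) by simp
    ultimately have "q * p \<le> card (R - W)" by linarith
    then show ?thesis using W by (intro exI[of _ W]) simp
  next
    case False
    then have q: "q = 1" using step.hyps by simp
    then have "R \<noteq> {}" using step.prems(3) p_ge_5 by auto
    then obtain x where x: "x \<in> R" by blast
    have "card (R - {x}) \<ge> 2 * p - 1" using x fR q step.prems(3) by simp
    moreover have "R - {x} \<subseteq> T" using step.prems(1) by blast
    ultimately obtain U where U: "U \<subseteq> R - {x}" "U \<noteq> {}" "zs j U"
      using zs_exists[of "R - {x}" j] by blast
    then have "U \<noteq> R" "U \<subseteq> R" using x by blast+
    then show ?thesis using U(2,3) q by (intro exI[of _ U]) simp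
  qed
  then obtain W where W: "W \<subseteq> R" "W \<noteq> {}" "zs j W"
     "q * p \<le> card (R - W) \<and> (q \<ge> 2 \<longrightarrow> card W \<le> p) \<or> W \<noteq> R \<and> q = 1" by blast
  have zsd: "zs j (R - W)" using step.prems(2) W(3,1) step.prems(1) by (rule zs_diff)
  show ?case
  proof (cases "W \<noteq> R \<and> q = 1")
    case True
    have "colouring j (R - W) 1 (\<lambda>_. 0)"
    proof -
      have "fibre (R - W) (\<lambda>_. 0) 0 = R - W" by (auto simp: fibre_def)
      then show ?thesis using True W(1) zsd by (auto simp: zero_sum_colouring_def)
    qed
    note ext = colouring_extend[OF this W(1-3)]
    show ?thesis using ext(1) True by (intro exI conjI) auto
  next
    case False
    then have W4: "q * p \<le> card (R - W)" "q \<ge> 2 \<Longrightarrow> card W \<le> p" using W(4) by auto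
    have RW: "R - W \<subseteq> T" using step.prems(1) by blast
    obtain \<pi> where \<pi>: "colouring j (R - W) q \<pi>" "\<forall>i. 2 \<le> i \<longrightarrow> i < q \<longrightarrow> card (fibre (R - W) \<pi> i) \<le> p"
      using step.IH[OF RW zsd W4(1)] by blast
    note ext = colouring_extend[OF \<pi>(1) W(1-3)]
    show ?thesis
    proof (intro exI conjI allI impI)
      show "colouring j R (Suc q) (\<lambda>t. if t \<in> W then q else \<pi> t)" by (rule ext)
      fix i :: nat assume i: "2 \<le> i" "i < Suc q"
      then consider "i = q" | "i < q" by linarith
      then show "card (fibre R (\<lambda>t. if t \<in> W then q else \<pi> t) i) \<le> p"
        using ext \<pi> W4 i by (cases; simp)
    qed
  qed
qed

text \<open>The surplus block \<open>p\<close> may be merged with block \<open>0\<close> or with block \<open>1\<close>. In the first case a shift of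
the blocks \<open>0\<close> and \<open>p\<close> can be moved to block \<open>2\<close>, and from there, in the second case, to block \<open>0\<close> alone.
So shifting the surplus block does not change \<open>F\<close>; but its \<open>p\<close> shifts add up to zero.\<close>

lemma F_eq_zero_of_many:
  assumes "colouring j T (Suc p) \<pi>"
  shows "F j = 0"
proof -
  define B where "B = fibre T \<pi> p"
  have lt: "\<pi> t < Suc p" if "t \<in> T" for t
    using assms that unfolding zero_sum_colouring_def by blast
  have merge: "colouring j' T p (\<lambda>t. if \<pi> t = p then m else \<pi> t)"
    if c: "colouring j' T (Suc p) \<pi>" and m: "m < p" for j' m
    unfolding zero_sum_colouring_def
  proof (intro conjI ballI allI impI)
    fix t assume "t \<in> T" then show "(if \<pi> t = p then m else \<pi> t) < p" using lt m by (force simp: less_Suc_eq)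
  next
    fix i assume i: "i < p"
    have eq: "fibre T (\<lambda>t. if \<pi> t = p then m else \<pi> t) i
       = (if i = m then fibre T \<pi> m \<union> fibre T \<pi> p else fibre T \<pi> i)"
      using i m by (auto simp: fibre_def)
    have "zs j' (fibre T \<pi> m \<union> fibre T \<pi> p)"
      using c m by (intro zs_union) (auto simp: zero_sum_colouring_def fibre_def)
    then show "fibre T (\<lambda>t. if \<pi> t = p then m else \<pi> t) i \<noteq> {}"
      and "zs j' (fibre T (\<lambda>t. if \<pi> t = p then m else \<pi> t) i)"
      unfolding eq using c i by (auto simp: zero_sum_colouring_def)
  qed
  have inv: "F (shift j' B 1) = F j'" if c: "colouring j' T (Suc p) \<pi>" for j'
  proof -
    \<comment> \<open>Block 0 is lowered first, so that raising it together with block \<open>p\<close> moves block \<open>p\<close> only.\<close>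
    define j0 where "j0 t = j' t + (if \<pi> t = 0 then - 1 else 0)" for t
    have c0: "colouring j0 T (Suc p) \<pi>" unfolding j0_def
      using colouring_shift[OF c, of "\<lambda>i. if i = 0 then - 1 else 0"] .
    let ?d = "\<lambda>i::nat. if i = 0 then 1 else (0::int)" and ?d' = "\<lambda>i::nat. if i = 2 then 1 else (0::int)"
    have eqd: "int p dvd (\<Sum>i<p. ?d i) - (\<Sum>i<p. ?d' i)"
      using p_ge_5 by (simp add: sum.delta)
    have "F (shift j' B 1) = F (\<lambda>t. j0 t + ?d (if \<pi> t = p then 0 else \<pi> t))"
      by (rule F_cong) (use p_ge_5 in \<open>auto simp: j0_def shift_def B_def fibre_def\<close>)
    also have "\<dots> = F (\<lambda>t. j0 t + ?d' (if \<pi> t = p then 0 else \<pi> t))"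
      using merge[OF c0, of 0] p_ge_5 eqd by (intro F_total_shift) auto
    also have "\<dots> = F (\<lambda>t. j0 t + ?d' (if \<pi> t = p then 1 else \<pi> t))"
      by (rule F_cong) (use p_ge_5 in auto)
    also have "\<dots> = F (\<lambda>t. j0 t + ?d (if \<pi> t = p then 1 else \<pi> t))"
      using merge[OF c0, of 1] p_ge_5 eqd by (intro F_total_shift[symmetric]) auto
    also have "\<dots> = F j'"
      by (rule F_cong) (use p_ge_5 in \<open>auto simp: j0_def\<close>)
    finally show ?thesis .
  qed
  have col: "colouring (shift j B c) T (Suc p) \<pi>" for c
  proof -
    have c: "colouring (\<lambda>t. j t + (if \<pi> t = p then c else 0)) T (Suc p) \<pi>"
      using colouring_shift[OF assms, of "\<lambda>i. if i = p then c else 0"] .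
    have "zs (shift j B c) (fibre T \<pi> i)"
      if "zs (\<lambda>t. j t + (if \<pi> t = p then c else 0)) (fibre T \<pi> i)" for i
      using that by (rule zs_cong) (simp add: shift_def B_def fibre_def)
    then show ?thesis using c unfolding zero_sum_colouring_def by blast
  qed
  have "F (shift j B (int c)) = F j" for c
  proof (induction c)
    case 0
    then show ?case by (intro F_cong) (auto simp: shift_def)
  next
    case (Suc c)
    have "F (shift j B (int (Suc c))) = F (shift (shift j B (int c)) B 1)"
      by (intro F_cong) (auto simp: shift_def)
    then show ?case using inv[OF col] Suc by simp
  qed
  moreover have "(\<Sum>c<p. F (shift j B (int c))) = 0"
  proof (rule F_shift_sum)
    have "fibre T \<pi> 0 \<noteq> {}" using assms by (auto simp: zero_sum_colouring_def)
    then obtain x where "x \<in> T" "\<pi> x = 0" by (auto simp: fibre_def)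
    moreover have "x \<notin> B" using p_ge_5 \<open>\<pi> x = 0\<close> by (auto simp: B_def fibre_def)
    ultimately show "B \<noteq> T" by blast
  qed (use assms in \<open>auto simp: B_def zero_sum_colouring_def fibre_def\<close>)
  ultimately have "of_nat p * F j = 0" by simp
  then show ?thesis using p_nonzero by simp
qed

text \<open>The complement of two disjoint short sets is large enough to be cut into \<open>p - 2\<close> zero-sum blocks, and
between the \<open>p\<close> blocks of the resulting colouring shifts may be moved.\<close>

lemma shift_disjoint:
  assumes j: "zs j T" and U: "U \<subseteq> T" "U \<noteq> {}" "zs j U" "card U \<le> p"
    and V: "V \<subseteq> T" "V \<noteq> {}" "zs j V" "card V \<le> p" and disj: "U \<inter> V = {}"
  shows "F (shift j U c) = F (shift j V c)"
proof -
  define R where "R = T - U - V"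
  have fin: "finite U" "finite V" using U V finite_sub by auto
  have "card R = card T - card U - card V"
    unfolding R_def using U V disj fin finite_T by (subst card_Diff_subset; (subst card_Diff_subset)?) auto
  moreover have "p\<^sup>2 - 2 * p = (p - 2) * p" by (simp add: power2_eq_square algebra_simps)
  ultimately have "(p - 2) * p \<le> card R" using card_T U V by linarith
  moreover have "zs j R"
  proof -
    have "zs j (T - U)" using j U(3,1) by (rule zs_diff) simp
    moreover have "V \<subseteq> T - U" using V(1) disj by blast
    ultimately show ?thesis unfolding R_def using V(3) by (intro zs_diff[of j "T - U" V]) auto
  qed
  moreover have "R \<subseteq> T" "1 \<le> p - 2" using p_ge_5 by (auto simp: R_def)
  ultimately obtain \<pi> where \<pi>: "colouring j R (p - 2) \<pi>"
    using colouring_exists[of R j "p - 2"] by blast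
  have VU: "V \<subseteq> T - U" using V disj by blast
  note e1 = colouring_extend[OF \<pi>[unfolded R_def] VU V(2,3)]
  note e2 = colouring_extend[OF e1(1) U(1-3)]
  let ?\<rho> = "\<lambda>t. if t \<in> U then Suc (p - 2) else if t \<in> V then p - 2 else \<pi> t"
  have pp: "Suc (Suc (p - 2)) = p" using p_ge_5 by simp
  have col: "colouring j T p ?\<rho>" using e2(1) pp by simp
  have lt: "\<pi> t < p - 2" if "t \<in> T" "t \<notin> U" "t \<notin> V" for t
    using \<pi> that unfolding zero_sum_colouring_def R_def by blast
  let ?d = "\<lambda>i. if i = Suc (p - 2) then c else 0" and ?d' = "\<lambda>i. if i = p - 2 then c else 0"
  have "Suc (p - 2) < p" "p - 2 < p" using p_ge_5 by auto
  then have eqd: "int p dvd (\<Sum>i<p. ?d i) - (\<Sum>i<p. ?d' i)"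
    by (simp add: sum.delta)
  have dU: "?d (?\<rho> t) = (if t \<in> U then c else 0)" if "t \<in> T" for t
    using lt[OF that] by (cases "t \<in> U"; cases "t \<in> V") auto
  have dV: "?d' (?\<rho> t) = (if t \<in> V then c else 0)" if "t \<in> T" for t
    using lt[OF that] disj by (cases "t \<in> U"; cases "t \<in> V") auto
  have "F (shift j U c) = F (\<lambda>t. j t + ?d (?\<rho> t))"
    by (rule F_cong) (simp add: shift_def dU)
  also have "\<dots> = F (\<lambda>t. j t + ?d' (?\<rho> t))" by (rule F_total_shift[OF col eqd])
  also have "\<dots> = F (shift j V c)"
    by (rule F_cong) (simp add: shift_def dV)
  finally show ?thesis .
qed

text \<open>Intersecting sets are compared through a third short set that misses both. It exists because
\<open>p\<^sup>2 - (2 * p - 1) \<ge> 3 * p - 2\<close> for \<open>p \<ge> 5\<close>.\<close>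

lemma shift_short:
  assumes j: "zs j T" and U: "U \<subseteq> T" "U \<noteq> {}" "zs j U" "card U \<le> p"
    and V: "V \<subseteq> T" "V \<noteq> {}" "zs j V" "card V \<le> p"
  shows "F (shift j U c) = F (shift j V c)"
proof (cases "U \<inter> V = {}")
  case True
  show ?thesis by (rule shift_disjoint[OF j U V True])
next
  case False
  have fin: "finite U" "finite V" by (rule finite_sub[OF U(1)], rule finite_sub[OF V(1)])
  have "card (U \<union> V) + card (U \<inter> V) = card U + card V" using card_Un_Int[OF fin] by simp
  moreover have "card (U \<inter> V) > 0" using False fin by (simp add: card_gt_0_iff)
  ultimately have "card (U \<union> V) \<le> 2 * p - 1" using U(4) V(4) by linarith
  moreover have "card (T - (U \<union> V)) = card T - card (U \<union> V)"
    using U(1) V(1) fin by (simp add: card_Diff_subset)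
  moreover have "5 * p \<le> p * p" using p_ge_5 by (rule mult_le_mono1)
  ultimately have "card (T - (U \<union> V)) \<ge> 3 * p - 2"
    using card_T unfolding power2_eq_square by linarith
  then obtain W where W: "W \<subseteq> T - (U \<union> V)" "W \<noteq> {}" "card W \<le> p" "zs j W"
    using short_zs_exists[of "T - (U \<union> V)" j] by blast
  have "F (shift j U c) = F (shift j W c)" using W(1) by (intro shift_disjoint[OF j U _ W(2,4,3)]) auto
  also have "\<dots> = F (shift j V c)" using W(1) by (intro shift_disjoint[OF j _ W(2,4,3) V]) auto
  finally show ?thesis .
qed

text \<open>The effect of shifting one short zero-sum block, which by \<open>shift_short\<close> is the same for all of them.\<close>

definition H :: "('i \<Rightarrow> int) \<Rightarrow> int \<Rightarrow> 'k" where
  "H j c = F (shift j (SOME W. W \<subseteq> T \<and> W \<noteq> {} \<and> zs j W \<and> card W \<le> p) c)"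

lemma H_eq:
  assumes j: "zs j T" and U: "U \<subseteq> T" "U \<noteq> {}" "zs j U" "card U \<le> p"
  shows "H j c = F (shift j U c)"
proof -
  define W where "W = (SOME W. W \<subseteq> T \<and> W \<noteq> {} \<and> zs j W \<and> card W \<le> p)"
  have "W \<subseteq> T \<and> W \<noteq> {} \<and> zs j W \<and> card W \<le> p"
    unfolding W_def by (rule someI[of _ U]) (use U in auto)
  then show ?thesis unfolding H_def W_def[symmetric] using shift_short[OF j _ _ _ _ U] by blast
qed

lemma H_cong:
  assumes "\<And>t. t \<in> T \<Longrightarrow> int p dvd j t - j' t"
  shows "H j c = H j' c"
proof -
  have "(W \<subseteq> T \<and> W \<noteq> {} \<and> zs j W \<and> card W \<le> p) = (W \<subseteq> T \<and> W \<noteq> {} \<and> zs j' W \<and> card W \<le> p)" for W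
    using zs_cong_mod[of W j j'] assms by (auto simp: subset_iff)
  then show ?thesis unfolding H_def using assms by (intro F_cong) (auto simp: shift_def)
qed

lemma H_0: assumes "zs j T" shows "H j 0 = F j"
proof -
  have "5 * p \<le> p * p" using p_ge_5 by (rule mult_le_mono1)
  then have "3 * p - 2 \<le> card T" using card_T unfolding power2_eq_square by linarith
  then obtain U where "U \<subseteq> T" "U \<noteq> {}" "zs j U" "card U \<le> p"
    using short_zs_exists[of T j] by blast
  then have "H j 0 = F (shift j U 0)" using assms H_eq by blast
  also have "\<dots> = F j" by (rule F_cong) (simp add: shift_def)
  finally show ?thesis .
qed

text \<open>All shifts can be concentrated on one short block.\<close>

lemma H_fibre_shift:
  assumes col: "colouring j T p \<pi>" and i: "i < p" "card (fibre T \<pi> i) \<le> p"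
  shows "H (\<lambda>t. j t + d (\<pi> t)) c = H j (c + (\<Sum>i<p. d i))"
proof -
  let ?B = "fibre T \<pi> i"
  let ?j' = "\<lambda>t. j t + d (\<pi> t)"
  have B: "?B \<subseteq> T" "?B \<noteq> {}" "zs j ?B" using col i by (auto simp: zero_sum_colouring_def fibre_def)
  have col': "colouring ?j' T p \<pi>" using col by (rule colouring_shift)
  then have B': "zs ?j' ?B" using i by (auto simp: zero_sum_colouring_def)
  have "H ?j' c = F (shift ?j' ?B c)"
    using colouring_zs[OF col'] B B' i by (intro H_eq) auto
  also have "\<dots> = F (\<lambda>t. j t + (d(i := d i + c)) (\<pi> t))"
    by (rule F_cong) (auto simp: shift_def fibre_def)
  also have "\<dots> = F (\<lambda>t. j t + (if \<pi> t = i then c + (\<Sum>i<p. d i) else 0))"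
  proof (rule F_total_shift[OF col, where d' = "\<lambda>l. if l = i then c + (\<Sum>i<p. d i) else 0"])
    have "(\<Sum>l<p. (d(i := d i + c)) l) = (\<Sum>l<p. d l + (if l = i then c else 0))"
      by (rule sum.cong) auto
    then show "int p dvd (\<Sum>l<p. (d(i := d i + c)) l) - (\<Sum>l<p. if l = i then c + (\<Sum>i<p. d i) else 0)"
      using i by (simp add: sum.distrib sum.delta)
  qed
  also have "\<dots> = F (shift j ?B (c + (\<Sum>i<p. d i)))"
    by (rule F_cong) (auto simp: shift_def fibre_def)
  also have "\<dots> = H j (c + (\<Sum>i<p. d i))"
    using colouring_zs[OF col] B i by (intro H_eq[symmetric]) auto
  finally show ?thesis .
qed

lemma H_one_fibre_shift:
  assumes col: "colouring j T p \<pi>" and i: "i < p" "card (fibre T \<pi> i) \<le> p" and l: "l < p"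
  shows "H (shift j (fibre T \<pi> l) d) c = H j (c + d)"
proof -
  have "H (\<lambda>t. j t + (if \<pi> t = l then d else 0)) c = H j (c + (\<Sum>i<p. if i = l then d else 0))"
    using H_fibre_shift[OF col i, of "\<lambda>i. if i = l then d else 0"] .
  moreover have "H (shift j (fibre T \<pi> l) d) c = H (\<lambda>t. j t + (if \<pi> t = l then d else 0)) c"
    by (rule H_cong) (auto simp: shift_def fibre_def)
  ultimately show ?thesis using l by (simp add: sum.delta)
qed

section \<open>Recutting blocks\<close>

text \<open>In contrast to \<open>F j \<noteq> 0\<close>, this condition survives all shifts of blocks, which merely translate the
function \<open>H j\<close>.\<close>

definition nonvanishing :: "('i \<Rightarrow> int) \<Rightarrow> bool" where
  "nonvanishing j \<longleftrightarrow> zs j T \<and> (\<exists>c. H j c \<noteq> 0)"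

lemma solve_mod:
  assumes "\<not> int p dvd \<kappa>"
  shows "\<exists>d. int p dvd a + d * \<kappa>"
proof -
  have "Factorial_Ring.prime (int p)" using p_prime by simp
  then have "coprime \<kappa> (int p)" using assms
    using prime_imp_coprime coprime_commute by blast
  then obtain z where z: "[\<kappa> * z = 1] (mod int p)"
    using cong_solve_coprime_int by blast
  then have "int p dvd 1 - \<kappa> * z" by (metis cong_iff_dvd_diff cong_sym)
  then have "int p dvd a * (1 - \<kappa> * z)" by simp
  then have "int p dvd a + (- a * z) * \<kappa>" by (simp add: algebra_simps)
  then show ?thesis by blast
qed

lemma prime_dvd_mult_int: "int p dvd a * b \<Longrightarrow> int p dvd a \<or> int p dvd b"
  using p_prime by (simp add: prime_dvd_mult_iff)

lemma fibre_colour: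
  "colouring j R q \<pi> \<Longrightarrow> i < q \<Longrightarrow> fibre R \<pi> i \<noteq> {}"
  "colouring j R q \<pi> \<Longrightarrow> i < q \<Longrightarrow> zs j (fibre R \<pi> i)"
  "colouring j R q \<pi> \<Longrightarrow> t \<in> R \<Longrightarrow> \<pi> t < q"
  unfolding zero_sum_colouring_def by blast+

lemma fibre_disjoint: "i \<noteq> l \<Longrightarrow> fibre R \<pi> i \<inter> fibre R \<pi> l = {}"
  by (auto simp: fibre_def)

lemma colouring_one_shift:
  assumes "colouring j R q \<pi>"
  shows "colouring (shift j (fibre R \<pi> i) d) R q \<pi>"
proof -
  have c: "colouring (\<lambda>t. j t + (if \<pi> t = i then d else 0)) R q \<pi>"
    using colouring_shift[OF assms, of "\<lambda>l. if l = i then d else 0"] .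
  have "zs (shift j (fibre R \<pi> i) d) (fibre R \<pi> l)"
    if "zs (\<lambda>t. j t + (if \<pi> t = i then d else 0)) (fibre R \<pi> l)" for l
    using that by (rule zs_cong) (auto simp: shift_def fibre_def)
  then show ?thesis using c unfolding zero_sum_colouring_def by blast
qed

text \<open>Two blocks of a colouring are cut anew along a zero-sum subset of their union.\<close>

lemma recolour:
  assumes col: "colouring j T p \<pi>" and il: "i < p" "l < p" "i \<noteq> l"
    and D: "zs j D" "D \<noteq> {}" "D \<subseteq> fibre T \<pi> i \<union> fibre T \<pi> l" "D \<noteq> fibre T \<pi> i \<union> fibre T \<pi> l"
  obtains \<pi>' where "colouring j T p \<pi>'" "fibre T \<pi>' l = D"
    "fibre T \<pi>' i = (fibre T \<pi> i \<union> fibre T \<pi> l) - D"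
    "\<And>m. m \<noteq> i \<Longrightarrow> m \<noteq> l \<Longrightarrow> fibre T \<pi>' m = fibre T \<pi> m"
proof -
  define \<pi>' where "\<pi>' t = (if t \<in> D then l else if \<pi> t = l then i else \<pi> t)" for t
  have l: "fibre T \<pi>' l = D" using D(3) il by (auto simp: \<pi>'_def fibre_def)
  have i: "fibre T \<pi>' i = (fibre T \<pi> i \<union> fibre T \<pi> l) - D"
    using D(3) il by (auto simp: \<pi>'_def fibre_def)
  have m: "fibre T \<pi>' m = fibre T \<pi> m" if "m \<noteq> i" "m \<noteq> l" for m
    using that D(3) il by (auto simp: \<pi>'_def fibre_def)
  have sub: "fibre T \<pi> i \<subseteq> T" "fibre T \<pi> l \<subseteq> T" by (rule fibre_sub)+
  have "zs j (fibre T \<pi> i \<union> fibre T \<pi> l)"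
    by (rule zs_union[OF fibre_colour(2)[OF col il(2)] fibre_colour(2)[OF col il(1)]
          fibre_disjoint[OF il(3)] sub])
  then have zi: "zs j ((fibre T \<pi> i \<union> fibre T \<pi> l) - D)"
    using D(1,3) by (rule zs_diff) (use sub in blast)
  have "colouring j T p \<pi>'"
    unfolding zero_sum_colouring_def
  proof (intro conjI ballI allI impI)
    fix t assume "t \<in> T"
    then show "\<pi>' t < p" using il fibre_colour(3)[OF col] by (simp add: \<pi>'_def)
  next
    fix n assume n: "n < p"
    consider "n = i" | "n = l" | "n \<noteq> i" "n \<noteq> l" by blast
    then show "fibre T \<pi>' n \<noteq> {}" and "zs j (fibre T \<pi>' n)"
      using l i m D(1,2,3,4) zi fibre_colour(1,2)[OF col n] by (cases; simp; blast)+
  qed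
  then show ?thesis using that l i m by blast
qed

lemma H_short_shift:
  assumes j: "zs j T" and U: "U \<subseteq> T" "U \<noteq> {}" "zs j U" "card U \<le> p"
  shows "zs (shift j U d) T" and "H (shift j U d) c = H j (c + d)"
proof -
  have "sum k (T \<inter> U) = sum k U" using U(1) by (simp add: Int_absorb1)
  then have e: "(\<Sum>t\<in>T. weight (shift j U d) t) = (\<Sum>t\<in>T. weight j t) + d * sum k U"
    using weight_sum_shift[OF finite_T, of j U d] by simp
  show z: "zs (shift j U d) T" using j U(3) unfolding zero_sum_def e by simp
  have "zs (shift j U d) U" by (rule zs_shift_const[OF U(3), where c = d]) (simp add: shift_def)
  then have "H (shift j U d) c = F (shift (shift j U d) U c)"
    using U z by (intro H_eq) auto
  also have "\<dots> = F (shift j U (c + d))" by (rule F_cong) (simp add: shift_def)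
  also have "\<dots> = H j (c + d)" using H_eq[OF j U] by simp
  finally show "H (shift j U d) c = H j (c + d)" .
qed

lemma nonvanishing_fibre_shift:
  assumes col: "colouring j T p \<pi>" and m: "m < p" "card (fibre T \<pi> m) \<le> p" and i: "i < p" and nonvanishing: "nonvanishing j"
  shows "nonvanishing (shift j (fibre T \<pi> i) d)"
proof -
  obtain c where c: "H j c \<noteq> 0" using nonvanishing nonvanishing_def by blast
  have "H (shift j (fibre T \<pi> i) d) (c - d) = H j c"
    using H_one_fibre_shift[OF col m i, of d "c - d"] by simp
  then show ?thesis using c colouring_zs[OF colouring_one_shift[OF col] subset_refl] unfolding nonvanishing_def by metis
qed

lemma not_nonvanishing_of_many:
  assumes "colouring j T (Suc p) \<pi>" "m < Suc p" "card (fibre T \<pi> m) \<le> p"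
  shows "\<not> nonvanishing j"
proof
  assume "nonvanishing j"
  then obtain c where c: "H j c \<noteq> 0" "zs j T" unfolding nonvanishing_def by blast
  have "H j c = F (shift j (fibre T \<pi> m) c)"
    using c(2) fibre_sub fibre_colour(1,2)[OF assms(1,2)] assms(3) by (rule H_eq)
  also have "\<dots> = 0" by (rule F_eq_zero_of_many[OF colouring_one_shift[OF assms(1)]])
  finally show False using c by simp
qed

lemma split_fibre_not_nonvanishing:
  assumes col: "colouring j T p \<pi>" and i: "i < p" and W: "W \<subseteq> fibre T \<pi> i" "W \<noteq> {}" "W \<noteq> fibre T \<pi> i" "zs j W"
    and m: "m < p" "card (fibre T \<pi> m) \<le> p"
  shows "\<not> nonvanishing j"
proof -
  let ?\<rho> = "\<lambda>t. if t \<in> W then p else \<pi> t"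
  have lt: "\<pi> t < p" if "t \<in> T" for t using fibre_colour(3)[OF col that] .
  have WT: "W \<subseteq> T" using W(1) fibre_sub by (rule subset_trans)
  have fi: "fibre T ?\<rho> i = fibre T \<pi> i - W" using i by (auto simp: fibre_def)
  have fp: "fibre T ?\<rho> p = W" using WT lt by (force simp: fibre_def)
  have fn: "fibre T ?\<rho> n = fibre T \<pi> n" if "n < p" "n \<noteq> i" for n
    using that W(1) by (auto simp: fibre_def)
  have zi: "zs j (fibre T \<pi> i - W)"
    by (rule zs_diff[OF fibre_colour(2)[OF col i] W(4,1) fibre_sub])
  have c: "colouring j T (Suc p) ?\<rho>"
    unfolding zero_sum_colouring_def
  proof (intro conjI ballI allI impI)
    fix t assume "t \<in> T" then show "?\<rho> t < Suc p" using lt[of t] by simp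
  next
    fix n assume "n < Suc p"
    then consider "n = p" | "n = i" | "n < p" "n \<noteq> i" by linarith
    then show "fibre T ?\<rho> n \<noteq> {}" and "zs j (fibre T ?\<rho> n)"
      using fi fp fn zi W fibre_colour(1,2)[OF col] by (cases; simp; blast)+
  qed
  have "card (fibre T ?\<rho> m) \<le> card (fibre T \<pi> m)"
    using m fi fn finite_sub[OF fibre_sub] by (cases "m = i") (auto intro: card_mono)
  then show ?thesis using not_nonvanishing_of_many[OF c, of m] m by simp
qed

text \<open>Shifting the block \<open>i\<close> by \<open>d\<close> adds \<open>d * sum k (D \<inter> fibre T \<pi> i)\<close> to the weight of \<open>D\<close>. The factor of \<open>d\<close> is
invertible, so some shift turns \<open>D\<close> into a zero-sum set, along which the two blocks can be recut.\<close>

lemma recut_crossing: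
  assumes col: "colouring j T p \<pi>" and nonvanishing: "nonvanishing j" and il: "i < p" "l < p" "i \<noteq> l"
    and m: "m < p" "card (fibre T \<pi> m) \<le> p"
    and D: "D \<subseteq> fibre T \<pi> i \<union> fibre T \<pi> l" "D \<noteq> fibre T \<pi> i \<union> fibre T \<pi> l"
      "int p dvd sum k D" "\<not> int p dvd sum k (D \<inter> fibre T \<pi> i)"
  obtains j' \<pi>' where "nonvanishing j'" "colouring j' T p \<pi>'" "fibre T \<pi>' l = D"
    "fibre T \<pi>' i = (fibre T \<pi> i \<union> fibre T \<pi> l) - D"
    "\<And>m. m \<noteq> i \<Longrightarrow> m \<noteq> l \<Longrightarrow> fibre T \<pi>' m = fibre T \<pi> m"
proof -
  obtain d where d: "int p dvd sum (weight j) D + d * sum k (D \<inter> fibre T \<pi> i)"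
    using solve_mod[OF D(4)] by blast
  define j' where "j' = shift j (fibre T \<pi> i) d"
  have DT: "D \<subseteq> T" using D(1) fibre_sub[of T \<pi> i] fibre_sub[of T \<pi> l] by blast
  have "sum (weight j') D = sum (weight j) D + d * sum k (D \<inter> fibre T \<pi> i)"
    unfolding j'_def by (rule weight_sum_shift[OF finite_sub[OF DT]])
  then have zD: "zs j' D" using d D(3) unfolding zero_sum_def by simp
  have "D \<noteq> {}" using D(4) by auto
  moreover have c': "colouring j' T p \<pi>" unfolding j'_def by (rule colouring_one_shift[OF col])
  ultimately obtain \<pi>' where "colouring j' T p \<pi>'" "fibre T \<pi>' l = D"
    "fibre T \<pi>' i = (fibre T \<pi> i \<union> fibre T \<pi> l) - D"
    "\<And>m. m \<noteq> i \<Longrightarrow> m \<noteq> l \<Longrightarrow> fibre T \<pi>' m = fibre T \<pi> m"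
    using recolour[OF c' il zD _ D(1,2)] by blast
  moreover have "nonvanishing j'" unfolding j'_def by (rule nonvanishing_fibre_shift[OF col m il(1) nonvanishing])
  ultimately show ?thesis using that by blast
qed

text \<open>No shift of blocks changes the weight of a subset \<open>D\<close> of one block with vanishing \<open>k\<close>-sum. Exchanging a
part \<open>E\<close> of \<open>D\<close> with a part \<open>E'\<close> of another block of the same \<open>k\<close>-sum turns \<open>D\<close> into a crossing set, to
which \<open>recut_crossing\<close> applies.\<close>

lemma recut_within_block:
  assumes col: "colouring j T p \<pi>" and nonvanishing: "nonvanishing j" and il: "i < p" "l < p" "i \<noteq> l"
    and m: "m < p" "m \<noteq> i" "m \<noteq> l" "card (fibre T \<pi> m) \<le> p"
    and D: "D \<subseteq> fibre T \<pi> i" "int p dvd sum k D"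
    and E: "E \<subseteq> D" "E' \<subseteq> fibre T \<pi> l" "int p dvd sum k E - sum k E'" "\<not> int p dvd sum k E"
  obtains j' \<pi>' where "nonvanishing j'" "colouring j' T p \<pi>'" "fibre T \<pi>' l = D"
    "fibre T \<pi>' i = (fibre T \<pi> i \<union> fibre T \<pi> l) - D"
    "\<And>m. m \<noteq> i \<Longrightarrow> m \<noteq> l \<Longrightarrow> fibre T \<pi>' m = fibre T \<pi> m"
proof -
  let ?I = "fibre T \<pi> i" and ?L = "fibre T \<pi> l"
  have disj: "?I \<inter> ?L = {}" using fibre_disjoint[OF il(3)] .
  have E'0: "\<not> int p dvd sum k E'" using dvd_diff_imp_dvd_iff[OF E(3)] E(4) by simp
  have sub: "?I \<subseteq> T" "?L \<subseteq> T" "E \<subseteq> ?I" "E \<subseteq> T" "E' \<subseteq> T"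
    using fibre_sub[of T \<pi> i] fibre_sub[of T \<pi> l] E(1,2) D(1) by blast+
  obtain d where d: "int p dvd (sum (weight j) E' - sum (weight j) E) + d * sum k E'"
    using solve_mod[OF E'0] by blast
  define j1 where "j1 = shift j ?L d"
  have c1: "colouring j1 T p \<pi>" unfolding j1_def by (rule colouring_one_shift[OF col])
  have nv1: "nonvanishing j1" unfolding j1_def by (rule nonvanishing_fibre_shift[OF col m(1,4) il(2) nonvanishing])
  have "E \<inter> ?L = {}" "E' \<inter> ?L = E'" using disj sub E(2) by blast+
  then have w: "sum (weight j1) E = sum (weight j) E" "sum (weight j1) E' = sum (weight j) E' + d * sum k E'"
    unfolding j1_def using weight_sum_shift finite_sub sub by simp_all
  define L' where "L' = (?L - E') \<union> E"
  have sumL: "sum h L' = sum h ?L - sum h E' + sum h E" for h :: "'i \<Rightarrow> int"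
  proof -
    have "(?L - E') \<inter> E = {}" using disj sub by blast
    then have "sum h L' = sum h (?L - E') + sum h E" unfolding L'_def
      using finite_sub sub by (intro sum.union_disjoint) auto
    then show ?thesis using sum_diff[of ?L E' h] finite_sub sub E(2) by simp
  qed
  have zL: "zs j1 ?L" using fibre_colour(2)[OF c1 il(2)] .
  have "zs j1 L'"
  proof -
    have "sum k L' = sum k ?L + (sum k E - sum k E')" using sumL[of k] by simp
    moreover have "sum (weight j1) L' = sum (weight j1) ?L - ((sum (weight j) E' - sum (weight j) E) + d * sum k E')"
      using sumL[of "weight j1"] w by simp
    ultimately show ?thesis using zL E(3) d unfolding zero_sum_def by (metis dvd_add dvd_diff)
  qed
  moreover have E0: "E \<noteq> {}" "E' \<noteq> {}" using E(4) E'0 by auto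
  then have "L' \<noteq> {}" by (simp add: L'_def)
  moreover have "L' \<subseteq> ?I \<union> ?L" using sub by (auto simp: L'_def)
  moreover have "L' \<noteq> ?I \<union> ?L"
  proof -
    obtain e where e: "e \<in> E'" using E0 by blast
    then have "e \<in> ?L" "e \<notin> E" using E(2) sub(3) disj by blast+
    then show ?thesis using e unfolding L'_def by blast
  qed
  ultimately obtain \<pi>1 where p1: "colouring j1 T p \<pi>1" "fibre T \<pi>1 l = L'"
    "fibre T \<pi>1 i = (?I \<union> ?L) - L'" "\<And>m. m \<noteq> i \<Longrightarrow> m \<noteq> l \<Longrightarrow> fibre T \<pi>1 m = fibre T \<pi> m"
    using recolour[OF c1 il] by blast
  have un: "fibre T \<pi>1 i \<union> fibre T \<pi>1 l = ?I \<union> ?L"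
    using p1(2,3) \<open>L' \<subseteq> ?I \<union> ?L\<close> by blast
  have "D \<inter> fibre T \<pi>1 i = D - E" unfolding p1(3) L'_def using D(1) disj by blast
  moreover have fD: "finite D" using D(1) finite_sub[OF fibre_sub] finite_subset by blast
  ultimately have "sum k (D \<inter> fibre T \<pi>1 i) = sum k D - sum k E"
    using sum_diff[OF fD E(1)] by simp
  then have nd: "\<not> int p dvd sum k (D \<inter> fibre T \<pi>1 i)"
    using D(2) E(4) by (metis dvd_diff_imp_dvd_iff)
  have "?L \<noteq> {}" using fibre_colour(1)[OF col il(2)] .
  then have "D \<noteq> ?I \<union> ?L" using D(1) disj by blast
  moreover have "D \<subseteq> ?I \<union> ?L" using D(1) by blast
  moreover have "card (fibre T \<pi>1 m) \<le> p" using m p1(4) by simp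
  ultimately obtain j' \<pi>' where "nonvanishing j'" "colouring j' T p \<pi>'" "fibre T \<pi>' l = D"
    "fibre T \<pi>' i = (fibre T \<pi>1 i \<union> fibre T \<pi>1 l) - D"
    "\<And>m. m \<noteq> i \<Longrightarrow> m \<noteq> l \<Longrightarrow> fibre T \<pi>' m = fibre T \<pi>1 m"
    using recut_crossing[OF p1(1) nv1 il m(1) _ _ _ D(2) nd] un by metis
  then show ?thesis using that un p1(4) by metis
qed

text \<open>Supplies the exchange needed in \<open>recut_within_block\<close>. The subset sums of \<open>p - 2\<close> elements of \<open>C\<close> miss at
most one residue, hence contain \<open>k x\<close> or \<open>- k x\<close>. The first is the sum over \<open>{x}\<close>, the second the
sum over \<open>D - {x}\<close>.\<close>

lemma common_subset_sum:
  assumes D: "finite D" "x \<in> D" "\<not> int p dvd k x" "int p dvd sum k D"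
    and C: "finite C" "\<And>t. t \<in> C \<Longrightarrow> \<not> int p dvd k t" "p - 1 \<le> card C"
  shows "\<exists>E E'. E \<subseteq> D \<and> E' \<subseteq> C \<and> int p dvd sum k E - sum k E' \<and> \<not> int p dvd sum k E"
proof -
  have p0: "int p > 0" using p_ge_5 by simp
  obtain Q where Q: "Q \<subseteq> C" "card Q = p - 2"
  proof -
    have "p - 2 \<le> card C" using C(3) by linarith
    then show ?thesis using that obtain_subset_with_card_n by metis
  qed
  define S where "S = shifted_subset_sums p {0} k Q"
  have "card S \<ge> min p (card {0::int} + card Q)"
    unfolding S_def using p0 Q C(1,2) finite_subset
    by (intro card_shifted_subset_sums[OF p_prime]) auto
  then have cS: "card S \<ge> p - 1" using Q p_ge_5 by simp
  have S: "S \<subseteq> {0..<int p}" using p0 by (auto simp: S_def shifted_subset_sums_def)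
  have "\<not> int p dvd k x - - k x"
  proof
    assume "int p dvd k x - - k x"
    then have "int p dvd 2 * k x" by (simp only: diff_minus_eq_add mult_2)
    then have "int p dvd 2" using prime_dvd_mult_int D(3) by blast
    then show False using p_ge_5 by (auto dest: zdvd_imp_le)
  qed
  then have neq: "k x mod int p \<noteq> (- k x) mod int p"
    using mod_eq_dvd_iff by blast
  have "k x mod int p \<in> S \<or> (- k x) mod int p \<in> S"
  proof (rule ccontr)
    assume "\<not> ?thesis"
    then have "S \<subseteq> {0..<int p} - {k x mod int p, (- k x) mod int p}" using S by blast
    then have "card S \<le> card ({0..<int p} - {k x mod int p, (- k x) mod int p})"
      by (intro card_mono) auto
    also have "\<dots> = p - 2" using neq p0 by (subst card_Diff_subset) auto
    finally show False using cS p_ge_5 by linarith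
  qed
  then consider E' where "E' \<subseteq> Q" "k x mod int p = sum k E' mod int p"
    | E' where "E' \<subseteq> Q" "(- k x) mod int p = sum k E' mod int p"
    unfolding S_def shifted_subset_sums_def by auto
  then show ?thesis
  proof cases
    case 1
    then have "int p dvd sum k {x} - sum k E'" by (simp add: mod_eq_dvd_iff)
    then show ?thesis using 1 Q(1) D by (intro exI[of _ "{x}"] exI[of _ E']) auto
  next
    case 2
    have e: "sum k (D - {x}) = sum k D - k x" using D by (simp add: sum_diff1)
    have "int p dvd - k x - sum k E'" using 2(2) mod_eq_dvd_iff by blast
    then have "int p dvd sum k D + (- k x - sum k E')" using D(4) by (rule dvd_add[rotated])
    then have "int p dvd sum k (D - {x}) - sum k E'" unfolding e by (simp add: algebra_simps)
    moreover have "\<not> int p dvd sum k (D - {x})"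
    proof
      assume "int p dvd sum k (D - {x})"
      then have "int p dvd sum k D - sum k (D - {x})" using D(4) by simp
      then show False using D(3) unfolding e by simp
    qed
    ultimately show ?thesis using 2 Q(1) by (intro exI[of _ "D - {x}"] exI[of _ E']) auto
  qed
qed

lemma sum_const_mod:
  assumes "\<And>t. t \<in> Q \<Longrightarrow> int p dvd k t - \<kappa>"
  shows "int p dvd sum k Q - int (card Q) * \<kappa>"
proof -
  have "sum k Q - int (card Q) * \<kappa> = (\<Sum>t\<in>Q. k t - \<kappa>)" by (simp add: sum_subtractf)
  moreover have "int p dvd (\<Sum>t\<in>Q. k t - \<kappa>)" using assms by (rule dvd_sum)
  ultimately show ?thesis by (simp only:)
qed

section \<open>Systems with a single central weight\<close>

text \<open>If \<open>y\<close> and \<open>z\<close> have the same \<open>k\<close>, a shift of the block of \<open>y\<close> by \<open>\<delta>\<close> gives them equal weights as well;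
then they can change places, and the new block, with \<open>z\<close> in place of \<open>y\<close>, is shifted back. In total
only \<open>y\<close> and \<open>z\<close> have moved, in opposite directions, and the two shifts cancel in \<open>H\<close>.\<close>

lemma swap_equal_class:
  assumes col: "colouring j T p \<pi>" and m: "m < p" "card (fibre T \<pi> m) \<le> p"
    and y: "y \<in> T" and z: "z \<in> T" and yz: "\<pi> y \<noteq> \<pi> z"
    and keq: "int p dvd k y - k z" and w: "int p dvd weight j y + \<delta> * k y - weight j z"
  defines "j' \<equiv> j(y := j y + \<delta>, z := j z - \<delta>)" and "\<pi>' \<equiv> \<pi>(y := \<pi> z, z := \<pi> y)"
  shows "colouring j' T p \<pi>'" and "card (fibre T \<pi>' n) = card (fibre T \<pi> n)" and "H j' c = H j c"
proof -
  define I L where "I = fibre T \<pi> (\<pi> y)" and "L = fibre T \<pi> (\<pi> z)"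
  have il: "\<pi> y < p" "\<pi> z < p" using fibre_colour(3)[OF col] y z by blast+
  have mem: "y \<in> I" "z \<in> L" "y \<notin> L" "z \<notin> I" "y \<noteq> z" using y z yz by (auto simp: I_def L_def fibre_def)
  have fin: "finite I" "finite L" unfolding I_def L_def by (rule finite_sub[OF fibre_sub])+
  have fi: "fibre T \<pi>' (\<pi> y) = insert z (I - {y})" and fl: "fibre T \<pi>' (\<pi> z) = insert y (L - {z})"
    and fo: "\<And>n. n \<noteq> \<pi> y \<Longrightarrow> n \<noteq> \<pi> z \<Longrightarrow> fibre T \<pi>' n = fibre T \<pi> n"
    using y z yz by (auto simp: \<pi>'_def I_def L_def fibre_def)
  show card_eq: "card (fibre T \<pi>' n) = card (fibre T \<pi> n)" for n
  proof -
    have "card (insert z (I - {y})) = card I" "card (insert y (L - {z})) = card L"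
      using fin mem card_Suc_Diff1[OF fin(1) mem(1)] card_Suc_Diff1[OF fin(2) mem(2)] by simp_all
    then show ?thesis using fi fl fo[of n] I_def L_def by (cases "n = \<pi> y"; cases "n = \<pi> z"; simp)
  qed
  define j1 where "j1 = shift j I \<delta>"
  have c1: "colouring j1 T p \<pi>" unfolding j1_def I_def by (rule colouring_one_shift[OF col])
  have wy: "weight j1 y - weight j1 z = weight j y + \<delta> * k y - weight j z"
    using mem by (simp add: j1_def shift_def sheared_weight_def algebra_simps)
  have sI: "sum h (insert z (I - {y})) = sum h I - (h y - h z)"
    and sL: "sum h (insert y (L - {z})) = sum h L + (h y - h z)" for h :: "'i \<Rightarrow> int"
    using fin mem by (simp_all add: sum_diff1)
  have zI: "zs j1 I" "zs j1 L" unfolding I_def L_def using fibre_colour(2)[OF c1] il by blast+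
  have zI': "zs j1 (insert z (I - {y}))" using zI(1) keq w unfolding zero_sum_def sI wy by (simp add: dvd_diff)
  have zL': "zs j1 (insert y (L - {z}))" using zI(2) keq w unfolding zero_sum_def sL wy by (simp add: dvd_add)
  have c1': "colouring j1 T p \<pi>'"
    unfolding zero_sum_colouring_def
  proof (intro conjI ballI allI impI)
    fix t assume "t \<in> T" then show "\<pi>' t < p" using il fibre_colour(3)[OF col] by (simp add: \<pi>'_def)
  next
    fix n assume n: "n < p"
    consider "n = \<pi> y" | "n = \<pi> z" | "n \<noteq> \<pi> y" "n \<noteq> \<pi> z" by blast
    then show "fibre T \<pi>' n \<noteq> {}" and "zs j1 (fibre T \<pi>' n)"
      using fi fl fo zI' zL' fibre_colour(1,2)[OF c1 n] by (cases; simp)+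
  qed
  have j': "j' = shift j1 (fibre T \<pi>' (\<pi> y)) (- \<delta>)"
    unfolding fi j'_def j1_def shift_def using mem by (auto simp: fun_eq_iff)
  show "colouring j' T p \<pi>'" unfolding j' by (rule colouring_one_shift[OF c1'])
  have "H j' c = H j1 (c - \<delta>)" unfolding j'
    using H_one_fibre_shift[OF c1' m(1) _ il(1), of "- \<delta>" c] card_eq m(2) by simp
  also have "\<dots> = H j c" unfolding j1_def I_def
    using H_one_fibre_shift[OF col m il(1), of \<delta> "c - \<delta>"] by simp
  finally show "H j' c = H j c" .
qed

lemma int_sum_lessThan_dvd: "int p dvd (\<Sum>i<p. int i)"
proof -
  have "2 * (\<Sum>i<n. int i) = int n * (int n - 1)" for n
    by (induction n) (auto simp: algebra_simps)
  then have "int p dvd 2 * (\<Sum>i<p. int i)" by simp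
  then have "int p dvd 2 \<or> int p dvd (\<Sum>i<p. int i)" by (rule prime_dvd_mult_int)
  moreover have "\<not> int p dvd 2" using p_ge_5 by (auto dest: zdvd_imp_le)
  ultimately show ?thesis by blast
qed

text \<open>Choose one element \<open>x i\<close> in each block and shift the blocks so that \<open>x i\<close> has weight \<open>i * \<kappa>\<close>. Then the
transversal formed by these elements is itself a short zero-sum set. Exchanging the
places of \<open>x 0\<close> and \<open>x 1\<close>, then of \<open>x 1\<close> and \<open>x 2\<close>, and so on, shifts the whole transversal by \<open>1\<close> and leaves \<open>H\<close> as it was, so \<open>H\<close>
does not depend on its second argument; since its values at \<open>p\<close> consecutive arguments add up to zero, it vanishes.\<close>

lemma constant_weight_not_nonvanishing:
  assumes k: "\<And>t. t \<in> T \<Longrightarrow> int p dvd k t - \<kappa>" "\<not> int p dvd \<kappa>"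
    and col: "colouring j T p \<pi>" and m: "m < p" "card (fibre T \<pi> m) \<le> p"
  shows "\<not> nonvanishing j"
proof -
  have "\<forall>i<p. \<exists>x. x \<in> fibre T \<pi> i" using fibre_colour(1)[OF col] by blast
  then obtain x where x: "\<And>i. i < p \<Longrightarrow> x i \<in> fibre T \<pi> i" by metis
  have xT: "x i \<in> T" "\<pi> (x i) = i" if "i < p" for i using x[OF that] by (auto simp: fibre_def)
  have injx: "x i = x i' \<longleftrightarrow> i = i'" if "i < p" "i' < p" for i i' using xT that by metis
  have nk: "\<not> int p dvd k (x i)" if "i < p" for i
    using k(1)[OF xT(1)[OF that]] k(2) dvd_diff_imp_dvd_iff by blast
  have "\<forall>i. \<exists>d. i < p \<longrightarrow> int p dvd (weight j (x i) - int i * \<kappa>) + d * k (x i)"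
    using solve_mod nk by blast
  then obtain d where d: "\<And>i. i < p \<Longrightarrow> int p dvd (weight j (x i) - int i * \<kappa>) + d i * k (x i)"
    by metis
  define j0 where "j0 = (\<lambda>t. j t + d (\<pi> t))"
  have w0: "int p dvd weight j0 (x i) - int i * \<kappa>" if "i < p" for i
    using d[OF that] xT(2)[OF that] by (simp add: j0_def sheared_weight_def algebra_simps)
  have c0: "colouring j0 T p \<pi>" unfolding j0_def by (rule colouring_shift[OF col])
  define Tr where "Tr = image x {..<p}"
  have inj: "inj_on x {..<p}" using injx by (auto simp: inj_on_def)
  have XT: "Tr \<subseteq> T" using xT by (auto simp: Tr_def)
  have cX: "card Tr = p" using inj by (simp add: Tr_def card_image)
  have sumX: "sum h Tr = (\<Sum>i<p. h (x i))" for h :: "'i \<Rightarrow> int"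
    unfolding Tr_def using inj by (simp add: sum.reindex)
  have zTr: "zs j0 Tr"
    unfolding zero_sum_def
  proof
    have "int p dvd sum k Tr - int (card Tr) * \<kappa>" using XT k(1) by (intro sum_const_mod) blast
    moreover have "int p dvd int (card Tr) * \<kappa>" by (simp add: cX)
    ultimately show "int p dvd sum k Tr" using dvd_diff_imp_dvd_iff by blast
    have "sum (weight j0) Tr - (\<Sum>i<p. int i) * \<kappa> = (\<Sum>i<p. weight j0 (x i) - int i * \<kappa>)"
      unfolding sumX by (simp add: sum_subtractf sum_distrib_right)
    moreover have "int p dvd (\<Sum>i<p. weight j0 (x i) - int i * \<kappa>)"
      by (rule dvd_sum) (use w0 in simp)
    ultimately have "int p dvd sum (weight j0) Tr - (\<Sum>i<p. int i) * \<kappa>" by (simp only:)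
    moreover have "int p dvd (\<Sum>i<p. int i) * \<kappa>" using int_sum_lessThan_dvd by (rule dvd_mult2)
    ultimately show "int p dvd sum (weight j0) Tr" using dvd_diff_imp_dvd_iff by blast
  qed
  \<comment> \<open>After \<open>n\<close> exchanges, \<open>x 0\<close>, ..., \<open>x (n - 1)\<close> are raised by 1 each and \<open>x n\<close> is lowered by \<open>n\<close>.\<close>
  define J where "J n = (\<lambda>t. j0 t + (if t \<in> x ` {..<n} then 1 else 0) - (if t = x n then int n else 0))" for n
  have cyc: "\<exists>\<pi>'. colouring (J n) T p \<pi>' \<and> card (fibre T \<pi>' m) \<le> p \<and> inj_on (\<lambda>i. \<pi>' (x i)) {..<p}
       \<and> (\<forall>c. H (J n) c = H j0 c)" if "n < p" for n
    using that
  proof (induction n)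
    case 0
    have "J 0 = j0" by (auto simp: J_def fun_eq_iff)
    moreover have "inj_on (\<lambda>i. \<pi> (x i)) {..<p}" using xT by (auto simp: inj_on_def)
    ultimately show ?case using c0 m by (intro exI[of _ \<pi>]) simp
  next
    case (Suc n)
    then obtain \<pi>' where IH: "colouring (J n) T p \<pi>'" "card (fibre T \<pi>' m) \<le> p"
      "inj_on (\<lambda>i. \<pi>' (x i)) {..<p}" "\<And>c. H (J n) c = H j0 c" by auto
    let ?y = "x n" and ?z = "x (Suc n)"
    have np: "n < p" using Suc.prems by simp
    have notin: "?y \<notin> x ` {..<n}" "?z \<notin> x ` {..<n}" "?z \<noteq> ?y"
      using injx Suc.prems by (auto simp: image_iff)
    have yzT: "?y \<in> T" "?z \<in> T" using xT np Suc.prems by auto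
    have neq: "\<pi>' ?y \<noteq> \<pi>' ?z" using inj_onD[OF IH(3), of n "Suc n"] np Suc.prems by auto
    have keq: "int p dvd k ?y - k ?z" using dvd_diff[OF k(1)[OF yzT(1)] k(1)[OF yzT(2)]] by simp
    have "weight (J n) ?y + (int n + 1) * k ?y - weight (J n) ?z
        = (weight j0 ?y - int n * \<kappa>) - (weight j0 ?z - int (Suc n) * \<kappa>) + (k ?y - \<kappa>)"
      using notin by (simp add: J_def sheared_weight_def algebra_simps)
    then have w: "int p dvd weight (J n) ?y + (int n + 1) * k ?y - weight (J n) ?z"
      using w0[OF np] w0[OF Suc.prems] k(1)[OF yzT(1)] by (simp only: dvd_add dvd_diff)
    note sw = swap_equal_class[OF IH(1) m(1) IH(2) yzT neq keq w]
    let ?\<rho> = "\<pi>'(?y := \<pi>' ?z, ?z := \<pi>' ?y)"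
    have JS: "(J n)(?y := J n ?y + (int n + 1), ?z := J n ?z - (int n + 1)) = J (Suc n)"
      using notin by (auto simp: J_def fun_eq_iff lessThan_Suc)
    define \<tau> where "\<tau> i = (if i = n then Suc n else if i = Suc n then n else i)" for i
    have \<tau>: "?\<rho> (x i) = \<pi>' (x (\<tau> i))" if "i < p" for i
      using that injx Suc.prems np by (auto simp: \<tau>_def)
    have "inj_on (\<lambda>i. ?\<rho> (x i)) {..<p}"
    proof (rule inj_onI)
      fix i i' assume i: "i \<in> {..<p}" "i' \<in> {..<p}" "?\<rho> (x i) = ?\<rho> (x i')"
      then have "\<pi>' (x (\<tau> i)) = \<pi>' (x (\<tau> i'))" using \<tau>[of i] \<tau>[of i'] by (metis lessThan_iff)
      moreover have "\<tau> i < p" "\<tau> i' < p" using i Suc.prems by (auto simp: \<tau>_def)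
      ultimately have "\<tau> i = \<tau> i'" using inj_onD[OF IH(3)] by blast
      then show "i = i'" by (auto simp: \<tau>_def split: if_splits)
    qed
    moreover have "H (J (Suc n)) c = H j0 c" for c using sw(3)[of c] IH(4) JS by simp
    moreover have "colouring (J (Suc n)) T p ?\<rho>" using sw(1) JS by simp
    moreover have "card (fibre T ?\<rho> m) \<le> p" using sw(2)[of m] IH(2) by simp
    ultimately show ?case by blast
  qed
  have z0: "zs j0 T" by (rule colouring_zs[OF c0 subset_refl])
  have Xne: "Tr \<noteq> {}" using cX p_ge_5 by auto
  \<comment> \<open>Finally the last element is lowered by \<open>p - 1\<close>, that is, raised by 1 modulo \<open>p\<close>.\<close>
  have step: "H j0 (c + 1) = H j0 c" for c
  proof -
    have lt: "p - 1 < p" using p_ge_5 by simp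
    have "H j0 c = H (J (p - 1)) c" using cyc[OF lt] by metis
    also have "\<dots> = H (shift j0 Tr 1) c"
    proof (rule H_cong)
      fix t assume "t \<in> T"
      have Xp: "Tr = insert (x (p - 1)) (x ` {..<p - 1})"
      proof -
        have "{..<p} = insert (p - 1) {..<p - 1}" using p_ge_5 by auto
        then show ?thesis unfolding Tr_def by simp
      qed
      have "x (p - 1) \<notin> x ` {..<p - 1}" using injx p_ge_5 by (auto simp: image_iff)
      then show "int p dvd J (p - 1) t - shift j0 Tr 1 t"
        using p_ge_5 unfolding J_def shift_def Xp by (auto simp: of_nat_diff)
    qed
    also have "\<dots> = H j0 (c + 1)" using H_short_shift(2)[OF z0 XT Xne zTr] cX by simp
    finally show ?thesis by simp
  qed
  have const: "H j0 c = H j0 0" for c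
  proof (induction c rule: int_induct[where k = 0])
    case (step2 i)
    then show ?case using step[of "i - 1"] by simp
  qed (use step in auto)
  have "Tr \<noteq> T"
  proof
    assume "Tr = T"
    then have "p\<^sup>2 \<le> p" using card_T cX by simp
    moreover have "5 * p \<le> p * p" using p_ge_5 by (rule mult_le_mono1)
    ultimately show False using p_ge_5 unfolding power2_eq_square by linarith
  qed
  then have "(\<Sum>c<p. F (shift j0 Tr (int c))) = 0" by (rule F_shift_sum[OF XT Xne _ zTr])
  moreover have "F (shift j0 Tr (int c)) = H j0 0" for c
    using H_eq[OF z0 XT Xne zTr, of "int c"] const[of "int c"] cX by simp
  ultimately have "of_nat p * H j0 0 = 0" by simp
  then have zero: "H j0 c = 0" for c using p_nonzero const by simp
  have "H j c = 0" for c
    using H_fibre_shift[OF col m, of d "c - (\<Sum>i<p. d i)"] zero unfolding j0_def by simp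
  then show ?thesis by (simp add: nonvanishing_def)
qed

definition admissible :: "('i \<Rightarrow> int) \<Rightarrow> ('i \<Rightarrow> nat) \<Rightarrow> bool" where
  "admissible j \<pi> \<longleftrightarrow> nonvanishing j \<and> colouring j T p \<pi> \<and> (\<forall>i. 1 \<le> i \<longrightarrow> i < p \<longrightarrow> card (fibre T \<pi> i) \<le> p)"

definition extremal :: "('i \<Rightarrow> int) \<Rightarrow> ('i \<Rightarrow> nat) \<Rightarrow> bool" where
  "extremal j \<pi> \<longleftrightarrow> admissible j \<pi> \<and> (\<forall>j' \<pi>'. admissible j' \<pi>' \<longrightarrow> card (fibre T \<pi>' 0) \<le> card (fibre T \<pi> 0))"

lemma k_zero_subset:
  assumes "B \<subseteq> T" "p \<le> card B"
  shows "\<exists>D\<subseteq>B. D \<noteq> {} \<and> card D \<le> p \<and> int p dvd sum k D"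
proof -
  obtain B' where B': "B' \<subseteq> B" "card B' = p" using obtain_subset_with_card_n[OF assms(2)] by blast
  have fB: "finite B'" using B' p_ge_5 card.infinite by fastforce
  have "\<exists>W\<subseteq>B'. W \<noteq> {} \<and> (\<forall>c\<in>{()}. int p dvd (\<Sum>t\<in>W. k t))"
    using B' p_ge_5 fB by (intro zero_sum_subset_exists[OF p_prime]) auto
  then obtain W where W: "W \<subseteq> B'" "W \<noteq> {}" "int p dvd sum k W" by auto
  moreover have "card W \<le> p" using W(1) B'(2) fB card_mono by metis
  ultimately show ?thesis using B'(1) by (intro exI[of _ W]) simp
qed

lemma class_multiple:
  assumes "\<not> int p dvd \<kappa>" "\<not> int p dvd a"
  obtains e where "1 \<le> e" "e < p" "int p dvd a - int e * \<kappa>"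
proof -
  obtain d where d: "int p dvd a + d * \<kappa>" using solve_mod[OF assms(1)] by blast
  define e where "e = nat ((- d) mod int p)"
  have p0: "int p > 0" using p_ge_5 by simp
  have e: "int e = (- d) mod int p" using p0 by (simp add: e_def)
  then have "e < p" using p0 by (metis of_nat_less_iff pos_mod_bound)
  have "int p dvd - d - int e" unfolding e by (simp add: dvd_minus_mod)
  then have "int p dvd (- d - int e) * \<kappa>" by simp
  then have "int p dvd (a + d * \<kappa>) + (- d - int e) * \<kappa>" using d by (rule dvd_add[rotated])
  then have a: "int p dvd a - int e * \<kappa>" by (simp add: algebra_simps)
  then have "e \<noteq> 0" using assms(2) by (intro notI) simp
  then show ?thesis using that[of e] \<open>e < p\<close> a by simp
qed

lemma nonvanishing_of_nonzero: "F j \<noteq> 0 \<Longrightarrow> nonvanishing j"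
  using F_zero_sum[of j] H_0[of j] unfolding nonvanishing_def by metis

lemma card_fibres: "(\<forall>t\<in>T. \<pi> t < q) \<Longrightarrow> card T = (\<Sum>i<q. card (fibre T \<pi> i))"
  using sum.group[OF finite_T finite_lessThan, of \<pi> q "\<lambda>_. 1::nat"]
  by (auto simp: fibre_def image_subset_iff)

section \<open>Systems containing fixed elements\<close>

text \<open>The element \<open>t0\<close> is a block of its own. A colouring of the other elements with \<open>p\<close> blocks would hence
give \<open>p + 1\<close> blocks, and so would a zero-sum set of fewer than \<open>p\<close> elements; thus \<open>T\<close> has \<open>p\<^sup>2\<close>
elements and all blocks but \<open>{t0}\<close> have at least \<open>p\<close>. Recutting a block against
one with at most one element of vanishing \<open>k\<close> shows that the nonzero values of \<open>k\<close> on both agree, and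
there are two blocks of the latter kind. Counting modulo \<open>p\<close> then yields the number of elements with vanishing \<open>k\<close>, and as they
contain no short zero-sum set, \<open>minimal_zero_sum_constant\<close> determines their weights.\<close>

lemma invariant_element_structure:
  assumes t0: "t0 \<in> T" "int p dvd k t0" "int p dvd s t0"
    and few: "card {t\<in>T. int p dvd k t} \<le> p + 1" and Fj: "F j \<noteq> 0"
  shows "card {t\<in>T. int p dvd k t} = p" and "card T = p * p"
    and "\<And>t. t \<in> T \<Longrightarrow> t \<noteq> t0 \<Longrightarrow> int p dvd k t \<Longrightarrow> \<not> int p dvd s t"
    and "\<And>t t'. t \<in> T \<Longrightarrow> t \<noteq> t0 \<Longrightarrow> int p dvd k t \<Longrightarrow> t' \<in> T \<Longrightarrow> t' \<noteq> t0 \<Longrightarrow> int p dvd k t'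
      \<Longrightarrow> int p dvd s t - s t'"
proof -
  define U where "U = T - {t0}"
  have UT: "U \<subseteq> T" "T - {t0} = U" by (auto simp: U_def)
  have fU: "finite U" by (rule finite_sub[OF UT(1)])
  have nonvanishing: "nonvanishing j" by (rule nonvanishing_of_nonzero[OF Fj])
  have z0: "zs j' {t0}" for j' using t0 by (simp add: zero_sum_def sheared_weight_def)
  have p5: "5 * p \<le> p * p" using p_ge_5 by (rule mult_le_mono1)
  have cU: "card U = card T - 1" unfolding U_def by (rule card_Diff_singleton[OF t0(1)])
  have no_col: False if "nonvanishing j'" "colouring j' U p \<pi>" for j' \<pi>
  proof -
    note e = colouring_extend[of j' T "{t0}" p \<pi>, unfolded UT(2), OF that(2) _ _ z0]
    have "\<not> nonvanishing j'" using not_nonvanishing_of_many[OF e(1), of p] e(2) t0(1) p_ge_5 by simp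
    then show False using that(1) by simp
  qed
  have zU: "zs j' U" if "nonvanishing j'" for j'
    using zs_diff[of j' T "{t0}"] that t0(1) z0 unfolding nonvanishing_def UT(2) by simp
  show cT: "card T = p * p"
  proof (rule ccontr)
    assume "card T \<noteq> p * p"
    then have "p * p \<le> card U" using cU card_T unfolding power2_eq_square by linarith
    then obtain \<pi> where "colouring j U p \<pi>"
      using colouring_exists[OF UT(1) zU[OF nonvanishing], of p] p_ge_5 by auto
    then show False using no_col nonvanishing by blast
  qed
  have cU': "card U = p * p - 1" using cU cT by simp
  have pm: "(p - 1) * p = p * p - p" by (simp add: algebra_simps)
  \<comment> \<open>The complement of a smaller set in \<open>U\<close> still has room for \<open>p - 1\<close> blocks.\<close>
  have no_short: "p \<le> card W" if nv': "nonvanishing j'" and W: "W \<subseteq> U" "W \<noteq> {}" "zs j' W" for j' W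
  proof (rule ccontr)
    assume "\<not> p \<le> card W"
    moreover have "card (U - W) = card U - card W"
      using card_Diff_subset[OF finite_subset[OF W(1) fU] W(1)] .
    ultimately have c: "(p - 1) * p \<le> card (U - W)" using cU' pm by linarith
    have sub: "U - W \<subseteq> T" using UT(1) by blast
    have zUW: "zs j' (U - W)" by (rule zs_diff[OF zU[OF nv'] W(3,1) UT(1)])
    have "1 \<le> p - 1" using p_ge_5 by linarith
    then obtain \<pi> where \<pi>: "colouring j' (U - W) (p - 1) \<pi>"
      using colouring_exists[OF sub zUW _ c] by blast
    have "Suc (p - 1) = p" using p_ge_5 by simp
    then have "colouring j' U p (\<lambda>t. if t \<in> W then p - 1 else \<pi> t)"
      using colouring_extend(1)[OF \<pi> W] by simp
    then show False using no_col nv' by blast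
  qed
  have w: "int p dvd sum (weight j) W \<longleftrightarrow> int p dvd sum s W" if "\<And>t. t \<in> W \<Longrightarrow> int p dvd k t" for W
  proof -
    have "sum (weight j) W - sum s W = (\<Sum>t\<in>W. j t * k t)"
      unfolding sum_subtractf[symmetric] by (rule sum.cong) (simp_all add: sheared_weight_def)
    moreover have "int p dvd (\<Sum>t\<in>W. j t * k t)" by (rule dvd_sum) (use that in simp)
    ultimately show ?thesis by (intro dvd_diff_imp_dvd_iff) (simp only:)
  qed
  define Z where "Z = {t\<in>U. int p dvd k t}"
  have ZT: "{t\<in>T. int p dvd k t} = insert t0 Z" using t0 by (auto simp: Z_def U_def)
  have ZU: "Z \<subseteq> U" "finite Z" "t0 \<notin> Z" using fU by (auto simp: Z_def U_def)
  have cZ: "card {t\<in>T. int p dvd k t} = Suc (card Z)" unfolding ZT using ZU by simp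
  have cZp: "card Z \<le> p" using few cZ by simp
  have free: "\<not> int p dvd sum s W" if W: "W \<subseteq> Z" "W \<noteq> {}" "card W < p" for W
  proof
    assume "int p dvd sum s W"
    then have "int p dvd sum (weight j) W" using w[of W] W(1) by (auto simp: Z_def)
    moreover have "int p dvd sum k W" by (rule dvd_sum) (use W(1) in \<open>auto simp: Z_def\<close>)
    ultimately have "zs j W" by (simp add: zero_sum_def)
    then show False using no_short[OF nonvanishing _ W(2)] W ZU(1) by (metis not_le subset_trans)
  qed
  show "\<not> int p dvd s t" if "t \<in> T" "t \<noteq> t0" "int p dvd k t" for t
    using free[of "{t}"] that p_ge_5 by (auto simp: Z_def U_def)
  have "zs j U" by (rule zU[OF nonvanishing])
  moreover have "(p - 1) * p \<le> card U" "1 \<le> p - 1" using cU' pm p_ge_5 by linarith+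
  ultimately obtain \<pi>0 where \<pi>0: "colouring j U (p - 1) \<pi>0" using colouring_exists[OF UT(1)] by blast
  define \<pi> where "\<pi> t = (if t \<in> {t0} then p - 1 else \<pi>0 t)" for t
  have Sp: "Suc (p - 1) = p" using p_ge_5 by simp
  note ext = colouring_extend[of j T "{t0}" "p - 1" \<pi>0, unfolded UT(2), OF \<pi>0 _ _ z0, folded \<pi>_def]
  have col: "colouring j T p \<pi>" using ext(1) t0(1) Sp by simp
  have fp: "fibre T \<pi> (p - 1) = {t0}" using ext(2) t0(1) by simp
  have fi: "fibre T \<pi> i = fibre U \<pi>0 i" if "i < p - 1" for i using ext(3)[OF _ _ that] t0(1) by simp
  have fiU: "fibre T \<pi> i \<subseteq> U" if "i < p - 1" for i unfolding fi[OF that] by (rule fibre_sub)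
  have fin: "finite (fibre T \<pi> i)" for i by (rule finite_sub[OF fibre_sub])
  have big: "p \<le> card (fibre T \<pi> i)" if i: "i < p - 1" for i
    using no_short[OF nonvanishing fiU[OF i]] fibre_colour(1,2)[OF col, of i] i by simp
  have crossing: "p \<le> card D" if il: "i < p - 1" "l < p - 1" "i \<noteq> l" and D: "D \<subseteq> fibre T \<pi> i \<union> fibre T \<pi> l"
    "int p dvd sum k D" "\<not> int p dvd sum k (D \<inter> fibre T \<pi> i)" for i l D
  proof (rule ccontr)
    assume small: "\<not> p \<le> card D"
    have ne: "D \<noteq> fibre T \<pi> i \<union> fibre T \<pi> l"
    proof
      assume "D = fibre T \<pi> i \<union> fibre T \<pi> l"
      then have "card (fibre T \<pi> i) \<le> card D" using fin by (intro card_mono) auto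
      then show False using big[OF il(1)] small by simp
    qed
    have m: "p - 1 < p" "card (fibre T \<pi> (p - 1)) \<le> p" using fp p_ge_5 by auto
    have il': "i < p" "l < p" using il by auto
    from recut_crossing[OF col nonvanishing il' il(3) m D(1) ne D(2,3)]
    obtain j' \<pi>' where r: "nonvanishing j'" "colouring j' T p \<pi>'" "fibre T \<pi>' l = D"
      "fibre T \<pi>' i = (fibre T \<pi> i \<union> fibre T \<pi> l) - D"
      "\<And>m. m \<noteq> i \<Longrightarrow> m \<noteq> l \<Longrightarrow> fibre T \<pi>' m = fibre T \<pi> m" by blast
    have "zs j' D" "D \<noteq> {}" using fibre_colour(1,2)[OF r(2) il'(2)] r(3) by simp_all
    moreover have "D \<subseteq> U" using D(1) fiU il by blast
    ultimately show False using no_short[OF r(1)] small by blast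
  qed
  define N where "N i = {t \<in> fibre T \<pi> i. \<not> int p dvd k t}" for i
  define Zf where "Zf i = {t \<in> Z. \<pi>0 t = i}" for i
  have NZ: "card (fibre T \<pi> i) = card (N i) + card (Zf i)" if i: "i < p - 1" for i
  proof -
    have "fibre T \<pi> i = N i \<union> Zf i" "N i \<inter> Zf i = {}"
      unfolding N_def Zf_def Z_def fi[OF i] by (auto simp: fibre_def)
    then show ?thesis using fin[of i] by (metis card_Un_disjoint finite_Un)
  qed
  have NT: "N i \<subseteq> T" "N i \<subseteq> fibre T \<pi> i" "finite (N i)" for i
    using fin[of i] fibre_sub[of T \<pi> i] by (auto simp: N_def)
  have rich: "int p dvd k t - k u"
    if il: "i < p - 1" "l < p - 1" "i \<noteq> l" and l: "card (Zf l) \<le> 1" and u: "u \<in> N i" and t: "t \<in> N l" for i l t u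
  proof -
    have cN: "p - 1 \<le> card (N l)" using NZ[OF il(2)] big[OF il(2)] l by linarith
    have disj: "fibre T \<pi> i \<inter> fibre T \<pi> l = {}" by (rule fibre_disjoint[OF il(3)])
    have ui: "u \<in> fibre T \<pi> i" "u \<notin> fibre T \<pi> l" using u disj NT(2) by blast+
    have bound: "p \<le> Suc (card E)" if E: "E \<subseteq> N l" "int p dvd k u + sum k E" for E
    proof -
      have fE: "finite E" "u \<notin> E" using E(1) NT(2,3) ui finite_subset by blast+
      have "insert u E \<inter> fibre T \<pi> i = {u}" using E(1) NT(2)[of l] disj ui by blast
      moreover have "\<not> int p dvd k u" using u by (simp add: N_def)
      ultimately have "\<not> int p dvd sum k (insert u E \<inter> fibre T \<pi> i)" by simp
      moreover have "insert u E \<subseteq> fibre T \<pi> i \<union> fibre T \<pi> l" using E(1) NT(2)[of l] ui by blast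
      moreover have "int p dvd sum k (insert u E)" using E(2) fE by simp
      ultimately have "p \<le> card (insert u E)" using crossing[OF il] by blast
      then show ?thesis using fE by simp
    qed
    have const: "int p dvd k a - k b" if ab: "a \<in> N l" "b \<in> N l" for a b
    proof (rule ccontr)
      assume neq: "\<not> int p dvd k a - k b"
      then have "a \<noteq> b" by auto
      have p0: "int p > 0" using p_ge_5 by simp
      define A where "A = {0, k a mod int p, k b mod int p}"
      have "k a mod int p \<noteq> 0" "k b mod int p \<noteq> 0"
        using ab by (auto simp: N_def dvd_eq_mod_eq_0)
      moreover have "k a mod int p \<noteq> k b mod int p" using neq mod_eq_dvd_iff by blast
      ultimately have cA: "card A = 3" by (simp add: A_def)
      have "card (N l - {a, b}) = card (N l) - card {a, b}" using ab by (intro card_Diff_subset) auto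
      then have "p - 3 \<le> card (N l - {a, b})" using cN \<open>a \<noteq> b\<close> by simp
      then obtain Q where Q: "Q \<subseteq> N l - {a, b}" "card Q = p - 3" using obtain_subset_with_card_n by metis
      have fQ: "finite Q" using Q(1) NT(3) finite_subset by blast
      have "\<exists>a'\<in>A. \<exists>E\<subseteq>Q. int p dvd a' + sum k E - (- k u)"
        using p0 p_ge_5 cA Q fQ
        by (intro shifted_subset_sums_everything[OF p_prime]) (auto simp: A_def N_def)
      then obtain a' E where E: "a' \<in> A" "E \<subseteq> Q" "int p dvd a' + sum k E + k u" by auto
      have fE: "finite E" "a \<notin> E" "b \<notin> E" "E \<subseteq> N l" using E(2) Q(1) fQ finite_subset by blast+
      have cE: "card E \<le> p - 3" using card_mono[OF fQ E(2)] Q(2) by simp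
      have mod_shift: "int p dvd x + sum k E + k u" if "int p dvd x mod int p + sum k E + k u" for x
      proof -
        have "(x + sum k E + k u) - (x mod int p + sum k E + k u) = x - x mod int p" by simp
        then have "int p dvd (x + sum k E + k u) - (x mod int p + sum k E + k u)"
          using dvd_minus_mod[of "int p" x] by (simp only:)
        from dvd_diff_imp_dvd_iff[OF this] show ?thesis using that by (rule iffD2)
      qed
      consider "a' = 0" | "a' = k a mod int p" | "a' = k b mod int p" using E(1) by (auto simp: A_def)
      then have "p \<le> p - 1"
      proof cases
        case 1
        then have "int p dvd k u + sum k E" using E(3) by (simp add: add.commute)
        then show ?thesis using bound[OF fE(4)] cE p_ge_5 by linarith
      next
        case 2
        then have "int p dvd k a + sum k E + k u" using E(3) mod_shift by blast
        then have z: "int p dvd k u + sum k (insert a E)" using fE by (simp add: add_ac)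
        have "insert a E \<subseteq> N l" using fE(4) ab(1) by blast
        from bound[OF this z] have "p \<le> Suc (Suc (card E))" using fE(1,2) by simp
        then show ?thesis using cE p_ge_5 by linarith
      next
        case 3
        then have "int p dvd k b + sum k E + k u" using E(3) mod_shift by blast
        then have z: "int p dvd k u + sum k (insert b E)" using fE by (simp add: add_ac)
        have "insert b E \<subseteq> N l" using fE(4) ab(2) by blast
        from bound[OF this z] have "p \<le> Suc (Suc (card E))" using fE(1,3) by simp
        then show ?thesis using cE p_ge_5 by linarith
      qed
      then show False using p_ge_5 by linarith
    qed
    have kt: "\<not> int p dvd k t" using t by (simp add: N_def)
    have "p dvd card (N l)"
    proof -
      have "int p dvd sum k (N l) - int (card (N l)) * k t" using const t by (intro sum_const_mod) blast
      moreover have "int p dvd sum k (N l)"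
      proof -
        have "sum k (fibre T \<pi> l) = sum k (N l) + sum k (fibre T \<pi> l - N l)"
          using sum.subset_diff[OF NT(2) fin, of k l] by (simp add: add.commute)
        moreover have "int p dvd sum k (fibre T \<pi> l - N l)" by (rule dvd_sum) (auto simp: N_def)
        moreover have "int p dvd sum k (fibre T \<pi> l)"
          using fibre_colour(2)[OF col, of l] il by (simp add: zero_sum_def)
        ultimately show ?thesis by (metis dvd_add_left_iff)
      qed
      ultimately have "int p dvd int (card (N l)) * k t" using dvd_diff_imp_dvd_iff by blast
      then have "int p dvd int (card (N l))" using prime_dvd_mult_int kt by blast
      then show ?thesis by (simp only: int_dvd_int_iff)
    qed
    moreover have "card (N l) \<noteq> 0" using t NT(3) by auto
    ultimately have cNp: "p \<le> card (N l)" by (auto dest: dvd_imp_le)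
    have "\<not> int p dvd k u" using u by (simp add: N_def)
    then obtain e where e: "1 \<le> e" "e < p" "int p dvd k u - int e * k t" using class_multiple[OF kt] by blast
    obtain Q where Q: "Q \<subseteq> N l" "card Q = p - e"
    proof -
      have "p - e \<le> card (N l)" using cNp by linarith
      then show ?thesis using that obtain_subset_with_card_n by metis
    qed
    have "int p dvd sum k Q - int (p - e) * k t" using sum_const_mod[of Q "k t"] const t Q by auto
    then have "int p dvd (k u - int e * k t) + (sum k Q - int (p - e) * k t)" by (rule dvd_add[OF e(3)])
    moreover have "(k u - int e * k t) + (sum k Q - int (p - e) * k t) = (k u + sum k Q) - int p * k t"
      using e by (simp add: of_nat_diff algebra_simps)
    ultimately have "int p dvd k u + sum k Q" by (metis dvd_diff_imp_dvd_iff dvd_triv_left)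
    then have "p \<le> Suc (p - e)" using bound[OF Q(1)] Q(2) by simp
    then have "e = 1" using e by linarith
    then have "int p dvd k u - k t" using e(3) by simp
    then show ?thesis by (simp only: dvd_diff_commute)
  qed
  have sumZ: "card Z = (\<Sum>i<p-1. card (Zf i))"
  proof -
    have "\<pi>0 ` Z \<subseteq> {..<p-1}" using fibre_colour(3)[OF \<pi>0] ZU(1) by blast
    then show ?thesis using sum.group[OF ZU(2) finite_lessThan, of \<pi>0 "p - 1" "\<lambda>_. 1::nat"]
      by (simp add: Zf_def)
  qed
  \<comment> \<open>With fewer than two such blocks, \<open>Z\<close> would have at least \<open>2 * (p - 2) > p\<close> elements.\<close>
  define R where "R = {i. i < p - 1 \<and> card (Zf i) \<le> 1}"
  have "2 \<le> card R"
  proof (rule ccontr)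
    assume "\<not> 2 \<le> card R"
    moreover have "R \<subseteq> {..<p-1}" by (auto simp: R_def)
    ultimately have c: "p - 2 \<le> card ({..<p-1} - R)"
      using card_Diff_subset[of R "{..<p-1}"] finite_subset[of R "{..<p-1}"] by simp
    have "2 * card ({..<p-1} - R) \<le> (\<Sum>i\<in>{..<p-1} - R. card (Zf i))"
      using sum_mono[of "{..<p-1} - R" "\<lambda>_. 2::nat" "\<lambda>i. card (Zf i)"] by (force simp: R_def)
    also have "\<dots> \<le> (\<Sum>i<p-1. card (Zf i))" by (rule sum_mono2) auto
    finally show False using c cZp sumZ p_ge_5 by linarith
  qed
  then obtain i1 i2 where i12: "i1 \<in> R" "i2 \<in> R" "i1 \<noteq> i2"
    by (metis card_le_Suc0_iff_eq card.infinite not_less_eq_eq numeral_2_eq_2 zero_le)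
  have ri: "i1 < p - 1" "i2 < p - 1" "card (Zf i1) \<le> 1" "card (Zf i2) \<le> 1" using i12 by (auto simp: R_def)
  have Nne: "N i \<noteq> {}" if "i \<in> R" for i
  proof
    assume "N i = {}"
    then show False using NZ[of i] big[of i] that p_ge_5 by (simp add: R_def)
  qed
  obtain a b where ab: "a \<in> N i1" "b \<in> N i2" using Nne i12 by blast
  have ba: "int p dvd k b - k a" using rich[OF ri(1,2) i12(3) ri(4) ab] .
  have allb: "int p dvd k t - k b" if t: "t \<in> U" "\<not> int p dvd k t" for t
  proof -
    define i where "i = \<pi>0 t"
    have i: "i < p - 1" using fibre_colour(3)[OF \<pi>0 t(1)] by (simp add: i_def)
    have tN: "t \<in> N i" using t i fi[OF i] by (simp add: N_def i_def fibre_def)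
    show ?thesis
    proof (cases "i = i2")
      case True
      have "int p dvd k t - k a" using rich[OF ri(1,2) i12(3) ri(4) ab(1)] tN True by blast
      then have "int p dvd (k t - k a) - (k b - k a)" using ba by (rule dvd_diff)
      then show ?thesis by simp
    next
      case False
      then have "int p dvd k b - k t" using rich[OF i ri(2) False ri(4) tN ab(2)] by blast
      then show ?thesis by (simp only: dvd_diff_commute)
    qed
  qed
  have cN: "card U = card Z + card (U - Z)"
    using card_Diff_subset[OF ZU(2,1)] card_mono[OF fU ZU(1)] by simp
  have "p dvd card (U - Z)"
  proof -
    have "int p dvd sum k (U - Z) - int (card (U - Z)) * k b"
      using allb by (intro sum_const_mod) (auto simp: Z_def)
    moreover have "int p dvd sum k (U - Z)"
    proof -
      have "sum k U = sum k (U - Z) + sum k Z" using sum.subset_diff[OF ZU(1) fU, of k] .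
      moreover have "int p dvd sum k Z" by (rule dvd_sum) (auto simp: Z_def)
      moreover have "int p dvd sum k U" using zU[OF nonvanishing] by (simp add: zero_sum_def)
      ultimately show ?thesis by (metis dvd_add_left_iff)
    qed
    ultimately have "int p dvd int (card (U - Z)) * k b" using dvd_diff_imp_dvd_iff by blast
    moreover have "\<not> int p dvd k b" using ab by (simp add: N_def)
    ultimately have "int p dvd int (card (U - Z))" using prime_dvd_mult_int by blast
    then show ?thesis by (simp only: int_dvd_int_iff)
  qed
  then obtain n where n: "card (U - Z) = p * n" by blast
  have tot: "Suc (card Z) + p * n = p * p" using cN cU' n p5 p_ge_5 by linarith
  then have "p dvd Suc (card Z) + p * n" by simp
  then have "p dvd Suc (card Z)" by (metis dvd_add_left_iff dvd_triv_left)
  then obtain m where m: "Suc (card Z) = p * m" by blast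
  have "p * m < p * 2" using m cZp p_ge_5 by linarith
  then have "m < 2" by simp
  moreover have "m \<noteq> 0" using m by (intro notI) simp
  ultimately have "m = 1" by linarith
  then have cZ1: "Suc (card Z) = p" using m by simp
  then show "card {t\<in>T. int p dvd k t} = p" using cZ by simp
  show "int p dvd s t - s t'"
    if t: "t \<in> T" "t \<noteq> t0" "int p dvd k t" and t': "t' \<in> T" "t' \<noteq> t0" "int p dvd k t'" for t t'
  proof -
    \<comment> \<open>The weight of \<open>t0\<close> is altered so that the \<open>p\<close> elements of \<open>B\<close> form a minimal zero-sum sequence.\<close>
    define f where "f = s(t0 := - sum s Z)"
    define B where "B = insert t0 Z"
    have fB: "finite B" "card B = p" using ZU cZ1 by (simp_all add: B_def)
    have fZ: "sum f W = sum s W" if "W \<subseteq> Z" for W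
      using that ZU(3) unfolding f_def by (intro sum.cong) auto
    have min: "\<not> int p dvd sum f W" if W: "W \<subseteq> B" "W \<noteq> {}" "W \<noteq> B" for W
    proof (cases "t0 \<in> W")
      case False
      then have WZ: "W \<subseteq> Z" using W(1) by (auto simp: B_def)
      moreover have "card W < p" using card_mono[OF ZU(2) WZ] cZ1 by simp
      ultimately show ?thesis using free[OF WZ W(2)] fZ by simp
    next
      case True
      define V where "V = W - {t0}"
      have V: "V \<subseteq> Z" "W = insert t0 V" "t0 \<notin> V" "finite V"
        using W(1) True ZU finite_subset by (auto simp: V_def B_def)
      have "V \<noteq> Z" using W(3) V(2) by (auto simp: B_def)
      then have ne: "Z - V \<noteq> {}" using V(1) by blast
      have "sum f W = - (sum s Z - sum s V)" using V fZ[OF V(1)] by (simp add: f_def)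
      also have "\<dots> = - sum s (Z - V)" using sum_diff[OF ZU(2) V(1), of s] by simp
      finally have "sum f W = - sum s (Z - V)" .
      moreover have "card (Z - V) < p" using card_mono[OF ZU(2), of "Z - V"] cZ1 by auto
      ultimately show ?thesis using free[OF Diff_subset ne] by simp
    qed
    have p3: "3 \<le> p" using p_ge_5 by simp
    have "t \<in> B" "t' \<in> B" using t t' by (auto simp: B_def Z_def U_def)
    from minimal_zero_sum_constant[OF p_prime p3 fB min this]
    show ?thesis using t(2) t'(2) by (simp add: f_def)
  qed
qed

text \<open>Two singleton blocks, together with \<open>p - 1\<close> blocks cut from the other elements, are too many.\<close>

lemma two_invariant_elements:
  assumes t: "t \<in> T" "t' \<in> T" "t \<noteq> t'" and k: "int p dvd k t" "int p dvd k t'"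
    and s: "int p dvd s t" "int p dvd s t'"
  shows "F j = 0"
proof (rule ccontr)
  assume "F j \<noteq> 0"
  then have zT: "zs j T" by (rule F_zero_sum)
  have z: "zs j {t}" "zs j {t'}" using k s by (simp_all add: zero_sum_def sheared_weight_def)
  define R where "R = T - {t} - {t'}"
  have RT: "R \<subseteq> T" by (auto simp: R_def)
  have "zs j (T - {t})" using zT z(1) by (rule zs_diff) (use t in auto)
  then have zR: "zs j R" unfolding R_def using z(2) by (rule zs_diff) (use t in auto)
  have "card (T - {t}) = card T - 1" using t by simp
  then have "card R = card T - 1 - 1" unfolding R_def using t by simp
  moreover have "(p - 1) * p = p * p - p" by (simp add: algebra_simps)
  ultimately have cR: "(p - 1) * p \<le> card R"
    using card_T p_ge_5 unfolding power2_eq_square by linarith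
  have "1 \<le> p - 1" using p_ge_5 by linarith
  then obtain \<pi> where \<pi>: "colouring j R (p - 1) \<pi>" using colouring_exists[OF RT zR _ cR] by blast
  have sub: "{t'} \<subseteq> T - {t}" "{t} \<subseteq> T" using t by auto
  from colouring_extend(1)[OF \<pi>[unfolded R_def] sub(1) _ z(2)]
  have c1: "colouring j (T - {t}) (Suc (p - 1)) (\<lambda>u. if u \<in> {t'} then p - 1 else \<pi> u)" by blast
  have "Suc (p - 1) = p" using p_ge_5 by simp
  with colouring_extend(1)[OF c1 sub(2) _ z(1)] obtain \<rho> where "colouring j T (Suc p) \<rho>" by auto
  then show False using F_eq_zero_of_many \<open>F j \<noteq> 0\<close> by blast
qed

text \<open>The class of elements with vanishing \<open>k\<close> has zero sum, and by \<open>minimal_zero_sum_constant\<close> it contains a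
proper zero-sum subset. Its two parts and \<open>p - 1\<close> blocks cut from the other elements are too many.\<close>

lemma zero_class_splits:
  assumes cZ: "card {t\<in>T. int p dvd k t} = p" and cT: "card T = p * p"
    and sum0: "int p dvd sum s {t\<in>T. int p dvd k t}"
    and t: "t \<in> T" "t' \<in> T" "int p dvd k t" "int p dvd k t'" "\<not> int p dvd s t - s t'"
  shows "F j = 0"
proof (rule ccontr)
  assume nz: "F j \<noteq> 0"
  then have zT: "zs j T" by (rule F_zero_sum)
  define Z where "Z = {t\<in>T. int p dvd k t}"
  have ZT: "Z \<subseteq> T" by (auto simp: Z_def)
  have fZ: "finite Z" by (rule finite_sub[OF ZT])
  have zs_Z: "zs j W" if "W \<subseteq> Z" "int p dvd sum s W" for W
  proof -
    have k0: "int p dvd k u" if "u \<in> W" for u using that \<open>W \<subseteq> Z\<close> by (auto simp: Z_def)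
    have "int p dvd (\<Sum>t\<in>W. j t * k t)" by (rule dvd_sum) (use k0 in simp)
    moreover have "sum (weight j) W = sum s W + (\<Sum>t\<in>W. j t * k t)"
      unfolding sum.distrib[symmetric] by (rule sum.cong) (simp_all add: sheared_weight_def)
    moreover have "int p dvd sum k W" by (rule dvd_sum) (use k0 in simp)
    ultimately show ?thesis using that(2) unfolding zero_sum_def by simp
  qed
  have "\<exists>W. W \<subseteq> Z \<and> W \<noteq> {} \<and> W \<noteq> Z \<and> int p dvd sum s W"
  proof (rule ccontr)
    assume no: "\<not> ?thesis"
    have "int p dvd s t - s t'"
      using p_ge_5 fZ cZ no t by (intro minimal_zero_sum_constant[OF p_prime, of Z s]) (auto simp: Z_def)
    then show False using t by simp
  qed
  then obtain W where W: "W \<subseteq> Z" "W \<noteq> {}" "W \<noteq> Z" "int p dvd sum s W" by blast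
  have zZ: "zs j Z" using zs_Z[of Z] sum0 by (simp add: Z_def)
  have zW: "zs j W" using zs_Z W by blast
  have zZW: "zs j (Z - W)" by (rule zs_diff[OF zZ zW W(1) ZT])
  have zR: "zs j (T - Z)" by (rule zs_diff[OF zT zZ ZT subset_refl])
  have "card (T - Z) = card T - card Z" by (rule card_Diff_subset[OF fZ ZT])
  moreover have "(p - 1) * p = p * p - p" by (simp add: algebra_simps)
  ultimately have cR: "(p - 1) * p \<le> card (T - Z)" using cT cZ by (simp add: Z_def)
  have "1 \<le> p - 1" using p_ge_5 by linarith
  then obtain \<pi> where \<pi>: "colouring j (T - Z) (p - 1) \<pi>"
    using colouring_exists[OF Diff_subset zR _ cR] by blast
  have e: "T - W - (Z - W) = T - Z" using W(1) by blast
  have sub: "Z - W \<subseteq> T - W" "Z - W \<noteq> {}" "W \<subseteq> T" using W ZT by blast+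
  from colouring_extend(1)[OF \<pi>[folded e] sub(1,2) zZW]
  have c1: "colouring j (T - W) (Suc (p - 1)) (\<lambda>u. if u \<in> Z - W then p - 1 else \<pi> u)" .
  have "Suc (p - 1) = p" using p_ge_5 by simp
  with colouring_extend(1)[OF c1 sub(3) W(2) zW] obtain \<rho> where "colouring j T (Suc p) \<rho>" by auto
  then show False using F_eq_zero_of_many nz by blast
qed

end

section \<open>Systems without fixed elements\<close>

locale nonzero_shear_system = shear_system +
  assumes k_nonzero: "\<And>t. t \<in> T \<Longrightarrow> \<not> int p dvd k t"
begin

text \<open>A short subset of block \<open>0\<close> with vanishing \<open>k\<close>-sum can take the place of a block with at least \<open>p - 1\<close>
elements.\<close>

lemma admissible_exchange:
  assumes admissible: "admissible j \<pi>" and l: "1 \<le> l" "l < p" and D: "D \<subseteq> fibre T \<pi> 0" "D \<noteq> {}" "int p dvd sum k D" "card D \<le> p"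
    and C: "p - 1 \<le> card (fibre T \<pi> l)"
  shows "\<exists>j' \<pi>'. admissible j' \<pi>' \<and> fibre T \<pi>' l = D \<and> fibre T \<pi>' 0 = (fibre T \<pi> 0 \<union> fibre T \<pi> l) - D"
proof -
  have nonvanishing: "nonvanishing j" and col: "colouring j T p \<pi>" and short: "\<And>i. 1 \<le> i \<Longrightarrow> i < p \<Longrightarrow> card (fibre T \<pi> i) \<le> p"
    using admissible unfolding admissible_def by blast+
  obtain x where x: "x \<in> D" using D(2) by blast
  have sub: "fibre T \<pi> 0 \<subseteq> T" "fibre T \<pi> l \<subseteq> T" by (rule fibre_sub)+
  have DT: "D \<subseteq> T" using D(1) sub(1) by blast
  have "\<exists>E E'. E \<subseteq> D \<and> E' \<subseteq> fibre T \<pi> l \<and> int p dvd sum k E - sum k E' \<and> \<not> int p dvd sum k E"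
    using common_subset_sum[OF finite_sub[OF DT] x k_nonzero D(3) finite_sub[OF sub(2)] k_nonzero C] x DT sub(2)
    by blast
  then obtain E E' where E: "E \<subseteq> D" "E' \<subseteq> fibre T \<pi> l" "int p dvd sum k E - sum k E'" "\<not> int p dvd sum k E"
    by blast
  define m where "m = (if l = 1 then 2 else 1 :: nat)"
  have m: "m < p" "m \<noteq> 0" "m \<noteq> l" "card (fibre T \<pi> m) \<le> p"
    using p_ge_5 short[of m] by (auto simp: m_def)
  have "0 < p" "0 \<noteq> l" using p_ge_5 l by auto
  from recut_within_block[OF col nonvanishing this(1) l(2) this(2) m D(1,3) E]
  obtain j' \<pi>' where r: "nonvanishing j'" "colouring j' T p \<pi>'" "fibre T \<pi>' l = D"
    "fibre T \<pi>' 0 = (fibre T \<pi> 0 \<union> fibre T \<pi> l) - D"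
    "\<And>m. m \<noteq> 0 \<Longrightarrow> m \<noteq> l \<Longrightarrow> fibre T \<pi>' m = fibre T \<pi> m" by blast
  have "card (fibre T \<pi>' i) \<le> p" if "1 \<le> i" "i < p" for i
    using r(3) r(5)[of i] short[OF that] D(4) that by (cases "i = l") auto
  then show ?thesis using r by (intro exI[of _ j'] exI[of _ \<pi>']) (auto simp: admissible_def)
qed

text \<open>Of the two blocks that \<open>colouring_exists\<close> leaves uncontrolled, one is short, or else it can be exchanged
for a short subset of the other.\<close>

lemma admissible_exists:
  assumes "nonvanishing j"
  shows "\<exists>j' \<pi>'. admissible j' \<pi>'"
proof -
  have j: "zs j T" using assms by (simp add: nonvanishing_def)
  obtain \<pi> where col: "colouring j T p \<pi>" and short: "\<And>i. 2 \<le> i \<Longrightarrow> i < p \<Longrightarrow> card (fibre T \<pi> i) \<le> p"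
    using colouring_exists[OF subset_refl j, of p] card_T p_ge_5 unfolding power2_eq_square by auto
  have p01: "0 < p" "1 < p" "2 < p" using p_ge_5 by auto
  consider "card (fibre T \<pi> 1) \<le> p" | "card (fibre T \<pi> 0) \<le> p"
    | "p \<le> card (fibre T \<pi> 0)" "p \<le> card (fibre T \<pi> 1)" by linarith
  then show ?thesis
  proof cases
    case 1
    have "card (fibre T \<pi> i) \<le> p" if "1 \<le> i" "i < p" for i
      using 1 short[of i] that by (cases "i = 1") auto
    then show ?thesis using assms col unfolding admissible_def by blast
  next
    case 2
    obtain y where y: "y \<in> fibre T \<pi> 1" using fibre_colour(1)[OF col p01(2)] by (meson ex_in_conv)
    then have "y \<notin> fibre T \<pi> 0" by (simp add: fibre_def)
    then have ne: "fibre T \<pi> 0 \<noteq> fibre T \<pi> 0 \<union> fibre T \<pi> 1" using y by (metis UnI2)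
    have il: "(0::nat) \<noteq> 1" by simp
    have s0: "fibre T \<pi> 0 \<subseteq> fibre T \<pi> 0 \<union> fibre T \<pi> 1" by blast
    from recolour[OF col p01(1) p01(2) il fibre_colour(2)[OF col p01(1)] fibre_colour(1)[OF col p01(1)] s0 ne]
    obtain \<pi>' where \<pi>': "colouring j T p \<pi>'" "fibre T \<pi>' 1 = fibre T \<pi> 0"
      "fibre T \<pi>' 0 = (fibre T \<pi> 0 \<union> fibre T \<pi> 1) - fibre T \<pi> 0"
      "\<And>m. m \<noteq> 0 \<Longrightarrow> m \<noteq> 1 \<Longrightarrow> fibre T \<pi>' m = fibre T \<pi> m" by blast
    have "card (fibre T \<pi>' i) \<le> p" if "1 \<le> i" "i < p" for i
      using 2 \<pi>'(2) \<pi>'(4)[of i] short[of i] that by (cases "i = 1") auto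
    then show ?thesis using assms \<pi>'(1) unfolding admissible_def by blast
  next
    case 3
    have sub: "fibre T \<pi> 0 \<subseteq> T" "fibre T \<pi> 1 \<subseteq> T" by (rule fibre_sub)+
    obtain D where D: "D \<subseteq> fibre T \<pi> 0" "D \<noteq> {}" "card D \<le> p" "int p dvd sum k D"
      using k_zero_subset[OF sub(1) 3(1)] by blast
    obtain x where x: "x \<in> D" using D(2) by blast
    have DT: "D \<subseteq> T" using D(1) sub(1) by blast
    have C: "p - 1 \<le> card (fibre T \<pi> 1)" using 3(2) by simp
    have "\<exists>E E'. E \<subseteq> D \<and> E' \<subseteq> fibre T \<pi> 1 \<and> int p dvd sum k E - sum k E' \<and> \<not> int p dvd sum k E"
      using common_subset_sum[OF finite_sub[OF DT] x k_nonzero D(4) finite_sub[OF sub(2)] k_nonzero C] x DT sub(2)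
      by blast
    then obtain E E' where E: "E \<subseteq> D" "E' \<subseteq> fibre T \<pi> 1" "int p dvd sum k E - sum k E'" "\<not> int p dvd sum k E"
      by blast
    have m: "2 < p" "2 \<noteq> (0::nat)" "2 \<noteq> (1::nat)" "card (fibre T \<pi> 2) \<le> p" using p01 short[of 2] by auto
    have "(0::nat) \<noteq> 1" by simp
    from recut_within_block[OF col assms p01(1,2) this m D(1,4) E]
    obtain j' \<pi>' where r: "nonvanishing j'" "colouring j' T p \<pi>'" "fibre T \<pi>' 1 = D"
      "fibre T \<pi>' 0 = (fibre T \<pi> 0 \<union> fibre T \<pi> 1) - D"
      "\<And>m. m \<noteq> 0 \<Longrightarrow> m \<noteq> 1 \<Longrightarrow> fibre T \<pi>' m = fibre T \<pi> m" by blast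
    have "card (fibre T \<pi>' i) \<le> p" if "1 \<le> i" "i < p" for i
      using D(3) r(3) r(5)[of i] short[of i] that by (cases "i = 1") auto
    then show ?thesis using r(1,2) unfolding admissible_def by blast
  qed
qed

lemma extremal_exists:
  assumes "nonvanishing j"
  obtains j' \<pi>' where "extremal j' \<pi>'"
proof -
  obtain j1 \<pi>1 where "admissible j1 \<pi>1" using admissible_exists[OF assms] by blast
  then have "(\<lambda>(j, \<pi>). admissible j \<pi>) (j1, \<pi>1)" by simp
  moreover have "\<forall>y. (\<lambda>(j, \<pi>). admissible j \<pi>) y \<longrightarrow> card (fibre T (snd y) 0) < Suc (card T)"
    using card_mono[OF finite_T fibre_sub] by (simp add: less_Suc_eq_le)
  ultimately have "\<exists>y. (\<lambda>(j, \<pi>). admissible j \<pi>) y \<and> (\<forall>z. (\<lambda>(j, \<pi>). admissible j \<pi>) z \<longrightarrow> card (fibre T (snd z) 0) \<le> card (fibre T (snd y) 0))"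
    by (rule ex_has_greatest_nat)
  then show ?thesis using that by (auto simp: extremal_def)
qed

lemma extremal_D:
  assumes "extremal j \<pi>"
  shows "admissible j \<pi>" "nonvanishing j" "colouring j T p \<pi>" "\<And>i. 1 \<le> i \<Longrightarrow> i < p \<Longrightarrow> card (fibre T \<pi> i) \<le> p"
    "\<And>j' \<pi>'. admissible j' \<pi>' \<Longrightarrow> card (fibre T \<pi>' 0) \<le> card (fibre T \<pi> 0)"
  using assms unfolding extremal_def admissible_def by blast+

lemma card_rest:
  assumes "i \<noteq> l" "D \<subseteq> fibre T \<pi> i \<union> fibre T \<pi> l"
  shows "card ((fibre T \<pi> i \<union> fibre T \<pi> l) - D) + card D = card (fibre T \<pi> i) + card (fibre T \<pi> l)"
proof -
  have fin: "finite (fibre T \<pi> i)" "finite (fibre T \<pi> l)" by (rule finite_sub[OF fibre_sub])+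
  have c: "card (fibre T \<pi> i \<union> fibre T \<pi> l) = card (fibre T \<pi> i) + card (fibre T \<pi> l)"
    using fin fibre_disjoint[OF assms(1)] by (rule card_Un_disjoint)
  have fD: "finite D" using assms(2) fin by (meson finite_Un finite_subset)
  have "card D \<le> card (fibre T \<pi> i \<union> fibre T \<pi> l)" using assms(2) fin by (intro card_mono) auto
  then show ?thesis using card_Diff_subset[OF fD assms(2)] c by simp
qed

text \<open>A larger block \<open>0\<close> would split into two zero-sum blocks, making \<open>p + 1\<close> in total.\<close>

lemma extremal_bound:
  assumes mc: "extremal j \<pi>"
  shows "card (fibre T \<pi> 0) \<le> 2 * p - 1"
proof (rule ccontr)
  assume "\<not> ?thesis"
  then have large: "2 * p \<le> card (fibre T \<pi> 0)" by simp
  then have "fibre T \<pi> 0 \<noteq> {}" using p_ge_5 by auto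
  then obtain x where x: "x \<in> fibre T \<pi> 0" by blast
  have "card (fibre T \<pi> 0 - {x}) \<ge> 2 * p - 1" using large card_Diff_singleton[OF x] by linarith
  moreover have "fibre T \<pi> 0 - {x} \<subseteq> T" using fibre_sub[of T \<pi> 0] by blast
  ultimately obtain W where W: "W \<subseteq> fibre T \<pi> 0 - {x}" "W \<noteq> {}" "zs j W"
    using zs_exists[of "fibre T \<pi> 0 - {x}" j] by blast
  have "W \<subseteq> fibre T \<pi> 0" "W \<noteq> fibre T \<pi> 0" using W(1) x by blast+
  moreover have "0 < p" "1 < p" using p_ge_5 by auto
  ultimately have "\<not> nonvanishing j"
    using split_fibre_not_nonvanishing[OF extremal_D(3)[OF mc] _ _ W(2) _ W(3), of 0 1] extremal_D(4)[OF mc, of 1] by simp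
  then show False using extremal_D(2)[OF mc] by simp
qed

text \<open>Recutting along \<open>D\<close> would enlarge block \<open>0\<close>.\<close>

lemma extremal_no_crossing:
  assumes mc: "extremal j \<pi>" and l: "1 \<le> l" "l < p"
    and D: "D \<subseteq> fibre T \<pi> 0 \<union> fibre T \<pi> l" "int p dvd sum k D" "\<not> int p dvd sum k (D \<inter> fibre T \<pi> 0)"
    and small: "card D < card (fibre T \<pi> l)"
  shows False
proof -
  have p0: "0 < p" "0 \<noteq> l" using p_ge_5 l by auto
  have rest: "card ((fibre T \<pi> 0 \<union> fibre T \<pi> l) - D) + card D = card (fibre T \<pi> 0) + card (fibre T \<pi> l)"
    by (rule card_rest[OF p0(2) D(1)])
  have fin: "finite (fibre T \<pi> 0 \<union> fibre T \<pi> l)" using finite_sub[OF fibre_sub] by blast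
  have ne: "D \<noteq> fibre T \<pi> 0 \<union> fibre T \<pi> l"
  proof
    assume "D = fibre T \<pi> 0 \<union> fibre T \<pi> l"
    then have "card (fibre T \<pi> l) \<le> card D" using fin by (intro card_mono) auto
    then show False using small by simp
  qed
  from recut_crossing[OF extremal_D(3,2)[OF mc] p0(1) l(2) p0(2) l(2) extremal_D(4)[OF mc l] D(1) ne D(2,3)]
  obtain j' \<pi>' where r: "nonvanishing j'" "colouring j' T p \<pi>'" "fibre T \<pi>' l = D"
    "fibre T \<pi>' 0 = (fibre T \<pi> 0 \<union> fibre T \<pi> l) - D"
    "\<And>m. m \<noteq> 0 \<Longrightarrow> m \<noteq> l \<Longrightarrow> fibre T \<pi>' m = fibre T \<pi> m" by blast
  have "card (fibre T \<pi>' i) \<le> p" if "1 \<le> i" "i < p" for i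
    using r(3) r(5)[of i] extremal_D(4)[OF mc that] extremal_D(4)[OF mc l] small that by (cases "i = l") auto
  then have "admissible j' \<pi>'" using r(1,2) unfolding admissible_def by blast
  then have "card (fibre T \<pi>' 0) \<le> card (fibre T \<pi> 0)" by (rule extremal_D(5)[OF mc])
  then show False using rest small r(4) by simp
qed

text \<open>Exchanging a smaller set \<open>D\<close> with block \<open>l\<close> would enlarge block \<open>0\<close>.\<close>

lemma extremal_zero_large:
  assumes mc: "extremal j \<pi>" and l: "1 \<le> l" "l < p"
    and D: "D \<subseteq> fibre T \<pi> 0" "D \<noteq> {}" "int p dvd sum k D" and C: "p - 1 \<le> card (fibre T \<pi> l)"
  shows "card (fibre T \<pi> l) \<le> card D"
proof (rule ccontr)
  assume small: "\<not> ?thesis"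
  then have "card D \<le> p" using extremal_D(4)[OF mc l] by simp
  from admissible_exchange[OF extremal_D(1)[OF mc] l D this C] obtain j' \<pi>' where
    r: "admissible j' \<pi>'" "fibre T \<pi>' 0 = (fibre T \<pi> 0 \<union> fibre T \<pi> l) - D" by blast
  have "0 \<noteq> l" "D \<subseteq> fibre T \<pi> 0 \<union> fibre T \<pi> l" using l D(1) by auto
  from card_rest[OF this] have "card (fibre T \<pi>' 0) + card D = card (fibre T \<pi> 0) + card (fibre T \<pi> l)"
    using r(2) by simp
  moreover have "card (fibre T \<pi>' 0) \<le> card (fibre T \<pi> 0)" by (rule extremal_D(5)[OF mc r(1)])
  ultimately show False using small by simp
qed

lemma extremal_card_T:
  assumes mc: "extremal j \<pi>"
  shows "p * p \<le> card (fibre T \<pi> 0) + (\<Sum>i\<in>{1..<p}. card (fibre T \<pi> i))"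
proof -
  have "card T = (\<Sum>i<p. card (fibre T \<pi> i))"
    using fibre_colour(3)[OF extremal_D(3)[OF mc]] by (intro card_fibres) blast
  also have "{..<p} = insert 0 {1..<p}" using p_ge_5 by auto
  finally show ?thesis using card_T by (simp add: power2_eq_square)
qed

text \<open>By \<open>extremal_bound\<close> the set \<open>D\<close> has fewer than \<open>p\<close> elements, and then so has every other block by
\<open>extremal_zero_large\<close>. Now \<open>2 * p - 1 + (p - 1) * (p - 1) = p * p\<close> leaves no slack.\<close>

lemma extremal_not_minimal:
  assumes mc: "extremal j \<pi>" and D: "D \<subseteq> fibre T \<pi> 0" "D \<noteq> {}" "int p dvd sum k D" "2 * card D \<le> card (fibre T \<pi> 0)"
  shows "card (fibre T \<pi> 0) = 2 * p - 1" and "\<And>l. 1 \<le> l \<Longrightarrow> l < p \<Longrightarrow> card (fibre T \<pi> l) = p - 1"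
proof -
  have cD: "card D \<le> p - 1" using D(4) extremal_bound[OF mc] p_ge_5 by linarith
  have le: "card (fibre T \<pi> l) \<le> p - 1" if "1 \<le> l" "l < p" for l
    using extremal_zero_large[OF mc that D(1,2,3)] cD by linarith
  have pp: "2 * p - 1 + (p - 1) * (p - 1) = p * p"
    using p_ge_5 by (cases p) (auto simp: algebra_simps)
  have s: "(\<Sum>i\<in>{1..<p}. card (fibre T \<pi> i)) \<le> (\<Sum>i\<in>{1..<p}. p - 1)"
    using le by (intro sum_mono) auto
  then have s': "(\<Sum>i\<in>{1..<p}. card (fibre T \<pi> i)) \<le> (p - 1) * (p - 1)" by simp
  show "card (fibre T \<pi> 0) = 2 * p - 1"
    using extremal_card_T[OF mc] extremal_bound[OF mc] s' pp by linarith
  then have eq: "(\<Sum>i\<in>{1..<p}. card (fibre T \<pi> i)) = (\<Sum>i\<in>{1..<p}. p - 1)"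
    using extremal_card_T[OF mc] s' pp s by simp
  show "card (fibre T \<pi> l) = p - 1" if "1 \<le> l" "l < p" for l
    using sum_mono_inv[OF eq] le that by auto
qed

text \<open>By \<open>extremal_zero_large\<close>, subsets of block \<open>0\<close> with vanishing \<open>k\<close>-sum have at least \<open>p - 1\<close> elements.
So the block consists of a set \<open>D0\<close> of \<open>p - 1\<close> and a set \<open>D'\<close> of \<open>p\<close> elements, both with vanishing
\<open>k\<close>-sum; \<open>k\<close> is constant on \<open>D'\<close>, with value \<open>\<kappa>\<close>, and takes the values \<open>\<kappa>\<close> and \<open>2 * \<kappa>\<close> on \<open>D0\<close>.\<close>

lemma extremal_form:
  assumes mc: "extremal j \<pi>" and cB: "card (fibre T \<pi> 0) = 2 * p - 1"
    and cC: "\<And>l. 1 \<le> l \<Longrightarrow> l < p \<Longrightarrow> card (fibre T \<pi> l) = p - 1"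
  shows "\<exists>\<kappa> x. \<not> int p dvd \<kappa> \<and> x \<in> fibre T \<pi> 0 \<and> int p dvd k x - 2 * \<kappa> \<and>
     (\<forall>t\<in>fibre T \<pi> 0 - {x}. int p dvd k t - \<kappa>)"
proof -
  define B where "B = fibre T \<pi> 0"
  have p1: "1 < p" "p \<ge> 3" using p_ge_5 by auto
  have BT: "B \<subseteq> T" unfolding B_def by (rule fibre_sub)
  have fB: "finite B" using finite_sub[OF BT] .
  have cBp: "card B = 2 * p - 1" using cB by (simp add: B_def)
  have big: "p - 1 \<le> card D" if "D \<subseteq> B" "D \<noteq> {}" "int p dvd sum k D" for D
    using extremal_zero_large[OF mc order_refl p1(1) that[unfolded B_def]] cC[OF order_refl p1(1)] by simp
  have zB: "int p dvd sum k B"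
    using fibre_colour(2)[OF extremal_D(3)[OF mc], of 0] p1 unfolding B_def zero_sum_def by simp
  have compl: "int p dvd sum k (W - D)" if "int p dvd sum k W" "int p dvd sum k D" "D \<subseteq> W" "W \<subseteq> B" for W D
    using that sum_diff[OF finite_subset[OF that(4) fB] that(3), of k] by simp
  have "p \<le> card B" using cBp p1 by simp
  then obtain D where D: "D \<subseteq> B" "D \<noteq> {}" "card D \<le> p" "int p dvd sum k D"
    using k_zero_subset[OF BT] by blast
  have cBD: "card (B - D) = card B - card D" using card_Diff_subset[OF finite_subset[OF D(1) fB] D(1)] .
  define D0 where "D0 = (if card D = p then B - D else D)"
  have D0: "D0 \<subseteq> B" "int p dvd sum k D0" using D compl[OF zB D(4,1)] by (auto simp: D0_def)
  have cD0: "card D0 = p - 1"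
  proof (cases "card D = p")
    case True
    then show ?thesis using cBD cBp by (simp add: D0_def)
  next
    case False
    then show ?thesis using big[OF D(1,2,4)] D(3) by (simp add: D0_def)
  qed
  define D' where "D' = B - D0"
  have cD': "card D' = p" unfolding D'_def
    using card_Diff_subset[OF finite_subset[OF D0(1) fB] D0(1)] cD0 cBp p1 by simp
  have zD': "int p dvd sum k D'" unfolding D'_def by (rule compl[OF zB D0(2,1) subset_refl])
  have D'B: "D' \<subseteq> B" "finite D'" using fB by (auto simp: D'_def)
  have "D' \<noteq> {}" using cD' p1 by auto
  then obtain y where y: "y \<in> D'" by blast
  define \<kappa> where "\<kappa> = k y"
  have \<kappa>: "\<not> int p dvd \<kappa>" using y D'B BT k_nonzero by (auto simp: \<kappa>_def)
  have const: "int p dvd k t - \<kappa>" if t: "t \<in> D'" for t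
    unfolding \<kappa>_def
  proof (rule minimal_zero_sum_constant[OF p_prime p1(2) D'B(2) cD' _ t y])
    fix W assume W: "W \<subseteq> D'" "W \<noteq> {}" "W \<noteq> D'"
    show "\<not> int p dvd sum k W"
    proof
      assume z: "int p dvd sum k W"
      have W2: "W \<subseteq> B" "D' - W \<subseteq> B" "D' - W \<noteq> {}" using W D'B by blast+
      have "p - 1 \<le> card W" using big[OF W2(1) W(2) z] .
      moreover have "p - 1 \<le> card (D' - W)" using big[OF W2(2,3) compl[OF zD' z W(1) D'B(1)]] .
      moreover have "card (D' - W) = p - card W"
        using card_Diff_subset[OF finite_subset[OF W(1) D'B(2)] W(1)] cD' by simp
      ultimately show False using p_ge_5 by linarith
    qed
  qed
  \<comment> \<open>If \<open>k t\<close> is \<open>e * \<kappa>\<close>, then \<open>t\<close> and \<open>p - e\<close> elements of \<open>D'\<close> have vanishing \<open>k\<close>-sum, so \<open>e \<le> 2\<close>.\<close>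
  have two: "int p dvd k t - \<kappa> \<or> int p dvd k t - 2 * \<kappa>" if t: "t \<in> D0" for t
  proof -
    have tB: "t \<in> B" "t \<notin> D'" using t D0(1) by (auto simp: D'_def)
    then have "\<not> int p dvd k t" using k_nonzero BT by blast
    then obtain e where e: "1 \<le> e" "e < p" "int p dvd k t - int e * \<kappa>" using class_multiple[OF \<kappa>] by blast
    obtain Q where Q: "Q \<subseteq> D'" "card Q = p - e"
      using obtain_subset_with_card_n[of "p - e" D'] cD' by auto
    have fQ: "finite Q" "t \<notin> Q" using Q(1) D'B(2) tB finite_subset by auto
    have "int p dvd sum k Q - int (p - e) * \<kappa>" using sum_const_mod[of Q \<kappa>] const Q by auto
    then have "int p dvd (k t - int e * \<kappa>) + (sum k Q - int (p - e) * \<kappa>)" by (rule dvd_add[OF e(3)])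
    moreover have "(k t - int e * \<kappa>) + (sum k Q - int (p - e) * \<kappa>) = sum k (insert t Q) - int p * \<kappa>"
      using fQ e by (simp add: of_nat_diff algebra_simps)
    ultimately have "int p dvd sum k (insert t Q)" by (metis dvd_diff_imp_dvd_iff dvd_triv_left)
    moreover have "insert t Q \<subseteq> B" using Q(1) D'B(1) tB by blast
    ultimately have "p - 1 \<le> card (insert t Q)" using big by blast
    then have "e \<le> 2" using fQ Q(2) e by simp
    then have "e = 1 \<or> e = 2" using e(1) by linarith
    then show ?thesis using e(3) by auto
  qed
  define S where "S = {t\<in>D0. int p dvd k t - 2 * \<kappa>}"
  have fD0: "finite D0" using finite_subset[OF D0(1) fB] .
  have notboth: "\<not> int p dvd a - \<kappa>" if "int p dvd a - 2 * \<kappa>" for a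
  proof
    assume "int p dvd a - \<kappa>"
    then have "int p dvd (a - \<kappa>) - (a - 2 * \<kappa>)" using that by (rule dvd_diff)
    then show False using \<kappa> by simp
  qed
  have "card S = 1"
  proof -
    have S: "S \<subseteq> D0" by (auto simp: S_def)
    have cS: "card S \<le> p - 1" using card_mono[OF fD0 S] cD0 by simp
    have sumD0: "(\<Sum>t\<in>D0. if t \<in> S then 2 * \<kappa> else \<kappa>) = int (p - 1 + card S) * \<kappa>"
    proof -
      have "(\<Sum>t\<in>D0. if t \<in> S then 2 * \<kappa> else \<kappa>) = (\<Sum>t\<in>D0. \<kappa> + (if t \<in> S then \<kappa> else 0))"
        by (rule sum.cong) auto
      also have "\<dots> = (\<Sum>t\<in>D0. \<kappa>) + (\<Sum>t\<in>D0 \<inter> S. \<kappa>)"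
        by (simp only: sum.distrib sum.inter_restrict[OF fD0])
      also have "D0 \<inter> S = S" using S by blast
      finally show ?thesis by (simp add: cD0 algebra_simps)
    qed
    have "int p dvd (\<Sum>t\<in>D0. k t - (if t \<in> S then 2 * \<kappa> else \<kappa>))"
    proof (rule dvd_sum)
      fix t assume "t \<in> D0"
      then show "int p dvd k t - (if t \<in> S then 2 * \<kappa> else \<kappa>)" using two[of t] by (auto simp: S_def)
    qed
    then have "int p dvd sum k D0 - int (p - 1 + card S) * \<kappa>" by (simp only: sum_subtractf sumD0)
    then have "int p dvd int (p - 1 + card S) * \<kappa>" using D0(2) dvd_diff_imp_dvd_iff by blast
    then have "int p dvd int (p - 1 + card S)" using prime_dvd_mult_int \<kappa> by blast
    then have "p dvd p - 1 + card S" by (simp only: int_dvd_int_iff)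
    then obtain n where n: "p - 1 + card S = p * n" by blast
    have "p * n < p * 2" using n cS p1 by linarith
    moreover have "n \<noteq> 0" using n p1 by (intro notI) simp
    ultimately have "n = 1" by simp
    then show ?thesis using n p1 by simp
  qed
  then obtain x where x: "S = {x}" by (rule card_1_singletonE)
  have xB: "x \<in> B" "int p dvd k x - 2 * \<kappa>" using x D0(1) unfolding S_def by blast+
  have "int p dvd k t - \<kappa>" if t: "t \<in> B - {x}" for t
  proof (cases "t \<in> D0")
    case True
    then show ?thesis using two[OF True] x t unfolding S_def by blast
  next
    case False
    then show ?thesis using const[of t] t by (simp add: D'_def)
  qed
  then show ?thesis using \<kappa> xB unfolding B_def by blast
qed

text \<open>Otherwise block \<open>0\<close> has the form given by \<open>extremal_form\<close>, and this remains true after exchanging a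
part \<open>D0\<close> of it that contains the exceptional element \<open>x\<close> with block \<open>1\<close>. Hence block \<open>1\<close> contains a second exceptional
element \<open>x'\<close>, and \<open>x\<close>, \<open>x'\<close> and \<open>p - 4\<close> ordinary elements form a crossing set that is too small for
\<open>extremal_no_crossing\<close>.\<close>

lemma extremal_minimal:
  assumes mc: "extremal j \<pi>" and D: "D \<subseteq> fibre T \<pi> 0" "D \<noteq> {}" "int p dvd sum k D"
  shows "card (fibre T \<pi> 0) < 2 * card D"
proof (rule ccontr)
  assume "\<not> ?thesis"
  then have D4: "2 * card D \<le> card (fibre T \<pi> 0)" by simp
  note cards = extremal_not_minimal[OF mc D D4]
  define B C where "B = fibre T \<pi> 0" and "C = fibre T \<pi> 1"
  have p1: "1 < p" "0 < p" using p_ge_5 by auto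
  have cC: "card C = p - 1" using cards(2)[of 1] p1 by (simp add: C_def)
  have cB: "card B = 2 * p - 1" using cards(1) by (simp add: B_def)
  have fB: "finite B" unfolding B_def by (rule finite_sub[OF fibre_sub])
  have disj: "B \<inter> C = {}" unfolding B_def C_def by (rule fibre_disjoint) simp
  obtain \<kappa> x where \<kappa>: "\<not> int p dvd \<kappa>" and x: "x \<in> B" "int p dvd k x - 2 * \<kappa>"
    and const: "\<And>t. t \<in> B - {x} \<Longrightarrow> int p dvd k t - \<kappa>"
    using extremal_form[OF mc cards] unfolding B_def by blast
  have cBx: "card (B - {x}) = 2 * p - 2" using cB x(1) by simp
  have sumP: "int p dvd sum k P - int (card P) * \<kappa>" if "P \<subseteq> B - {x}" for P
    using sum_const_mod[of P \<kappa>] const that by blast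
  have "p - 2 \<le> card (B - {x})" using cBx by simp
  then obtain P where P: "P \<subseteq> B - {x}" "card P = p - 2" using obtain_subset_with_card_n by metis
  have fP: "finite P" "x \<notin> P" using P(1) fB finite_subset by auto
  define D0 where "D0 = insert x P"
  have D0: "D0 \<subseteq> B" "D0 \<noteq> {}" "card D0 = p - 1" using P x(1) fP p_ge_5 by (auto simp: D0_def)
  have zD0: "int p dvd sum k D0"
  proof -
    have "int p dvd (k x - 2 * \<kappa>) + (sum k P - int (p - 2) * \<kappa>)"
      using x(2) sumP[OF P(1)] P(2) by (intro dvd_add) auto
    moreover have "(k x - 2 * \<kappa>) + (sum k P - int (p - 2) * \<kappa>) = sum k D0 - int p * \<kappa>"
      using fP p_ge_5 by (simp add: D0_def of_nat_diff algebra_simps)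
    ultimately show ?thesis by (metis dvd_diff_imp_dvd_iff dvd_triv_left)
  qed
  have "card D0 \<le> p" "p - 1 \<le> card C" using D0(3) cC by simp_all
  from admissible_exchange[OF extremal_D(1)[OF mc] order_refl p1(1) D0(1)[unfolded B_def] D0(2) zD0 this[unfolded C_def]]
  obtain j' \<pi>' where c': "admissible j' \<pi>'" "fibre T \<pi>' 0 = (B \<union> C) - D0" unfolding B_def C_def by blast
  have "card (fibre T \<pi>' 0) + card D0 = card B + card C"
    unfolding c'(2) B_def C_def using D0(1) by (intro card_rest) (auto simp: B_def)
  then have cB': "card (fibre T \<pi>' 0) = 2 * p - 1" using D0(3) cC cB by simp
  have mc': "extremal j' \<pi>'" unfolding extremal_def
    using c'(1) cB' cards(1) extremal_D(5)[OF mc] by simp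
  have nonempty: "2 * card D0 \<le> card (fibre T \<pi>' 0)" using D0(3) cB' by simp
  have cC': "card (fibre T \<pi>' l) = p - 1" if l: "1 \<le> l" "l < p" for l
  proof -
    have sub: "fibre T \<pi>' 0 \<subseteq> T" by (rule fibre_sub)
    have "p \<le> card (fibre T \<pi>' 0)" using cB' p1 by simp
    then obtain W where W: "W \<subseteq> fibre T \<pi>' 0" "W \<noteq> {}" "card W \<le> p" "int p dvd sum k W"
      using k_zero_subset[OF sub] by blast
    have fin: "finite (fibre T \<pi>' 0)" using finite_sub[OF sub] .
    have "int p dvd sum k (fibre T \<pi>' 0)"
      using fibre_colour(2)[OF extremal_D(3)[OF mc'], of 0] p1 unfolding zero_sum_def by simp
    then have z2: "int p dvd sum k (fibre T \<pi>' 0 - W)" using W(4) sum_diff[OF fin W(1), of k] by simp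
    have c2: "card (fibre T \<pi>' 0 - W) = 2 * p - 1 - card W"
      using card_Diff_subset[OF finite_subset[OF W(1) fin] W(1)] cB' by simp
    then have ne2: "fibre T \<pi>' 0 - W \<noteq> {}" using W(3) p_ge_5 by (intro notI) simp
    consider "2 * card W \<le> card (fibre T \<pi>' 0)" | "2 * card (fibre T \<pi>' 0 - W) \<le> card (fibre T \<pi>' 0)"
      using c2 cB' W(3) by linarith
    then show ?thesis
      using extremal_not_minimal(2)[OF mc' W(1,2,4)] extremal_not_minimal(2)[OF mc' Diff_subset ne2 z2] l
      by cases auto
  qed
  obtain \<kappa>' x' where \<kappa>': "\<not> int p dvd \<kappa>'" and x': "x' \<in> (B \<union> C) - D0" "int p dvd k x' - 2 * \<kappa>'"
    and const': "\<And>t. t \<in> (B \<union> C) - D0 - {x'} \<Longrightarrow> int p dvd k t - \<kappa>'"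
    using extremal_form[OF mc' cB' cC'] unfolding c'(2) by blast
  have "card (B - D0) = p" using card_Diff_subset[OF finite_subset[OF D0(1) fB] D0(1)] D0(3) cB p1 by simp
  then have "card (B - D0 - {x'}) \<ge> p - 1"
    using card_Diff1_le[of "B - D0" x'] by (metis card_Diff_singleton_if diff_le_self order_refl)
  then have "B - D0 - {x'} \<noteq> {}" using p_ge_5 by (intro notI) simp
  then obtain t0 where t0: "t0 \<in> B - D0" "t0 \<noteq> x'" by blast
  have t0x: "t0 \<in> B - {x}" using t0 by (auto simp: D0_def)
  have "int p dvd k t0 - \<kappa>'" using const'[of t0] t0 by blast
  then have "int p dvd (k t0 - \<kappa>') - (k t0 - \<kappa>)" using const[OF t0x] by (rule dvd_diff)
  then have kk: "int p dvd \<kappa> - \<kappa>'" by simp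
  have x'2: "int p dvd k x' - 2 * \<kappa>"
  proof -
    have "int p dvd (k x' - 2 * \<kappa>') - 2 * (\<kappa> - \<kappa>')" by (rule dvd_diff[OF x'(2) dvd_mult[OF kk]])
    then show ?thesis by (simp add: algebra_simps)
  qed
  have x'C: "x' \<in> C"
  proof (rule ccontr)
    assume "x' \<notin> C"
    then have "x' \<in> B - {x}" using x'(1) by (auto simp: D0_def)
    then have "int p dvd (k x' - \<kappa>) - (k x' - 2 * \<kappa>)" using dvd_diff[OF const x'2] by blast
    then show False using \<kappa> by simp
  qed
  have "p - 4 \<le> card (B - {x})" using cBx by simp
  then obtain P' where P': "P' \<subseteq> B - {x}" "card P' = p - 4" using obtain_subset_with_card_n by metis
  have fP': "finite P'" "x \<notin> P'" "x' \<notin> P'" "x \<noteq> x'" using P'(1) fB finite_subset x'C x(1) disj by auto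
  \<comment> \<open>The multiples of \<open>\<kappa>\<close> add up to \<open>2 + 2 + (p - 4) = p\<close>, with only \<open>p - 2\<close> elements.\<close>
  define Y where "Y = insert x' (insert x P')"
  have YB: "Y \<inter> B = insert x P'" using x'C x(1) P'(1) disj by (auto simp: Y_def)
  have sP': "int p dvd sum k P' - int (p - 4) * \<kappa>" using sumP[OF P'(1)] P'(2) by simp
  have "int p dvd sum k Y"
  proof -
    have "int p dvd (k x' - 2 * \<kappa>) + ((k x - 2 * \<kappa>) + (sum k P' - int (p - 4) * \<kappa>))"
      using x'2 x(2) sP' by (intro dvd_add)
    moreover have "(k x' - 2 * \<kappa>) + ((k x - 2 * \<kappa>) + (sum k P' - int (p - 4) * \<kappa>)) = sum k Y - int p * \<kappa>"
      using fP' p_ge_5 by (simp add: Y_def of_nat_diff algebra_simps)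
    ultimately show ?thesis by (metis dvd_diff_imp_dvd_iff dvd_triv_left)
  qed
  moreover have "\<not> int p dvd sum k (Y \<inter> B)"
  proof
    assume z: "int p dvd sum k (Y \<inter> B)"
    have "int p dvd (k x - 2 * \<kappa>) + (sum k P' - int (p - 4) * \<kappa>)" using x(2) sP' by (rule dvd_add)
    then have "int p dvd sum k (Y \<inter> B) - ((k x - 2 * \<kappa>) + (sum k P' - int (p - 4) * \<kappa>))"
      using z by (rule dvd_diff[rotated])
    moreover have "sum k (Y \<inter> B) - ((k x - 2 * \<kappa>) + (sum k P' - int (p - 4) * \<kappa>)) = (int p - 2) * \<kappa>"
      unfolding YB using fP' p_ge_5 by (simp add: of_nat_diff algebra_simps)
    ultimately have "int p dvd (int p - 2) * \<kappa>" by simp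
    then have "int p dvd int p - 2" using prime_dvd_mult_int \<kappa> by blast
    then have "int p dvd int p - (int p - 2)" by (rule dvd_diff[OF dvd_refl])
    then show False using p_ge_5 by (auto dest: zdvd_imp_le)
  qed
  moreover have "Y \<subseteq> B \<union> C" using x'C x(1) P'(1) by (auto simp: Y_def)
  moreover have "card Y < card C" using fP' P'(2) p_ge_5 cC by (simp add: Y_def)
  ultimately show False
    using extremal_no_crossing[OF mc order_refl p1(1), of Y] unfolding B_def C_def by blast
qed

text \<open>In an extremal configuration, block \<open>0\<close> has no proper subset with vanishing \<open>k\<close>-sum by
\<open>extremal_minimal\<close>. Hence it has at most \<open>p\<close> elements, so all blocks have exactly \<open>p\<close>, and \<open>k\<close> is
constant on it. An element with another value of \<open>k\<close> would form a small crossing set together with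
some elements of block \<open>0\<close>. So \<open>k\<close> is constant, which \<open>constant_weight_not_nonvanishing\<close> excludes.\<close>

theorem F_eq_zero: "F j = 0"
proof (rule ccontr)
  assume "F j \<noteq> 0"
  then have "nonvanishing j" by (rule nonvanishing_of_nonzero)
  then obtain j1 \<pi> where mc: "extremal j1 \<pi>" by (rule extremal_exists)
  define B where "B = fibre T \<pi> 0"
  have p1: "1 < p" "0 < p" "3 \<le> p" using p_ge_5 by auto
  have BT: "B \<subseteq> T" unfolding B_def by (rule fibre_sub)
  have fB: "finite B" using finite_sub[OF BT] .
  have zB: "int p dvd sum k B" and neB: "B \<noteq> {}"
    using fibre_colour(1,2)[OF extremal_D(3)[OF mc], of 0] p1 unfolding B_def zero_sum_def by auto
  have min: "card B < 2 * card D" if "D \<subseteq> B" "D \<noteq> {}" "int p dvd sum k D" for D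
    using extremal_minimal[OF mc] that unfolding B_def by blast
  have minimal: "\<not> int p dvd sum k W" if W: "W \<subseteq> B" "W \<noteq> {}" "W \<noteq> B" for W
  proof
    assume z: "int p dvd sum k W"
    have "int p dvd sum k (B - W)" using zB z sum_diff[OF fB W(1), of k] by simp
    moreover have "B - W \<noteq> {}" using W by blast
    ultimately have "card B < 2 * card (B - W)" using min[of "B - W"] by blast
    moreover have "card B < 2 * card W" using min[OF W(1,2) z] .
    moreover have "card (B - W) = card B - card W"
      using card_Diff_subset[OF finite_subset[OF W(1) fB] W(1)] .
    moreover have "card W \<le> card B" using card_mono[OF fB W(1)] .
    ultimately show False by linarith
  qed
  have cBle: "card B \<le> p"
  proof (rule ccontr)
    assume c: "\<not> ?thesis"
    then obtain D where D: "D \<subseteq> B" "D \<noteq> {}" "card D \<le> p" "int p dvd sum k D"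
      using k_zero_subset[OF BT] by (metis linear)
    then have "D \<noteq> B" using c by auto
    then show False using minimal D by blast
  qed
  have s: "(\<Sum>i\<in>{1..<p}. card (fibre T \<pi> i)) \<le> (\<Sum>i\<in>{1..<p}. p)"
    using extremal_D(4)[OF mc] by (intro sum_mono) auto
  then have s': "(\<Sum>i\<in>{1..<p}. card (fibre T \<pi> i)) \<le> (p - 1) * p" by simp
  have pp: "p + (p - 1) * p = p * p" using p1 by (cases p) auto
  have tot: "p * p \<le> card B + (\<Sum>i\<in>{1..<p}. card (fibre T \<pi> i))"
    using extremal_card_T[OF mc] by (simp add: B_def)
  have cB: "card B = p" using tot s' pp cBle by linarith
  have "(\<Sum>i\<in>{1..<p}. card (fibre T \<pi> i)) = (p - 1) * p" using tot s' pp cB by linarith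
  then have eq: "(\<Sum>i\<in>{1..<p}. card (fibre T \<pi> i)) = (\<Sum>i\<in>{1..<p}. p)" by simp
  have cC: "card (fibre T \<pi> l) = p" if "1 \<le> l" "l < p" for l
    using sum_mono_inv[OF eq] extremal_D(4)[OF mc] that by auto
  obtain y where y: "y \<in> B" using neB by blast
  define \<kappa> where "\<kappa> = k y"
  have \<kappa>: "\<not> int p dvd \<kappa>" unfolding \<kappa>_def using y BT k_nonzero by blast
  have constB: "int p dvd k t - \<kappa>" if "t \<in> B" for t
    unfolding \<kappa>_def by (rule minimal_zero_sum_constant[OF p_prime p1(3) fB cB minimal that y])
  have const: "int p dvd k t - \<kappa>" if t: "t \<in> T" for t
  proof (cases "\<pi> t = 0")
    case True
    then show ?thesis using constB t by (simp add: B_def fibre_def)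
  next
    case False
    define l where "l = \<pi> t"
    have l: "1 \<le> l" "l < p" using False fibre_colour(3)[OF extremal_D(3)[OF mc] t] by (simp_all add: l_def)
    have tl: "t \<in> fibre T \<pi> l" "t \<notin> B" using t False by (simp_all add: l_def fibre_def B_def)
    obtain e where e: "1 \<le> e" "e < p" "int p dvd k t - int e * \<kappa>"
      using class_multiple[OF \<kappa> k_nonzero[OF t]] by blast
    have "e = 1"
    proof (rule ccontr)
      assume "e \<noteq> 1"
      obtain Q where Q: "Q \<subseteq> B" "card Q = p - e"
        using obtain_subset_with_card_n[of "p - e" B] cB by auto
      have fQ: "finite Q" "t \<notin> Q" using Q(1) fB tl(2) finite_subset by auto
      have sQ: "int p dvd sum k Q - int (p - e) * \<kappa>" using sum_const_mod[of Q \<kappa>] constB Q by auto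
      then have "int p dvd (k t - int e * \<kappa>) + (sum k Q - int (p - e) * \<kappa>)" by (rule dvd_add[OF e(3)])
      moreover have "(k t - int e * \<kappa>) + (sum k Q - int (p - e) * \<kappa>) = sum k (insert t Q) - int p * \<kappa>"
        using fQ e by (simp add: of_nat_diff algebra_simps)
      ultimately have z: "int p dvd sum k (insert t Q)" by (metis dvd_diff_imp_dvd_iff dvd_triv_left)
      have QB: "insert t Q \<inter> B = Q" using Q(1) tl(2) by blast
      have "\<not> int p dvd sum k (insert t Q \<inter> B)"
      proof
        assume "int p dvd sum k (insert t Q \<inter> B)"
        then have "int p dvd int (p - e) * \<kappa>" unfolding QB using sQ dvd_diff_imp_dvd_iff by blast
        then have "int p dvd int (p - e)" using prime_dvd_mult_int \<kappa> by blast
        then have "p dvd p - e" by (simp only: int_dvd_int_iff)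
        then show False using e by (auto dest: dvd_imp_le)
      qed
      moreover have "insert t Q \<subseteq> B \<union> fibre T \<pi> l" using Q(1) tl(1) by blast
      moreover have "card (insert t Q) < card (fibre T \<pi> l)"
        using fQ Q(2) e \<open>e \<noteq> 1\<close> cC[OF l] by simp
      ultimately show False using extremal_no_crossing[OF mc l _ z] unfolding B_def by blast
    qed
    then show ?thesis using e(3) by simp
  qed
  have "\<not> nonvanishing j1"
    using constant_weight_not_nonvanishing[OF const \<kappa> extremal_D(3)[OF mc] p1(1)] cC[of 1] p1(1) by simp
  then show False using extremal_D(2)[OF mc] by blast
qed

end

section \<open>Functionals that vanish on decomposable forms\<close>

text \<open>A commutative algebra over a field, via \<open>emb\<close>, with an action by algebra automorphisms and a family
\<open>Hm\<close> of stable subspaces playing the part of the forms of each degree, together with a functional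
as described at the beginning. The order of the factors in \<open>act_comp\<close> is that of functions composed with group
elements.\<close>

locale heisenberg_action = group G
  for G :: "('g, 'b) monoid_scheme" (structure) +
  fixes p N :: nat and \<zeta> :: "'k::field" and emb :: "'k \<Rightarrow> 'r::comm_ring_1"
    and act :: "'g \<Rightarrow> 'r \<Rightarrow> 'r" and Hm :: "nat \<Rightarrow> 'r set" and \<phi> :: "'r \<Rightarrow> 'k" and c :: 'g
  assumes p_prime: "Factorial_Ring.prime p" and p_ge_5: "5 \<le> p" and N_large: "p\<^sup>2 \<le> N"
    and p_nonzero: "of_nat p \<noteq> (0::'k)" and root: "\<zeta> ^ p = 1" "\<zeta> \<noteq> 1"
    and emb_add: "emb (x + y) = emb x + emb y" and emb_mult: "emb (x * y) = emb x * emb y" and emb_1: "emb 1 = 1"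
    and act_add: "g \<in> carrier G \<Longrightarrow> act g (u + v) = act g u + act g v"
    and act_mult: "g \<in> carrier G \<Longrightarrow> act g (u * v) = act g u * act g v"
    and act_emb: "g \<in> carrier G \<Longrightarrow> act g (emb x) = emb x"
    and act_one: "u \<in> Hm d \<Longrightarrow> act \<one> u = u"
    and act_comp: "g \<in> carrier G \<Longrightarrow> h \<in> carrier G \<Longrightarrow> u \<in> Hm d \<Longrightarrow> act (g \<otimes> h) u = act h (act g u)"
    and act_Hm: "g \<in> carrier G \<Longrightarrow> u \<in> Hm d \<Longrightarrow> act g u \<in> Hm d"
    and Hm_add: "u \<in> Hm d \<Longrightarrow> v \<in> Hm d \<Longrightarrow> u + v \<in> Hm d"
    and Hm_scale: "u \<in> Hm d \<Longrightarrow> emb x * u \<in> Hm d"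
    and Hm_mult: "u \<in> Hm d \<Longrightarrow> v \<in> Hm e \<Longrightarrow> u * v \<in> Hm (d + e)" and Hm_1: "1 \<in> Hm 0"
    and \<phi>_add: "\<phi> (u + v) = \<phi> u + \<phi> v" and \<phi>_scale: "\<phi> (emb x * u) = x * \<phi> u"
    and \<phi>_act: "g \<in> carrier G \<Longrightarrow> u \<in> Hm N \<Longrightarrow> \<phi> (act g u) = \<phi> u"
    and \<phi>_invariant: "u \<in> Hm d \<Longrightarrow> v \<in> Hm e \<Longrightarrow> 0 < d \<Longrightarrow> 0 < e \<Longrightarrow> d + e = N \<Longrightarrow>
      (\<And>g. g \<in> carrier G \<Longrightarrow> act g u = u) \<Longrightarrow> \<phi> (u * v) = 0"
    and c_central: "c \<in> carrier G" "g \<in> carrier G \<Longrightarrow> g \<otimes> c = c \<otimes> g"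
    and exponent: "g \<in> carrier G \<Longrightarrow> g [^] p = \<one>"
begin

abbreviation Zt :: "int \<Rightarrow> 'k" where "Zt n \<equiv> \<zeta> powi n"

lemma zeta_nz: "\<zeta> \<noteq> 0"
  using root(1) p_ge_5 by (metis not_one_le_zero one_neq_zero power_0_left zero_less_one le_trans numeral_One not_numeral_le_zero)

lemma Zt_add: "Zt (m + n) = Zt m * Zt n"
  using zeta_nz by (simp add: power_int_add)

lemma Zt_mult_p: "Zt (int p * n) = 1"
  using root(1) by (simp add: power_int_mult)

lemma Zt_cong: "int p dvd m - n \<Longrightarrow> Zt m = Zt n"
proof -
  assume "int p dvd m - n"
  then obtain q where "m - n = int p * q" by blast
  then have "m = n + int p * q" by simp
  then show ?thesis by (simp only: Zt_add Zt_mult_p mult_1_right)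
qed

lemma Zt_eq_1: "Zt n = 1 \<longleftrightarrow> int p dvd n"
proof
  assume "int p dvd n" then show "Zt n = 1" using Zt_cong[of n 0] by simp
next
  assume n: "Zt n = 1"
  show "int p dvd n"
  proof (rule ccontr)
    assume "\<not> int p dvd n"
    moreover have "Factorial_Ring.prime (int p)" using p_prime by simp
    ultimately have "coprime n (int p)" using prime_imp_coprime coprime_commute by blast
    then obtain m where "[n * m = 1] (mod int p)" using cong_solve_coprime_int by blast
    then have "int p dvd n * m - 1" by (simp add: cong_iff_dvd_diff)
    then have "Zt (n * m) = Zt 1" by (rule Zt_cong)
    then have "\<zeta> = 1" using n by (simp add: power_int_mult)
    then show False using root(2) by simp
  qed
qed

lemma sum_Zt: "(\<Sum>i<p. Zt (int i * n)) = (if int p dvd n then of_nat p else 0)"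
proof (cases "int p dvd n")
  case True
  then have "Zt (int i * n) = 1" for i by (simp add: Zt_eq_1)
  then show ?thesis using True by simp
next
  case False
  then have ne: "Zt n \<noteq> 1" by (simp add: Zt_eq_1)
  have e: "Zt (int i * n) = Zt n ^ i" for i
    by (metis mult.commute power_int_mult power_int_of_nat)
  have "(\<Sum>i<p. Zt n ^ i) = (Zt n ^ p - 1) / (Zt n - 1)" using ne by (simp add: geometric_sum)
  moreover have "Zt n ^ p = 1" using e[of p] Zt_mult_p[of n] by simp
  ultimately show ?thesis using False e by simp
qed

lemma emb_0: "emb 0 = 0" using emb_add[of 0 0] by simp
lemma emb_sum: "emb (sum f A) = (\<Sum>x\<in>A. emb (f x))"
  by (induction A rule: infinite_finite_induct) (auto simp: emb_0 emb_add)
lemma act_0: "g \<in> carrier G \<Longrightarrow> act g 0 = 0" using act_add[of g 0 0] by simp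
lemma act_1: "g \<in> carrier G \<Longrightarrow> act g 1 = 1" using act_emb[of g 1] by (simp add: emb_1)
lemma act_sum: "g \<in> carrier G \<Longrightarrow> act g (sum f A) = (\<Sum>x\<in>A. act g (f x))"
  by (induction A rule: infinite_finite_induct) (auto simp: act_0 act_add)
lemma act_prod: "g \<in> carrier G \<Longrightarrow> act g (prod f A) = (\<Prod>x\<in>A. act g (f x))"
  by (induction A rule: infinite_finite_induct) (auto simp: act_1 act_mult)
lemma act_scale: "g \<in> carrier G \<Longrightarrow> act g (emb x * u) = emb x * act g u"
  by (simp add: act_mult act_emb)
lemma \<phi>_0: "\<phi> 0 = 0" using \<phi>_scale[of 0 0] by (simp add: emb_0)
lemma \<phi>_sum: "\<phi> (sum f A) = (\<Sum>x\<in>A. \<phi> (f x))"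
  by (induction A rule: infinite_finite_induct) (auto simp: \<phi>_0 \<phi>_add)
lemma Hm_sum: "finite A \<Longrightarrow> A \<noteq> {} \<Longrightarrow> (\<And>x. x \<in> A \<Longrightarrow> f x \<in> Hm d) \<Longrightarrow> sum f A \<in> Hm d"
  by (induction A rule: finite_ne_induct) (auto simp: Hm_add)
lemma Hm_prod: "finite A \<Longrightarrow> (\<And>t. t \<in> A \<Longrightarrow> f t \<in> Hm (e t)) \<Longrightarrow> prod f A \<in> Hm (sum e A)"
  by (induction A rule: finite_induct) (auto simp: Hm_1 Hm_mult)
lemma Hm_prod_1: "(\<And>t. t \<in> A \<Longrightarrow> f t \<in> Hm 1) \<Longrightarrow> finite A \<Longrightarrow> prod f A \<in> Hm (card A)"
  using Hm_prod[of A f "\<lambda>_. 1"] by simp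

lemma act_pow_add:
  assumes "g \<in> carrier G" "u \<in> Hm d"
  shows "act (g [^] m) (act (g [^] n) u) = act (g [^] (n + m :: nat)) u"
  using assms by (simp add: act_comp[symmetric] nat_pow_mult)

lemma act_pow_p: "g \<in> carrier G \<Longrightarrow> u \<in> Hm d \<Longrightarrow> act (g [^] (p * n :: nat)) u = u"
  using exponent by (simp add: nat_pow_pow[symmetric] act_one)

lemma act_pow_mod:
  assumes "g \<in> carrier G" "u \<in> Hm d"
  shows "act (g [^] (n mod p)) u = act (g [^] n) u"
proof -
  have "act (g [^] n) u = act (g [^] (p * (n div p) + n mod p)) u" by simp
  also have "\<dots> = act (g [^] (n mod p)) (act (g [^] (p * (n div p))) u)"
    by (rule act_pow_add[OF assms, symmetric])
  also have "\<dots> = act (g [^] (n mod p)) u" using act_pow_p[OF assms] by simp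
  finally show ?thesis by simp
qed

text \<open>The projection to the eigenspace of \<open>g\<close> for the eigenvalue \<open>\<zeta> ^ i\<close>.\<close>

definition proj :: "'g \<Rightarrow> nat \<Rightarrow> 'r \<Rightarrow> 'r" where
  "proj g i u = emb (inverse (of_nat p)) * (\<Sum>n<p. emb (Zt (- (int i * int n))) * act (g [^] n) u)"

lemma proj_Hm: "g \<in> carrier G \<Longrightarrow> u \<in> Hm d \<Longrightarrow> proj g i u \<in> Hm d"
  unfolding proj_def using p_ge_5 by (intro Hm_scale Hm_sum act_Hm) (auto simp: lessThan_empty_iff)

lemma sum_proj:
  assumes "g \<in> carrier G" "u \<in> Hm d"
  shows "(\<Sum>i<p. proj g i u) = u"
proof -
  have "(\<Sum>i<p. proj g i u) = emb (inverse (of_nat p)) *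
      (\<Sum>n<p. emb (\<Sum>i<p. Zt (int i * (- int n))) * act (g [^] n) u)"
    unfolding proj_def sum_distrib_left[symmetric] emb_sum sum_distrib_right
    by (subst sum.swap) simp
  also have "(\<Sum>n<p. emb (\<Sum>i<p. Zt (int i * (- int n))) * act (g [^] n) u)
      = (\<Sum>n<p. if n = 0 then emb (of_nat p) * u else 0)"
  proof (rule sum.cong[OF refl])
    fix n assume "n \<in> {..<p}"
    then have "int p dvd - int n \<longleftrightarrow> n = 0" by (auto dest: dvd_imp_le)
    then show "emb (\<Sum>i<p. Zt (int i * (- int n))) * act (g [^] n) u = (if n = 0 then emb (of_nat p) * u else 0)"
      unfolding sum_Zt using assms by (simp add: emb_0 act_one)
  qed
  also have "\<dots> = emb (of_nat p) * u" using p_ge_5 by (simp add: sum.delta)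
  finally show ?thesis using p_nonzero by (simp add: mult.assoc[symmetric] emb_mult[symmetric] emb_1)
qed

lemma act_proj:
  assumes "g \<in> carrier G" "u \<in> Hm d"
  shows "act g (proj g i u) = emb (Zt (int i)) * proj g i u"
proof -
  let ?f = "\<lambda>n. emb (Zt (- (int i * int n))) * act (g [^] n) u"
  have g1: "act g (act (g [^] n) u) = act (g [^] Suc n) u" for n
    using assms act_comp[of "g [^] n" g u d] by simp
  have f0: "?f p = ?f 0"
  proof -
    have "Zt (- (int i * int p)) = 1" by (simp add: Zt_eq_1)
    moreover have "act (g [^] p) u = act (g [^] (0::nat)) u" using exponent[OF assms(1)] by simp
    ultimately show ?thesis by simp
  qed
  have s1: "(\<Sum>n<p. ?f (Suc n)) = (\<Sum>n<p. ?f n)"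
  proof -
    have "?f 0 + (\<Sum>n<p. ?f (Suc n)) = (\<Sum>n<Suc p. ?f n)" by (rule sum.lessThan_Suc_shift[symmetric])
    also have "\<dots> = (\<Sum>n<p. ?f n) + ?f p" by (rule sum.lessThan_Suc)
    finally show ?thesis unfolding f0 by simp
  qed
  have "act g (\<Sum>n<p. ?f n) = (\<Sum>n<p. emb (Zt (- (int i * int n))) * act (g [^] Suc n) u)"
    using assms g1 by (simp add: act_sum act_scale)
  also have "\<dots> = (\<Sum>n<p. emb (Zt (int i)) * ?f (Suc n))"
  proof (rule sum.cong[OF refl])
    fix n
    have "Zt (- (int i * int n)) = Zt (int i) * Zt (- (int i * int (Suc n)))"
      unfolding Zt_add[symmetric] by (simp add: algebra_simps)
    then show "emb (Zt (- (int i * int n))) * act (g [^] Suc n) u = emb (Zt (int i)) * ?f (Suc n)"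
      by (simp only: emb_mult mult.assoc)
  qed
  also have "\<dots> = emb (Zt (int i)) * (\<Sum>n<p. ?f n)" unfolding s1[symmetric] by (simp only: sum_distrib_left)
  finally show ?thesis unfolding proj_def using assms by (simp add: act_scale mult.left_commute)
qed

lemma proj_eigen:
  assumes g: "g \<in> carrier G" "h \<in> carrier G" "g \<otimes> h = h \<otimes> g" and u: "u \<in> Hm d" "act h u = emb x * u"
  shows "act h (proj g i u) = emb x * proj g i u"
proof -
  have pw: "act h (act (g [^] n) u) = emb x * act (g [^] n) u" for n :: nat
  proof -
    have "g [^] n \<otimes> h = h \<otimes> g [^] n" using g by (induction n) (auto simp: m_assoc, metis m_assoc nat_pow_closed)
    then have "act h (act (g [^] n) u) = act (g [^] n) (act h u)"
      using g u act_comp[of "g [^] n" h u d] act_comp[of h "g [^] n" u d] by simp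
    then show ?thesis using u g by (simp add: act_scale)
  qed
  have "act h (emb y * act (g [^] n) u) = emb x * (emb y * act (g [^] n) u)" for n :: nat and y
    using g pw by (simp add: act_scale mult.left_commute)
  then show ?thesis unfolding proj_def using g
    by (simp add: act_scale act_sum sum_distrib_left mult.left_commute)
qed

definition weight_vector :: "'g \<Rightarrow> int \<Rightarrow> int \<Rightarrow> 'r \<Rightarrow> bool" where
  "weight_vector g m n u \<longleftrightarrow> act g u = emb (Zt m) * u \<and> act c u = emb (Zt (- n)) * u"

definition pair :: "'g \<Rightarrow> 'g \<Rightarrow> bool" where
  "pair g h \<longleftrightarrow> g \<in> carrier G \<and> h \<in> carrier G \<and> g \<otimes> h = h \<otimes> g \<otimes> c \<and> generate G {g, h} = carrier G"

lemma weight_vector_cong: "weight_vector g m n u \<Longrightarrow> int p dvd m - m' \<Longrightarrow> int p dvd n - n' \<Longrightarrow> weight_vector g m' n' u"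
  using Zt_cong[of m m'] Zt_cong[of "- n" "- n'"] unfolding weight_vector_def by (simp add: dvd_diff_commute)

lemma weight_vector_prod:
  assumes "g \<in> carrier G" "\<And>t. t \<in> A \<Longrightarrow> weight_vector g (m t) (n t) (f t)" "finite A"
  shows "weight_vector g (sum m A) (sum n A) (prod f A)"
proof -
  have "(\<Prod>t\<in>A. emb (Zt (q t)) * f t) = emb (Zt (sum q A)) * prod f A" for q
    using assms(3) by (induction A rule: finite_induct) (auto simp: emb_1 emb_mult Zt_add ac_simps)
  moreover have "act g (prod f A) = (\<Prod>t\<in>A. emb (Zt (m t)) * f t)"
    using assms by (simp add: act_prod weight_vector_def)
  moreover have "act c (prod f A) = (\<Prod>t\<in>A. emb (Zt (- n t)) * f t)"
    using assms c_central by (simp add: act_prod weight_vector_def)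
  moreover have "(\<Sum>t\<in>A. - n t) = - sum n A" by (simp add: sum_negf)
  ultimately show ?thesis unfolding weight_vector_def by metis
qed

text \<open>From \<open>g \<otimes> h = h \<otimes> g \<otimes> c\<close> and the fact that \<open>c\<close> has the eigenvalue \<open>\<zeta> powi (- n)\<close>, applying \<open>h\<close> multiplies the eigenvalue of
\<open>g\<close> by \<open>\<zeta> powi n\<close>.\<close>

lemma weight_vector_pow:
  assumes gh: "pair g h" and u: "u \<in> Hm d" "weight_vector g m n u"
  shows "weight_vector g (m + int i * n) n (act (h [^] i) u)"
proof (induction i)
  case 0
  then show ?case using u by (simp add: act_one)
next
  case (Suc i)
  have g: "g \<in> carrier G" "h \<in> carrier G" "g \<otimes> h = h \<otimes> g \<otimes> c" using gh by (auto simp: pair_def)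
  define w where "w = act (h [^] i) u"
  have w: "w \<in> Hm d" unfolding w_def using g u by (simp add: act_Hm)
  have hw: "act h w = act (h [^] Suc i) u" unfolding w_def using g u act_comp[of "h [^] i" h u d] by simp
  have IH: "act g w = emb (Zt (m + int i * n)) * w" "act c w = emb (Zt (- n)) * w"
    using Suc unfolding w_def[symmetric] weight_vector_def by auto
  have cc: "act c (act x y) = act x (act c y)" if "x \<in> carrier G" "y \<in> Hm d" for x y
    using c_central that act_comp[of c x y d] act_comp[of x c y d] by simp
  have c': "act c (act h w) = emb (Zt (- n)) * act h w"
    using cc[OF g(2) w] IH(2) g by (simp add: act_scale)
  have "act h (act g w) = act c (act g (act h w))"
  proof -
    have "act h (act g w) = act (h \<otimes> g \<otimes> c) w" using g w act_comp[of g h w d] by simp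
    also have "\<dots> = act c (act g (act h w))"
      using g c_central w act_comp[of "h \<otimes> g" c w d] act_comp[of h g w d] by simp
    finally show ?thesis .
  qed
  also have "\<dots> = emb (Zt (- n)) * act g (act h w)"
    using cc[OF g(1) act_Hm[OF g(2) w]] c' g by (simp add: act_scale)
  finally have "emb (Zt (m + int i * n)) * act h w = emb (Zt (- n)) * act g (act h w)"
    using IH(1) g by (simp add: act_scale)
  then have "emb (Zt n) * (emb (Zt (m + int i * n)) * act h w) = emb (Zt n) * (emb (Zt (- n)) * act g (act h w))"
    by simp
  then have "emb (Zt (n + (m + int i * n))) * act h w = emb (Zt (n + - n)) * act g (act h w)"
    by (simp only: mult.assoc[symmetric] emb_mult[symmetric] Zt_add[symmetric])
  then have "act g (act h w) = emb (Zt (m + int (Suc i) * n)) * act h w"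
    by (simp add: emb_1 algebra_simps)
  then show ?case using c' unfolding hw weight_vector_def by simp
qed

lemma invariant_of_pair:
  assumes gh: "pair g h" and u: "u \<in> Hm d" "act g u = u" "act h u = u" and q: "q \<in> carrier G"
  shows "act q u = u"
proof -
  have g: "g \<in> carrier G" "h \<in> carrier G" "generate G {g, h} = carrier G" using gh by (auto simp: pair_def)
  have "q \<in> generate G {g, h}" using q g(3) by simp
  moreover have "x \<in> carrier G \<and> act x u = u" if "x \<in> generate G {g, h}" for x
    using that
  proof (induction rule: generate.induct)
    case one then show ?case using u by (simp add: act_one)
  next
    case (incl h') then show ?case using u g by auto
  next
    case (inv h')
    then have h': "h' \<in> carrier G" "act h' u = u" using u g by auto
    have "act (h' \<otimes> inv h') u = act (inv h') (act h' u)" using h' u by (intro act_comp) auto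
    then show ?case using h' u by (simp add: act_one)
  next
    case (eng h1 h2)
    then show ?case using act_comp[of h1 h2 u d] u by simp
  qed
  ultimately show ?thesis by blast
qed

lemma \<phi>_eigen_zero:
  assumes "u \<in> Hm N" "g \<in> carrier G" "act g u = emb (Zt m) * u" "\<phi> u \<noteq> 0"
  shows "int p dvd m"
proof -
  have "\<phi> u = Zt m * \<phi> u" using \<phi>_act[OF assms(2,1)] unfolding assms(3) \<phi>_scale by simp
  then have "Zt m = 1" using assms(4) by simp
  then show ?thesis by (simp add: Zt_eq_1)
qed

text \<open>A proper subproduct on which \<open>h\<close> acts trivially would be invariant under the whole group, so that
\<open>\<phi>\<close> would vanish. Hence the exponents of the eigenvalues are a minimal zero-sum sequence of length
\<open>p\<close>.\<close>

lemma \<phi>_nonzero_imp_equal_eigenvalues: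
  assumes gh: "pair g h" and e: "\<And>i. i < p \<Longrightarrow> e i \<in> Hm (d i)" "\<And>i. i < p \<Longrightarrow> 0 < d i" "(\<Sum>i<p. d i) = N"
    and inv: "\<And>i. i < p \<Longrightarrow> act g (e i) = e i" and eig: "\<And>i. i < p \<Longrightarrow> act h (e i) = emb (Zt (int (f i))) * e i"
    and f: "\<And>i. i < p \<Longrightarrow> f i < p" and nz: "\<phi> (\<Prod>i<p. e i) \<noteq> 0" and il: "i < p" "l < p"
  shows "f i = f l"
proof -
  have g: "g \<in> carrier G" "h \<in> carrier G" using gh by (auto simp: pair_def)
  have hprod: "act h (prod e A) = emb (Zt (\<Sum>i\<in>A. int (f i))) * prod e A" if "A \<subseteq> {..<p}" for A
  proof -
    have fA: "finite A" using that finite_subset by blast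
    have "act h (prod e A) = (\<Prod>i\<in>A. emb (Zt (int (f i))) * e i)"
      using that eig g by (auto simp: act_prod intro!: prod.cong)
    also have "\<dots> = emb (Zt (\<Sum>i\<in>A. int (f i))) * prod e A"
      using fA by (induction A rule: finite_induct) (auto simp: emb_1 emb_mult Zt_add ac_simps)
    finally show ?thesis .
  qed
  have HmA: "prod e A \<in> Hm (sum d A)" if "A \<subseteq> {..<p}" for A
    using that e(1) finite_subset[OF that] by (intro Hm_prod) auto
  have tot: "int p dvd (\<Sum>i<p. int (f i))"
    using \<phi>_eigen_zero[OF _ g(2) hprod nz] HmA[of "{..<p}"] e(3) by simp
  have min: "\<not> int p dvd (\<Sum>i\<in>W. int (f i))" if W: "W \<subseteq> {..<p}" "W \<noteq> {}" "W \<noteq> {..<p}" for W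
  proof
    assume z: "int p dvd (\<Sum>i\<in>W. int (f i))"
    have fW: "finite W" using W(1) finite_subset by blast
    have "Zt (\<Sum>i\<in>W. int (f i)) = 1" using z Zt_eq_1 by blast
    then have "act h (prod e W) = prod e W" unfolding hprod[OF W(1)] by (simp add: emb_1)
    moreover have "act g (prod e W) = prod e W" using W(1) inv g by (auto simp: act_prod intro!: prod.cong)
    ultimately have I: "\<And>q. q \<in> carrier G \<Longrightarrow> act q (prod e W) = prod e W"
      using invariant_of_pair[OF gh HmA[OF W(1)]] by blast
    have pos: "0 < sum d A" if "A \<subseteq> {..<p}" "A \<noteq> {}" for A
    proof (rule sum_pos)
      show "finite A" using that(1) finite_subset by blast
      show "0 < d i" if "i \<in> A" for i using e(2)[of i] that \<open>A \<subseteq> {..<p}\<close> by auto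
    qed (rule that(2))
    have sub: "{..<p} - W \<subseteq> {..<p}" "{..<p} - W \<noteq> {}" using W by auto
    have "sum d W + sum d ({..<p} - W) = N"
      using e(3) sum.subset_diff[OF W(1), of d] by simp
    then have "\<phi> (prod e W * prod e ({..<p} - W)) = 0"
      using I by (intro \<phi>_invariant[OF HmA[OF W(1)] HmA[OF sub(1)] pos[OF W(1,2)] pos[OF sub]])
    then show False using nz prod.subset_diff[OF W(1), of e] by (simp add: mult.commute)
  qed
  have "int p dvd int (f i) - int (f l)"
    using p_ge_5 il min by (intro minimal_zero_sum_constant[OF p_prime, of "{..<p}" "\<lambda>i. int (f i)"]) auto
  then have "int (f i) mod int p = int (f l) mod int p" using mod_eq_dvd_iff by blast
  then show ?thesis using f[OF il(1)] f[OF il(2)] by simp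
qed

text \<open>The action of the power of \<open>h\<close> with an integral exponent, which matters only modulo \<open>p\<close>.\<close>

definition pow_act :: "'g \<Rightarrow> int \<Rightarrow> 'r \<Rightarrow> 'r" where
  "pow_act h n u = act (h [^] nat (n mod int p)) u"

lemma p_pos: "int p > 0" using p_ge_5 by simp

lemma pow_act_cong: "int p dvd m - n \<Longrightarrow> pow_act h m u = pow_act h n u"
  unfolding pow_act_def by (simp add: mod_eq_dvd_iff[symmetric])

lemma pow_act_nat: "h \<in> carrier G \<Longrightarrow> u \<in> Hm d \<Longrightarrow> pow_act h (int n) u = act (h [^] n) u"
  unfolding pow_act_def using act_pow_mod[of h u d n] by (simp add: nat_mod_distrib)

lemma pow_act_0: "u \<in> Hm d \<Longrightarrow> pow_act h 0 u = u"
  unfolding pow_act_def by (simp add: act_one)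

lemma pow_act_Hm: "h \<in> carrier G \<Longrightarrow> u \<in> Hm d \<Longrightarrow> pow_act h n u \<in> Hm d"
  unfolding pow_act_def by (simp add: act_Hm)

lemma pow_act_add:
  assumes "h \<in> carrier G" "u \<in> Hm d"
  shows "pow_act h m (pow_act h n u) = pow_act h (n + m) u"
proof -
  have "pow_act h m (pow_act h n u) = act (h [^] (nat (n mod int p) + nat (m mod int p))) u"
    unfolding pow_act_def using act_pow_add[OF assms] .
  also have "\<dots> = pow_act h (int (nat (n mod int p) + nat (m mod int p))) u"
    by (rule pow_act_nat[OF assms, symmetric])
  also have "\<dots> = pow_act h (n + m) u"
    by (rule pow_act_cong) (use p_pos in \<open>simp add: mod_eq_dvd_iff[symmetric] mod_simps\<close>)
  finally show ?thesis .
qed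

lemma pow_act_prod: "h \<in> carrier G \<Longrightarrow> pow_act h n (prod f A) = (\<Prod>t\<in>A. pow_act h n (f t))"
  unfolding pow_act_def by (simp add: act_prod)

lemma pow_act_sum: "h \<in> carrier G \<Longrightarrow> pow_act h n (sum f A) = (\<Sum>t\<in>A. pow_act h n (f t))"
  unfolding pow_act_def by (simp add: act_sum)

lemma pow_act_wt:
  assumes gh: "pair g h" and u: "u \<in> Hm d" "weight_vector g m n u"
  shows "weight_vector g (m + i * n) n (pow_act h i u)"
proof -
  have "weight_vector g (m + int (nat (i mod int p)) * n) n (pow_act h i u)"
    unfolding pow_act_def by (rule weight_vector_pow[OF assms])
  moreover have "int p dvd (m + int (nat (i mod int p)) * n) - (m + i * n)"
  proof -
    have "(m + int (nat (i mod int p)) * n) - (m + i * n) = (i mod int p - i) * n"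
      using p_pos by (simp add: algebra_simps)
    moreover have "int p dvd i mod int p - i"
      using dvd_minus_mod[of "int p" i] by (simp only: dvd_diff_commute)
    ultimately show ?thesis by simp
  qed
  ultimately show ?thesis by (rule weight_vector_cong) simp
qed

lemma pow_act_eigen:
  assumes h: "h \<in> carrier G" and u: "u \<in> Hm d" "act h u = emb (Zt q) * u"
  shows "pow_act h n u = emb (Zt (n * q)) * u"
proof -
  have pw: "act (h [^] i) u = emb (Zt (int i * q)) * u" for i
  proof (induction i)
    case 0 then show ?case using u by (simp add: act_one emb_1)
  next
    case (Suc i)
    have "act (h [^] Suc i) u = act h (act (h [^] i) u)"
      using h u act_comp[of "h [^] i" h u d] by simp
    also have "\<dots> = emb (Zt (int i * q)) * (emb (Zt q) * u)" using Suc u h by (simp add: act_scale)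
    also have "\<dots> = emb (Zt (int i * q + q)) * u" by (simp only: mult.assoc[symmetric] emb_mult[symmetric] Zt_add)
    finally show ?case by (simp add: algebra_simps)
  qed
  have "Zt (int (nat (n mod int p)) * q) = Zt (n * q)"
  proof (rule Zt_cong)
    have "int (nat (n mod int p)) * q - n * q = (n mod int p - n) * q"
      using p_pos by (simp add: algebra_simps)
    moreover have "int p dvd n mod int p - n"
      using dvd_minus_mod[of "int p" n] by (simp only: dvd_diff_commute)
    ultimately show "int p dvd int (nat (n mod int p)) * q - n * q" by simp
  qed
  then show ?thesis unfolding pow_act_def pw by simp
qed

lemma proj_weight_vector_0:
  assumes gh: "pair g h" and u: "u \<in> Hm d" "weight_vector g 0 0 u"
  shows "act g (proj h i u) = proj h i u"
proof -
  have g: "g \<in> carrier G" "h \<in> carrier G" using gh by (auto simp: pair_def)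
  have "act g (act (h [^] n) u) = act (h [^] n) u" for n :: nat
    using weight_vector_pow[OF gh u, of n] by (simp add: weight_vector_def emb_1)
  then show ?thesis unfolding proj_def using g by (simp add: act_scale act_sum)
qed

definition shifted_product :: "'g \<Rightarrow> ('i \<Rightarrow> 'r) \<Rightarrow> ('i \<Rightarrow> int) \<Rightarrow> 'i set \<Rightarrow> 'r" where
  "shifted_product h v j W = (\<Prod>t\<in>W. pow_act h (j t) (v t))"

text \<open>A zero-sum block is a form fixed by \<open>g\<close> and \<open>c\<close>. Decomposing the \<open>p\<close> blocks of a colouring into
eigenvectors of \<open>h\<close>, only products with equal eigenvalues contribute by
\<open>\<phi>_nonzero_imp_equal_eigenvalues\<close>, and on these a shift of the blocks acts through the sum of the exponents.
The sum over all shifts of one block is a multiple of its projection to the invariants, times the rest.\<close>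

lemma shear_system_monomials:
  fixes T :: "'i set"
  assumes gh: "pair g h" and T: "finite T" "card T = N"
    and v: "\<And>t. t \<in> T \<Longrightarrow> v t \<in> Hm 1" "\<And>t. t \<in> T \<Longrightarrow> weight_vector g (s t) (k t) (v t)"
  shows "shear_system p T s k (\<lambda>j. \<phi> (shifted_product h v j T))"
proof -
  have g: "g \<in> carrier G" "h \<in> carrier G" using gh by (auto simp: pair_def)
  have fin: "finite W" if "W \<subseteq> T" for W using that T finite_subset by blast
  have mon_Hm: "shifted_product h v j W \<in> Hm (card W)" if "W \<subseteq> T" for j W
    unfolding shifted_product_def using that v(1) g fin[OF that] by (intro Hm_prod_1 pow_act_Hm) auto
  have mon_wt: "weight_vector g (sum (sheared_weight s k j) W) (sum k W) (shifted_product h v j W)" if "W \<subseteq> T" for j W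
    unfolding shifted_product_def
  proof (rule weight_vector_prod[OF g(1) _ fin[OF that]])
    fix t assume "t \<in> W"
    then show "weight_vector g (sheared_weight s k j t) (k t) (pow_act h (j t) (v t))"
      unfolding sheared_weight_def using that v by (intro pow_act_wt[OF gh]) auto
  qed
  have mon_wt0: "weight_vector g 0 0 (shifted_product h v j W)" if "W \<subseteq> T" "zero_sum p s k j W" for j W
    using weight_vector_cong[OF mon_wt[OF that(1), of j], of 0 0] that(2) by (simp add: zero_sum_def)
  have mon_shift: "shifted_product h v (\<lambda>t. j t + c) W = pow_act h c (shifted_product h v j W)" if "W \<subseteq> T" for j c W
  proof -
    have "pow_act h c (shifted_product h v j W) = (\<Prod>t\<in>W. pow_act h c (pow_act h (j t) (v t)))"
      unfolding shifted_product_def by (rule pow_act_prod[OF g(2)])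
    also have "\<dots> = shifted_product h v (\<lambda>t. j t + c) W" unfolding shifted_product_def
      using that v(1) by (intro prod.cong refl pow_act_add[OF g(2)]) auto
    finally show ?thesis by simp
  qed
  have mon_cong: "shifted_product h v j W = shifted_product h v j' W" if "\<And>t. t \<in> W \<Longrightarrow> j t = j' t" for j j' W
    unfolding shifted_product_def using that by (intro prod.cong) auto
  show ?thesis
  proof
    show "Factorial_Ring.prime p" "5 \<le> p" "finite T" "p\<^sup>2 \<le> card T" "of_nat p \<noteq> (0::'k)"
      using p_prime p_ge_5 T N_large p_nonzero by auto
  next
    fix j j' :: "'i \<Rightarrow> int"
    assume "\<And>t. t \<in> T \<Longrightarrow> int p dvd j t - j' t"
    then have "shifted_product h v j T = shifted_product h v j' T" unfolding shifted_product_def by (intro prod.cong refl pow_act_cong)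
    then show "\<phi> (shifted_product h v j T) = \<phi> (shifted_product h v j' T)" by simp
  next
    fix j assume nz: "\<phi> (shifted_product h v j T) \<noteq> 0"
    have H: "shifted_product h v j T \<in> Hm N" using mon_Hm[of T j] T by simp
    have e: "act g (shifted_product h v j T) = emb (Zt (sum (sheared_weight s k j) T)) * shifted_product h v j T"
      "act c (shifted_product h v j T) = emb (Zt (- sum k T)) * shifted_product h v j T"
      using mon_wt[of T j] by (simp_all only: weight_vector_def subset_refl simp_thms)
    have "int p dvd sum (sheared_weight s k j) T" by (rule \<phi>_eigen_zero[OF H g(1) e(1) nz])
    moreover have "int p dvd sum k T" using \<phi>_eigen_zero[OF H c_central(1) e(2) nz] by simp
    ultimately show "zero_sum p s k j T" by (simp add: zero_sum_def)
  next
    fix j :: "'i \<Rightarrow> int" and W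
    assume W: "W \<subseteq> T" "W \<noteq> {}" "W \<noteq> T" "zero_sum p s k j W"
    define u where "u = shifted_product h v j W"
    have u: "u \<in> Hm (card W)" "weight_vector g 0 0 u" using mon_Hm mon_wt0 W unfolding u_def by auto
    have split: "shifted_product h v (shift j W (int n)) T = act (h [^] n) u * shifted_product h v j (T - W)" for n
    proof -
      have "shifted_product h v (shift j W (int n)) T = shifted_product h v (shift j W (int n)) (T - W) * shifted_product h v (shift j W (int n)) W"
        unfolding shifted_product_def by (rule prod.subset_diff[OF W(1) T(1)])
      also have "shifted_product h v (shift j W (int n)) (T - W) = shifted_product h v j (T - W)"
        by (rule mon_cong) (simp add: shift_def)
      also have "shifted_product h v (shift j W (int n)) W = shifted_product h v (\<lambda>t. j t + int n) W"
        by (rule mon_cong) (simp add: shift_def)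
      also have "\<dots> = act (h [^] n) u"
        unfolding mon_shift[OF W(1)] u_def[symmetric] by (rule pow_act_nat[OF g(2) u(1)])
      finally show ?thesis by (simp add: mult.commute)
    qed
    have pr: "act h (proj h 0 u) = proj h 0 u" using act_proj[OF g(2) u(1), of 0] by (simp add: emb_1)
    have sub: "T - W \<subseteq> T" "T - W \<noteq> {}" using W by auto
    have cards: "card W + card (T - W) = N" "0 < card W" "0 < card (T - W)"
      using W fin[OF W(1)] T card_Diff_subset[OF fin[OF W(1)] W(1)] card_mono[OF T(1) W(1)] fin[OF sub(1)] sub(2)
      by (auto simp: card_gt_0_iff)
    have "\<phi> (proj h 0 u * shifted_product h v j (T - W)) = 0"
      using cards invariant_of_pair[OF gh proj_Hm[OF g(2) u(1)] proj_weight_vector_0[OF gh u] pr]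
      by (intro \<phi>_invariant[OF proj_Hm[OF g(2) u(1)] mon_Hm[OF sub(1)]]) auto
    moreover have "proj h 0 u * shifted_product h v j (T - W)
       = emb (inverse (of_nat p)) * (\<Sum>n<p. shifted_product h v (shift j W (int n)) T)"
      unfolding proj_def split by (simp add: emb_1 sum_distrib_right mult.assoc)
    ultimately have "inverse (of_nat p) * (\<Sum>n<p. \<phi> (shifted_product h v (shift j W (int n)) T)) = 0"
      by (simp add: \<phi>_scale \<phi>_sum)
    then show "(\<Sum>n<p. \<phi> (shifted_product h v (shift j W (int n)) T)) = 0" using p_nonzero by simp
  next
    fix j :: "'i \<Rightarrow> int" and \<pi> and d d' :: "nat \<Rightarrow> int"
    assume col: "zero_sum_colouring p s k j T p \<pi>" and dd: "int p dvd (\<Sum>i<p. d i) - (\<Sum>i<p. d' i)"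
    define B where "B = fibre T \<pi>"
    have B: "B i \<subseteq> T" for i unfolding B_def fibre_def by auto
    have Bne: "B i \<noteq> {}" "zero_sum p s k j (B i)" if "i < p" for i
      using col that unfolding zero_sum_colouring_def B_def by auto
    have img: "\<pi> ` T \<subseteq> {..<p}" using col unfolding zero_sum_colouring_def by auto
    define u where "u i = shifted_product h v j (B i)" for i
    have u: "u i \<in> Hm (card (B i))" for i unfolding u_def using mon_Hm B by blast
    have uw: "weight_vector g 0 0 (u i)" if "i < p" for i unfolding u_def using mon_wt0 B Bne that by blast
    define e where "e i q = proj h q (u i)" for i q
    have eH: "e i q \<in> Hm (card (B i))" for i q unfolding e_def by (rule proj_Hm[OF g(2) u])
    have eg: "act g (e i q) = e i q" if "i < p" for i q unfolding e_def by (rule proj_weight_vector_0[OF gh u uw[OF that]])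
    have eh: "act h (e i q) = emb (Zt (int q)) * e i q" for i q unfolding e_def by (rule act_proj[OF g(2) u])
    have sumB: "(\<Sum>i<p. card (B i)) = N"
      using sum.group[OF T(1) finite_lessThan img, of "\<lambda>_. 1::nat"] T(2) by (simp add: B_def fibre_def)
    have expand: "\<phi> (shifted_product h v (\<lambda>t. j t + \<delta> (\<pi> t)) T)
        = (\<Sum>f\<in>PiE {..<p} (\<lambda>_. {..<p}). Zt (\<Sum>i<p. \<delta> i * int (f i)) * \<phi> (\<Prod>i<p. e i (f i)))" for \<delta>
    proof -
      have "shifted_product h v (\<lambda>t. j t + \<delta> (\<pi> t)) T = (\<Prod>i<p. shifted_product h v (\<lambda>t. j t + \<delta> (\<pi> t)) (B i))"
        unfolding shifted_product_def B_def fibre_def by (rule prod.group[OF T(1) finite_lessThan img, symmetric])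
      also have "\<dots> = (\<Prod>i<p. \<Sum>q<p. emb (Zt (\<delta> i * int q)) * e i q)"
      proof (rule prod.cong[OF refl])
        fix i
        have "shifted_product h v (\<lambda>t. j t + \<delta> (\<pi> t)) (B i) = shifted_product h v (\<lambda>t. j t + \<delta> i) (B i)"
          by (rule mon_cong) (simp add: B_def fibre_def)
        also have "\<dots> = pow_act h (\<delta> i) (u i)" unfolding u_def by (rule mon_shift[OF B])
        also have "\<dots> = pow_act h (\<delta> i) (\<Sum>q<p. e i q)" unfolding e_def sum_proj[OF g(2) u] by simp
        also have "\<dots> = (\<Sum>q<p. pow_act h (\<delta> i) (e i q))" by (rule pow_act_sum[OF g(2)])
        also have "\<dots> = (\<Sum>q<p. emb (Zt (\<delta> i * int q)) * e i q)"
          using pow_act_eigen[OF g(2) eH eh] by simp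
        finally show "shifted_product h v (\<lambda>t. j t + \<delta> (\<pi> t)) (B i) = (\<Sum>q<p. emb (Zt (\<delta> i * int q)) * e i q)" .
      qed
      also have "\<dots> = (\<Sum>f\<in>PiE {..<p} (\<lambda>_. {..<p}). \<Prod>i<p. emb (Zt (\<delta> i * int (f i))) * e i (f i))"
        by (rule prod_sum_PiE) auto
      also have "\<dots> = (\<Sum>f\<in>PiE {..<p} (\<lambda>_. {..<p}). emb (Zt (\<Sum>i<p. \<delta> i * int (f i))) * (\<Prod>i<p. e i (f i)))"
      proof (rule sum.cong[OF refl])
        fix f :: "nat \<Rightarrow> nat"
        have "(\<Prod>i\<in>A. emb (Zt (\<delta> i * int (f i))) * e i (f i))
            = emb (Zt (\<Sum>i\<in>A. \<delta> i * int (f i))) * (\<Prod>i\<in>A. e i (f i))" if "finite A" for A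
          using that by (induction A rule: finite_induct) (auto simp: emb_1 emb_mult Zt_add ac_simps)
        then show "(\<Prod>i<p. emb (Zt (\<delta> i * int (f i))) * e i (f i))
            = emb (Zt (\<Sum>i<p. \<delta> i * int (f i))) * (\<Prod>i<p. e i (f i))" by simp
      qed
      finally show ?thesis by (simp add: \<phi>_sum \<phi>_scale)
    qed
    show "\<phi> (shifted_product h v (\<lambda>t. j t + d (\<pi> t)) T) = \<phi> (shifted_product h v (\<lambda>t. j t + d' (\<pi> t)) T)"
      unfolding expand
    proof (rule sum.cong[OF refl])
      fix f assume "f \<in> PiE {..<p} (\<lambda>_. {..<p})"
      then have f: "\<And>i. i < p \<Longrightarrow> f i < p" by (auto simp: PiE_iff)
      show "Zt (\<Sum>i<p. d i * int (f i)) * \<phi> (\<Prod>i<p. e i (f i))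
          = Zt (\<Sum>i<p. d' i * int (f i)) * \<phi> (\<Prod>i<p. e i (f i))"
      proof (cases "\<phi> (\<Prod>i<p. e i (f i)) = 0")
        case False
        have p0: "0 < p" using p_ge_5 by simp
        have pos: "0 < card (B i)" if "i < p" for i
          using Bne(1)[OF that] fin[OF B] by (simp add: card_gt_0_iff)
        have const: "f i = f 0" if "i < p" for i
          by (rule \<phi>_nonzero_imp_equal_eigenvalues[OF gh, where e = "\<lambda>i. e i (f i)" and d = "\<lambda>i. card (B i)",
                OF eH pos sumB eg eh f False that p0])
        have "(\<Sum>i<p. \<delta> i * int (f i)) = (\<Sum>i<p. \<delta> i) * int (f 0)" for \<delta> :: "nat \<Rightarrow> int"
        proof -
          have "(\<Sum>i<p. \<delta> i * int (f i)) = (\<Sum>i<p. \<delta> i * int (f 0))"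
          proof (rule sum.cong[OF refl])
            fix i assume "i \<in> {..<p}"
            then have "f i = f 0" by (intro const) simp
            then show "\<delta> i * int (f i) = \<delta> i * int (f 0)" by (simp only:)
          qed
          then show ?thesis by (simp only: sum_distrib_right)
        qed
        moreover have "int p dvd (\<Sum>i<p. d i) * int (f 0) - (\<Sum>i<p. d' i) * int (f 0)"
          using dvd_mult2[OF dd, of "int (f 0)"] by (simp only: left_diff_distrib)
        ultimately have "Zt (\<Sum>i<p. d i * int (f i)) = Zt (\<Sum>i<p. d' i * int (f i))"
          using Zt_cong by simp
        then show ?thesis by simp
      qed simp
    qed
  qed
qed

lemma shifted_product_0: "(\<And>t. t \<in> T \<Longrightarrow> v t \<in> Hm 1) \<Longrightarrow> shifted_product h v (\<lambda>_. 0) T = prod v T"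
  unfolding shifted_product_def by (intro prod.cong refl) (auto intro: pow_act_0)

section \<open>Products of linear forms\<close>

lemma proj_weight_vector:
  assumes gh: "pair g h" and u: "u \<in> Hm d" "weight_vector g m 0 u"
  shows "weight_vector g m 0 (proj h i u)"
proof -
  have g: "g \<in> carrier G" "h \<in> carrier G" using gh by (auto simp: pair_def)
  have pw: "act g (act (h [^] n) u) = emb (Zt m) * act (h [^] n) u"
    "act c (act (h [^] n) u) = act (h [^] n) u" for n :: nat
    using weight_vector_pow[OF gh u, of n] by (simp_all add: weight_vector_def emb_1)
  have "act g (proj h i u) = emb (Zt m) * proj h i u"
    unfolding proj_def using g pw by (simp add: act_scale act_sum sum_distrib_left mult.left_commute)
  moreover have "act c (proj h i u) = proj h i u"
    unfolding proj_def using c_central pw by (simp add: act_scale act_sum)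
  ultimately show ?thesis by (simp add: weight_vector_def emb_1)
qed

text \<open>Multilinear expansion of the factors indexed by \<open>A\<close>.\<close>

lemma product_decompose:
  assumes T: "finite T" and v: "\<And>t. t \<in> T \<Longrightarrow> t \<in> A \<Longrightarrow> v t = (\<Sum>i<p. w t i)"
    and zero: "\<And>f. (\<And>t. f t < p) \<Longrightarrow> \<phi> (\<Prod>t\<in>T. if t \<in> A then w t (f t) else v t) = 0"
  shows "\<phi> (prod v T) = 0"
proof -
  have p0: "0 < p" using p_ge_5 by simp
  define w' where "w' t i = (if t \<in> A then w t i else if i = 0 then v t else 0)" for t i
  have "prod v T = (\<Prod>t\<in>T. \<Sum>i<p. w' t i)"
  proof (rule prod.cong[OF refl])
    fix t assume "t \<in> T"
    then show "v t = (\<Sum>i<p. w' t i)" using v[of t] p0 by (cases "t \<in> A") (simp_all add: w'_def sum.delta)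
  qed
  also have "\<dots> = (\<Sum>f\<in>PiE T (\<lambda>_. {..<p}). \<Prod>t\<in>T. w' t (f t))"
    using T by (rule prod_sum_PiE) auto
  finally have e: "\<phi> (prod v T) = (\<Sum>f\<in>PiE T (\<lambda>_. {..<p}). \<phi> (\<Prod>t\<in>T. w' t (f t)))"
    by (simp add: \<phi>_sum)
  have "\<phi> (\<Prod>t\<in>T. w' t (f t)) = 0" if f: "f \<in> PiE T (\<lambda>_. {..<p})" for f
  proof (cases "\<exists>t\<in>T. t \<notin> A \<and> f t \<noteq> 0")
    case True
    then obtain t where "t \<in> T" "w' t (f t) = 0" by (auto simp: w'_def)
    then have "(\<Prod>t\<in>T. w' t (f t)) = 0" using T by (metis prod_zero)
    then show ?thesis by (simp add: \<phi>_0)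
  next
    case False
    define f' where "f' t = (if t \<in> T then f t else 0)" for t
    have "(\<Prod>t\<in>T. w' t (f t)) = (\<Prod>t\<in>T. if t \<in> A then w t (f' t) else v t)"
      using False by (intro prod.cong) (auto simp: w'_def f'_def)
    moreover have "f' t < p" for t using f p0 by (auto simp: f'_def PiE_iff)
    ultimately show ?thesis using zero[of f'] by simp
  qed
  then show ?thesis unfolding e by simp
qed

text \<open>Expand the factors on which \<open>c\<close> acts nontrivially into eigenvectors of \<open>g\<close>; some term of the expansion
keeps \<open>\<phi>\<close> nonzero.\<close>

lemma eigen_choice:
  assumes gh: "pair g h" and T: "finite T"
    and v: "\<And>t. t \<in> T \<Longrightarrow> v t \<in> Hm 1" "\<And>t. t \<in> T \<Longrightarrow> act c (v t) = emb (Zt (- k t)) * v t"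
    and zero: "\<And>t. t \<in> T \<Longrightarrow> int p dvd k t \<Longrightarrow> act g (v t) = emb (Zt (s t)) * v t"
    and nz: "\<phi> (prod v T) \<noteq> 0"
  obtains v' s' where "\<And>t. t \<in> T \<Longrightarrow> v' t \<in> Hm 1" "\<And>t. t \<in> T \<Longrightarrow> weight_vector g (s' t) (k t) (v' t)"
    "\<And>t. int p dvd k t \<Longrightarrow> s' t = s t" "\<phi> (prod v' T) \<noteq> 0"
proof -
  have g: "g \<in> carrier G" using gh by (auto simp: pair_def)
  define A where "A = {t. \<not> int p dvd k t}"
  have "\<exists>f. (\<forall>t. f t < p) \<and> \<phi> (\<Prod>t\<in>T. if t \<in> A then proj g (f t) (v t) else v t) \<noteq> 0"
  proof (rule ccontr)
    assume no: "\<not> ?thesis"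
    have "\<phi> (prod v T) = 0"
    proof (rule product_decompose[OF T, where A = A and w = "\<lambda>t i. proj g i (v t)"])
      show "v t = (\<Sum>i<p. proj g i (v t))" if "t \<in> T" for t using sum_proj[OF g v(1)[OF that]] by simp
      show "\<phi> (\<Prod>t\<in>T. if t \<in> A then proj g (f t) (v t) else v t) = 0" if "\<And>t. f t < p" for f
        using no that by blast
    qed
    then show False using nz by simp
  qed
  then obtain f where f: "\<phi> (\<Prod>t\<in>T. if t \<in> A then proj g (f t) (v t) else v t) \<noteq> 0" by blast
  define v' where "v' t = (if t \<in> A then proj g (f t) (v t) else v t)" for t
  define s' where "s' t = (if t \<in> A then int (f t) else s t)" for t
  have "v' t \<in> Hm 1" if "t \<in> T" for t using v(1)[OF that] g by (simp add: v'_def proj_Hm)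
  moreover have "weight_vector g (s' t) (k t) (v' t)" if t: "t \<in> T" for t
  proof (cases "t \<in> A")
    case True
    have "act c (proj g (f t) (v t)) = emb (Zt (- k t)) * proj g (f t) (v t)"
      using g c_central v[OF t] by (intro proj_eigen) auto
    then show ?thesis using True act_proj[OF g v(1)[OF t]] by (simp add: weight_vector_def v'_def s'_def)
  next
    case False
    then show ?thesis using zero[OF t] v(2)[OF t] by (simp add: weight_vector_def v'_def s'_def A_def)
  qed
  moreover have "s' t = s t" if "int p dvd k t" for t using that by (simp add: s'_def A_def)
  moreover have "\<phi> (prod v' T) \<noteq> 0" using f by (simp add: v'_def)
  ultimately show ?thesis using that by blast
qed

text \<open>The eigenvectors and the weights of the factors with nontrivial central character have to be chosen
anew for each pair of generators, whereas those with trivial central character are kept.\<close>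

lemma shear_choice:
  assumes gh: "pair g h" and T: "finite T" "card T = N"
    and v: "\<And>t. t \<in> T \<Longrightarrow> v t \<in> Hm 1" "\<And>t. t \<in> T \<Longrightarrow> act c (v t) = emb (Zt (- k t)) * v t"
    and zero: "\<And>t. t \<in> T \<Longrightarrow> int p dvd k t \<Longrightarrow> act g (v t) = emb (Zt (s t)) * v t"
    and nz: "\<phi> (prod v T) \<noteq> 0"
  obtains s' F where "shear_system p T s' k (F :: _ \<Rightarrow> 'k)" "F (\<lambda>_. 0) \<noteq> 0" "\<And>t. int p dvd k t \<Longrightarrow> s' t = s t"
proof -
  obtain v' s' where v': "\<And>t. t \<in> T \<Longrightarrow> v' t \<in> Hm 1" "\<And>t. t \<in> T \<Longrightarrow> weight_vector g (s' t) (k t) (v' t)"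
    "\<And>t. int p dvd k t \<Longrightarrow> s' t = s t" "\<phi> (prod v' T) \<noteq> 0"
    using eigen_choice[OF gh T(1) v zero nz] by blast
  have "\<phi> (shifted_product h v' (\<lambda>_. 0) T) \<noteq> 0" using v'(4) shifted_product_0[of T v' h, OF v'(1)] by simp
  then show ?thesis using that[OF shear_system_monomials[OF gh T v'(1,2)]] v'(3) by blast
qed

lemma pair_twist:
  assumes "pair g h"
  shows "pair (g [^] (n::nat) \<otimes> h) (inv g)"
proof -
  have g: "g \<in> carrier G" "h \<in> carrier G" "g \<otimes> h = h \<otimes> g \<otimes> c" "generate G {g, h} = carrier G"
    using assms by (auto simp: pair_def)
  define q where "q = g [^] n"
  have q: "q \<in> carrier G" "q \<otimes> inv g = inv g \<otimes> q"
  proof -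
    show "q \<in> carrier G" using g by (simp add: q_def)
    have "g \<otimes> q = q \<otimes> g" unfolding q_def using g by (metis nat_pow_Suc nat_pow_Suc2)
    then show "q \<otimes> inv g = inv g \<otimes> q" using g \<open>q \<in> carrier G\<close> inv_commute[of g q] by simp
  qed
  have hg: "h \<otimes> inv g = inv g \<otimes> h \<otimes> c"
  proof -
    have "inv g \<otimes> h \<otimes> c = inv g \<otimes> (h \<otimes> g \<otimes> c) \<otimes> inv g"
    proof -
      have "inv g \<otimes> (h \<otimes> g \<otimes> c) \<otimes> inv g = inv g \<otimes> h \<otimes> (g \<otimes> c) \<otimes> inv g"
        using g c_central(1) by (simp add: m_assoc)
      also have "\<dots> = inv g \<otimes> h \<otimes> (c \<otimes> g) \<otimes> inv g" using c_central(2)[OF g(1)] by simp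
      also have "\<dots> = inv g \<otimes> h \<otimes> c \<otimes> (g \<otimes> inv g)" using g(1,2) c_central(1) by (simp add: m_assoc)
      finally show ?thesis using g(1,2) c_central(1) by simp
    qed
    also have "\<dots> = inv g \<otimes> (g \<otimes> h) \<otimes> inv g" using g(3) by simp
    also have "\<dots> = h \<otimes> inv g" using g(1,2) by (simp add: m_assoc[symmetric])
    finally show ?thesis by simp
  qed
  have "q \<otimes> h \<otimes> inv g = q \<otimes> (inv g \<otimes> h \<otimes> c)" using g q hg by (simp add: m_assoc)
  also have "\<dots> = (q \<otimes> inv g) \<otimes> (h \<otimes> c)" using g(1,2) q(1) c_central(1) by (simp add: m_assoc)
  also have "\<dots> = inv g \<otimes> (q \<otimes> h) \<otimes> c" unfolding q(2) using g(1,2) q(1) c_central(1) by (simp add: m_assoc)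
  finally have comm: "q \<otimes> h \<otimes> inv g = inv g \<otimes> (q \<otimes> h) \<otimes> c" .
  define S where "S = generate G {q \<otimes> h, inv g}"
  have sub: "subgroup S G" unfolding S_def using g q by (intro generate_is_subgroup) auto
  have "inv g \<in> S" "q \<otimes> h \<in> S" unfolding S_def by (auto intro: generate.incl)
  then have gS: "g \<in> S" using subgroup.m_inv_closed[OF sub] g(1) by (metis inv_inv)
  have qS: "q \<in> S"
    unfolding q_def using gS sub by (induction n) (auto intro: subgroup.one_closed subgroup.m_closed)
  have "inv q \<otimes> (q \<otimes> h) \<in> S"
    using subgroup.m_closed[OF sub subgroup.m_inv_closed[OF sub qS] \<open>q \<otimes> h \<in> S\<close>] .
  then have hS: "h \<in> S" using q(1) g(2) by (simp add: m_assoc[symmetric])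
  have "generate G {g, h} \<subseteq> S" using gS hS sub by (intro generate_subgroup_incl) auto
  then have "S = carrier G" using g(4) subgroup.subset[OF sub] by blast
  then show ?thesis using g q comm unfolding pair_def S_def q_def by simp
qed

lemma act_twist:
  assumes g: "g \<in> carrier G" "h \<in> carrier G" and u: "u \<in> Hm d"
    "act g u = emb (Zt x) * u" "act h u = emb (Zt y) * u"
  shows "act (g [^] (n::nat) \<otimes> h) u = emb (Zt (int n * x + y)) * u"
    and "act (inv g) u = emb (Zt (- x)) * u"
proof -
  have "act (g [^] n) u = emb (Zt (int n * x)) * u"
    using pow_act_eigen[OF g(1) u(1,2), of "int n"] pow_act_nat[OF g(1) u(1), of n] by simp
  then have "act (g [^] n \<otimes> h) u = emb (Zt (int n * x)) * (emb (Zt y) * u)"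
    using g u act_comp[of "g [^] n" h u d] by (simp add: act_scale)
  then show "act (g [^] n \<otimes> h) u = emb (Zt (int n * x + y)) * u"
    by (simp only: mult.assoc[symmetric] emb_mult[symmetric] Zt_add)
  have "u = act (inv g) (act g u)" using act_comp[of g "inv g" u d] g u by (simp add: act_one)
  also have "\<dots> = emb (Zt x) * act (inv g) u" using u g by (simp add: act_scale)
  finally have "emb (Zt (- x)) * u = emb (Zt (- x)) * (emb (Zt x) * act (inv g) u)" by simp
  also have "\<dots> = emb (Zt (- x + x)) * act (inv g) u"
    by (simp only: mult.assoc[symmetric] emb_mult[symmetric] Zt_add)
  finally show "act (inv g) u = emb (Zt (- x)) * u" by (simp add: emb_1)
qed

lemma solve_nat:
  assumes "\<not> int p dvd x"
  shows "\<exists>n::nat. n < p \<and> int p dvd int n * x + y"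
proof -
  have "Factorial_Ring.prime (int p)" using p_prime by simp
  then have "coprime x (int p)" using assms prime_imp_coprime coprime_commute by blast
  then obtain z where z: "[x * z = 1] (mod int p)" using cong_solve_coprime_int by blast
  define n where "n = nat ((- y * z) mod int p)"
  have n: "int n = (- y * z) mod int p" using p_pos by (simp add: n_def)
  have "n < p" using n p_pos by (metis of_nat_less_iff pos_mod_bound)
  have "[int n * x + y = (- y * z) * x + y] (mod int p)"
    unfolding n by (intro cong_add cong_mult cong_refl) (simp add: cong_def)
  also have "(- y * z) * x + y = y * (1 - x * z)" by (simp add: algebra_simps)
  also have "[y * (1 - x * z) = y * (1 - 1)] (mod int p)"
    using z by (intro cong_mult cong_diff cong_refl)
  finally have "int p dvd int n * x + y" by (simp add: cong_0_iff)
  then show ?thesis using \<open>n < p\<close> by blast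
qed

lemma prime_dvd_mult_int: "int p dvd a * b \<Longrightarrow> int p dvd a \<or> int p dvd b"
  using p_prime by (simp add: prime_dvd_mult_iff)

text \<open>The factors fixed by \<open>c\<close> have weights \<open>(x t, y t)\<close> under \<open>g\<close> and \<open>h\<close>. Two proportional weights would be
killed by the first member of the same pair, which \<open>two_invariant_elements\<close> excludes; so apart from \<open>t0\<close> the
ratios \<open>- y t / x t\<close> are distinct and there are at most \<open>p + 1\<close> such factors. Now
\<open>invariant_element_structure\<close> applies to \<open>t0\<close>: the \<open>x t\<close> with \<open>t \<noteq> t0\<close> agree and their sum is not
zero. So some pair kills the sum of all weights but leaves some of them different, contrary to
\<open>zero_class_splits\<close>.\<close>

lemma zero_class_product_normalised:
  assumes gh: "pair g h" and T: "finite T" "card T = N"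
    and v: "\<And>t. t \<in> T \<Longrightarrow> v t \<in> Hm 1" "\<And>t. t \<in> T \<Longrightarrow> act c (v t) = emb (Zt (- k t)) * v t"
    and xg: "\<And>t. t \<in> T \<Longrightarrow> int p dvd k t \<Longrightarrow> act g (v t) = emb (Zt (x t)) * v t"
    and yh: "\<And>t. t \<in> T \<Longrightarrow> int p dvd k t \<Longrightarrow> act h (v t) = emb (Zt (y t)) * v t"
    and t0: "t0 \<in> T" "int p dvd k t0" "int p dvd x t0"
  shows "\<phi> (prod v T) = 0"
proof (rule ccontr)
  assume nz: "\<phi> (prod v T) \<noteq> 0"
  have g: "g \<in> carrier G" "h \<in> carrier G" using gh by (auto simp: pair_def)
  define Z where "Z = {t\<in>T. int p dvd k t}"
  have fZ: "finite Z" using T by (simp add: Z_def)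
  have t0Z: "t0 \<in> Z" using t0 by (simp add: Z_def)
  have tw: "act (g [^] n \<otimes> h) (v t) = emb (Zt (int n * x t + y t)) * v t" if "t \<in> T" "int p dvd k t" for n :: nat and t
    by (rule act_twist(1)[OF g v(1)[OF that(1)] xg[OF that] yh[OF that]])
  have two: False if t: "t \<in> Z" "t' \<in> Z" "t \<noteq> t'" and q: "pair q q'"
    and s: "\<And>t. t \<in> T \<Longrightarrow> int p dvd k t \<Longrightarrow> act q (v t) = emb (Zt (s t)) * v t"
    and d: "int p dvd s t" "int p dvd s t'" for t t' q q' s
  proof -
    obtain s' F where F: "shear_system p T s' k (F :: _ \<Rightarrow> 'k)" "F (\<lambda>_. 0) \<noteq> 0"
        "\<And>t. int p dvd k t \<Longrightarrow> s' t = s t"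
      using shear_choice[where k = k and s = s, OF q T v s nz] by blast
    interpret S: shear_system p T s' k F by (rule F(1))
    show False using S.two_invariant_elements[of t t' "\<lambda>_. 0"] t d F(2,3) by (simp add: Z_def)
  qed
  have det1: False if t: "t \<in> Z" "t' \<in> Z" "t \<noteq> t'" and nx: "\<not> int p dvd x t"
    and d: "int p dvd x t * y t' - x t' * y t" for t t'
  proof -
    obtain n where n: "int p dvd int n * x t + y t" using solve_nat[OF nx] by blast
    have "x t * (int n * x t' + y t') = x t' * (int n * x t + y t) + (x t * y t' - x t' * y t)"
      by (simp add: algebra_simps)
    moreover have "int p dvd x t' * (int n * x t + y t) + (x t * y t' - x t' * y t)"
      by (rule dvd_add[OF dvd_mult[OF n] d])
    ultimately have "int p dvd x t * (int n * x t' + y t')" by (simp only:)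
    then have "int p dvd int n * x t' + y t'" using prime_dvd_mult_int nx by blast
    then show False using two[OF t pair_twist[OF gh] tw n] by blast
  qed
  have det: "\<not> int p dvd x t * y t' - x t' * y t" if t: "t \<in> Z" "t' \<in> Z" "t \<noteq> t'" for t t'
  proof
    assume d: "int p dvd x t * y t' - x t' * y t"
    have d': "int p dvd x t' * y t - x t * y t'" using d by (simp only: dvd_diff_commute)
    show False
    proof (cases "int p dvd x t \<and> int p dvd x t'")
      case True
      then show ?thesis using two[OF t gh xg] by blast
    next
      case False
      then show ?thesis using det1[OF t _ d] det1[OF t(2,1) t(3)[symmetric] _ d'] by blast
    qed
  qed
  have xnz: "\<not> int p dvd x t" if "t \<in> Z" "t \<noteq> t0" for t
  proof
    assume "int p dvd x t"
    then have "int p dvd x t0 * y t - x t * y t0" using t0(3) by (intro dvd_diff dvd_mult2)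
    then show False using det[OF t0Z that(1) that(2)[symmetric]] by blast
  qed
  have "\<forall>t. \<exists>n. t \<in> Z - {t0} \<longrightarrow> n < p \<and> int p dvd int n * x t + y t"
    using solve_nat xnz by blast
  then obtain m where m: "\<And>t. t \<in> Z - {t0} \<Longrightarrow> m t < p \<and> int p dvd int (m t) * x t + y t" by metis
  have "inj_on m (Z - {t0})"
  proof (rule inj_onI)
    fix t t' assume t: "t \<in> Z - {t0}" "t' \<in> Z - {t0}" "m t = m t'"
    have "x t * (int (m t) * x t' + y t') - x t' * (int (m t) * x t + y t) = x t * y t' - x t' * y t"
      by (simp add: algebra_simps)
    moreover have "int p dvd x t * (int (m t) * x t' + y t') - x t' * (int (m t) * x t + y t)"
      using m[OF t(1)] m[OF t(2)] t(3) by (intro dvd_diff dvd_mult) simp_all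
    ultimately have "int p dvd x t * y t' - x t' * y t" by (simp only:)
    then show "t = t'" using det t by blast
  qed
  then have "card (Z - {t0}) \<le> card {..<p}"
    using m by (intro card_inj_on_le[of m]) auto
  then have few: "card {t\<in>T. int p dvd k t} \<le> p + 1"
    using t0Z fZ unfolding Z_def[symmetric] by simp
  obtain s' F where F: "shear_system p T s' k (F :: _ \<Rightarrow> 'k)" "F (\<lambda>_. 0) \<noteq> 0"
      "\<And>t. int p dvd k t \<Longrightarrow> s' t = x t"
    using shear_choice[where k = k and s = x, OF gh T v xg nz] by blast
  interpret S: shear_system p T s' k F by (rule F(1))
  have s0: "int p dvd s' t0" using F(3)[OF t0(2)] t0(3) by simp
  note str = S.invariant_element_structure[OF t0(1,2) s0 few F(2)]
  have cZ: "card Z = p" using str(1) by (simp add: Z_def)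
  have xx: "int p dvd x t - x t'" if "t \<in> Z - {t0}" "t' \<in> Z - {t0}" for t t'
  proof -
    have "int p dvd s' t - s' t'" using that by (intro str(4)) (auto simp: Z_def)
    then show ?thesis using that F(3) by (simp add: Z_def)
  qed
  have cZ0: "card (Z - {t0}) = p - 1" using cZ t0Z fZ by simp
  obtain t1 where t1: "t1 \<in> Z - {t0}"
  proof -
    have "Z - {t0} \<noteq> {}" using cZ0 p_ge_5 by (intro notI) simp
    then show ?thesis using that by blast
  qed
  obtain t2 where t2: "t2 \<in> Z - {t0}" "t2 \<noteq> t1"
  proof -
    have "card (Z - {t0} - {t1}) = p - 2" using cZ0 t1 fZ by simp
    then have "Z - {t0} - {t1} \<noteq> {}" using p_ge_5 by (intro notI) simp
    then show ?thesis using that by blast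
  qed
  have sx: "\<not> int p dvd sum x Z"
  proof
    assume d: "int p dvd sum x Z"
    have "sum x Z = x t0 + sum x (Z - {t0})" using t0Z fZ by (simp add: sum.remove)
    then have "int p dvd sum x (Z - {t0})" using d t0(3) by (metis dvd_add_right_iff)
    moreover have "int p dvd (\<Sum>t\<in>Z - {t0}. x t - x t1)" by (rule dvd_sum) (use xx t1 in blast)
    moreover have "(\<Sum>t\<in>Z - {t0}. x t - x t1) = sum x (Z - {t0}) - int (p - 1) * x t1"
      by (simp add: sum_subtractf cZ0)
    ultimately have "int p dvd int (p - 1) * x t1" by (metis dvd_diff_imp_dvd_iff)
    then have "int p dvd int (p - 1)" using prime_dvd_mult_int xnz t1 by blast
    then have "p dvd p - 1" by (simp only: int_dvd_int_iff)
    then show False using p_ge_5 by (auto dest: dvd_imp_le)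
  qed
  \<comment> \<open>The pair with first member \<open>g\<^sup>n h\<close> kills the sum of the weights of the whole class.\<close>
  obtain n where n: "int p dvd int n * sum x Z + sum y Z" using solve_nat[OF sx] by blast
  obtain s'' F' where F': "shear_system p T s'' k (F' :: _ \<Rightarrow> 'k)" "F' (\<lambda>_. 0) \<noteq> 0"
      "\<And>t. int p dvd k t \<Longrightarrow> s'' t = int n * x t + y t"
    using shear_choice[where k = k and s = "\<lambda>t. int n * x t + y t", OF pair_twist[OF gh] T v tw nz] by blast
  interpret S': shear_system p T s'' k F' by (rule F'(1))
  have "sum s'' Z = (\<Sum>t\<in>Z. int n * x t + y t)" using F'(3) by (intro sum.cong) (auto simp: Z_def)
  also have "\<dots> = int n * sum x Z + sum y Z" by (simp add: sum.distrib sum_distrib_left)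
  finally have sum0: "int p dvd sum s'' {t\<in>T. int p dvd k t}" using n by (simp add: Z_def)
  have T12: "t1 \<in> T" "t2 \<in> T" "int p dvd k t1" "int p dvd k t2" using t1 t2 by (auto simp: Z_def)
  have "\<not> int p dvd s'' t1 - s'' t2"
  proof
    assume d: "int p dvd s'' t1 - s'' t2"
    have "x t1 * y t2 - x t2 * y t1
      = (x t1 - x t2) * y t1 + x t1 * (int n * (x t1 - x t2)) - x t1 * (s'' t1 - s'' t2)"
      using F'(3) T12 by (simp add: algebra_simps)
    moreover have "int p dvd (x t1 - x t2) * y t1 + x t1 * (int n * (x t1 - x t2)) - x t1 * (s'' t1 - s'' t2)"
      by (rule dvd_diff[OF dvd_add[OF dvd_mult2[OF xx[OF t1 t2(1)]] dvd_mult[OF dvd_mult[OF xx[OF t1 t2(1)]]]]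
            dvd_mult[OF d]])
    ultimately have "int p dvd x t1 * y t2 - x t2 * y t1" by (simp only:)
    then show False using det[of t1 t2] t1 t2 by blast
  qed
  then have "F' (\<lambda>_. 0) = 0"
    using S'.zero_class_splits[OF str(1,2) sum0 T12(1,2,3,4)] by blast
  then show False using F'(2) by simp
qed

text \<open>A change of generators makes the first of them fix the factor \<open>t0\<close>.\<close>

lemma zero_class_product:
  assumes gh: "pair g h" and T: "finite T" "card T = N"
    and v: "\<And>t. t \<in> T \<Longrightarrow> v t \<in> Hm 1" "\<And>t. t \<in> T \<Longrightarrow> act c (v t) = emb (Zt (- k t)) * v t"
    and xg: "\<And>t. t \<in> T \<Longrightarrow> int p dvd k t \<Longrightarrow> act g (v t) = emb (Zt (x t)) * v t"
    and yh: "\<And>t. t \<in> T \<Longrightarrow> int p dvd k t \<Longrightarrow> act h (v t) = emb (Zt (y t)) * v t"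
    and t0: "t0 \<in> T" "int p dvd k t0"
  shows "\<phi> (prod v T) = 0"
proof (cases "int p dvd x t0")
  case True
  show ?thesis by (rule zero_class_product_normalised[where k = k and x = x and y = y, OF gh T v xg yh t0 True])
next
  case False
  have g: "g \<in> carrier G" "h \<in> carrier G" using gh by (auto simp: pair_def)
  obtain n where n: "int p dvd int n * x t0 + y t0" using solve_nat[OF False] by blast
  have tw: "act (g [^] n \<otimes> h) (v t) = emb (Zt (int n * x t + y t)) * v t"
    "act (inv g) (v t) = emb (Zt (- x t)) * v t" if "t \<in> T" "int p dvd k t" for t
    using act_twist[OF g v(1)[OF that(1)] xg[OF that] yh[OF that]] by blast+
  show ?thesis by (rule zero_class_product_normalised[where k = k and x = "\<lambda>t. int n * x t + y t"
        and y = "\<lambda>t. - x t", OF pair_twist[OF gh] T v tw t0 n])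
qed

text \<open>Expand the factors into eigenvectors of \<open>c\<close>, and those fixed by \<open>c\<close> further into joint eigenvectors of
\<open>g\<close> and \<open>h\<close>, which commute on them.\<close>

theorem product_of_linear_forms:
  fixes T :: "'i set" and v :: "'i \<Rightarrow> 'r"
  assumes gh: "pair g h" and T: "finite T" "card T = N" and v: "\<And>t. t \<in> T \<Longrightarrow> v t \<in> Hm 1"
  shows "\<phi> (prod v T) = 0"
proof -
  have g: "g \<in> carrier G" "h \<in> carrier G" using gh by (auto simp: pair_def)
  have p0: "0 < p" using p_ge_5 by simp
  show ?thesis
  proof (rule product_decompose[OF T(1), where A = UNIV and w = "\<lambda>t i. proj c i (v t)"])
    show "v t = (\<Sum>i<p. proj c i (v t))" if "t \<in> T" for t
      using sum_proj[OF c_central(1) v[OF that]] by simp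
    fix f :: "'i \<Rightarrow> nat" assume f: "\<And>t. f t < p"
    define v1 where "v1 t = proj c (f t) (v t)" for t
    define k where "k t = - int (f t)" for t
    have v1: "v1 t \<in> Hm 1" "act c (v1 t) = emb (Zt (- k t)) * v1 t" if "t \<in> T" for t
      using proj_Hm[OF c_central(1) v[OF that]] act_proj[OF c_central(1) v[OF that]] by (simp_all add: v1_def k_def)
    have k0: "int p dvd k t \<longleftrightarrow> f t = 0" for t using f[of t] by (auto simp: k_def dest: dvd_imp_le)
    have "\<phi> (prod v1 T) = 0"
    proof (cases "\<exists>t0\<in>T. f t0 = 0")
      case False
      show ?thesis
      proof (rule ccontr)
        assume nz: "\<phi> (prod v1 T) \<noteq> 0"
        have vac: "act g (v1 t) = emb (Zt 0) * v1 t" if "t \<in> T" "int p dvd k t" for t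
          using False that k0 by blast
        obtain s' F where F: "shear_system p T s' k (F :: _ \<Rightarrow> 'k)" "F (\<lambda>_. 0) \<noteq> 0"
          using shear_choice[where k = k and s = "\<lambda>_. 0", OF gh T v1 vac nz] by blast
        interpret S: nonzero_shear_system p T s' k F
          using F(1) False k0 by (auto simp: nonzero_shear_system_def nonzero_shear_system_axioms_def)
        show False using S.F_eq_zero F(2) by blast
      qed
    next
      case True
      then obtain t0 where t0: "t0 \<in> T" "f t0 = 0" by blast
      define A where "A = {t. f t = 0}"
      show ?thesis
      proof (rule product_decompose[OF T(1), where A = A and w = "\<lambda>t i. proj g i (v1 t)"])
        show "v1 t = (\<Sum>i<p. proj g i (v1 t))" if "t \<in> T" for t
          using sum_proj[OF g(1) v1(1)[OF that]] by simp
        fix f1 :: "'i \<Rightarrow> nat" assume f1: "\<And>t. f1 t < p"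
        define v2 where "v2 t = (if t \<in> A then proj g (f1 t) (v1 t) else v1 t)" for t
        have v2: "v2 t \<in> Hm 1" "act c (v2 t) = emb (Zt (- k t)) * v2 t" if "t \<in> T" for t
          using proj_Hm[OF g(1) v1(1)[OF that]] v1[OF that]
            proj_eigen[OF g(1) c_central(1) c_central(2)[OF g(1)] v1[OF that]] by (simp_all add: v2_def)
        have v2g: "weight_vector g (int (f1 t)) 0 (v2 t)" if "t \<in> T" "t \<in> A" for t
          using act_proj[OF g(1) v1(1)[OF that(1)], of "f1 t"] v2(2)[OF that(1)] that(2)
          by (simp add: weight_vector_def v2_def A_def k_def)
        have "\<phi> (prod v2 T) = 0"
        proof (rule product_decompose[OF T(1), where A = A and w = "\<lambda>t i. proj h i (v2 t)"])
          show "v2 t = (\<Sum>i<p. proj h i (v2 t))" if "t \<in> T" for t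
            using sum_proj[OF g(2) v2(1)[OF that]] by simp
          fix f2 :: "'i \<Rightarrow> nat" assume f2: "\<And>t. f2 t < p"
          define v3 where "v3 t = (if t \<in> A then proj h (f2 t) (v2 t) else v2 t)" for t
          have wt3: "weight_vector g (int (f1 t)) 0 (v3 t)" "act h (v3 t) = emb (Zt (int (f2 t))) * v3 t"
            if "t \<in> T" "t \<in> A" for t
            using proj_weight_vector[OF gh v2(1)[OF that(1)] v2g[OF that]] act_proj[OF g(2) v2(1)[OF that(1)]] that(2)
            by (simp_all add: v3_def)
          have v3: "v3 t \<in> Hm 1" if "t \<in> T" for t
            using proj_Hm[OF g(2) v2(1)[OF that]] v2(1)[OF that] by (simp add: v3_def)
          have v3c: "act c (v3 t) = emb (Zt (- k t)) * v3 t" if "t \<in> T" for t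
          proof (cases "t \<in> A")
            case True
            then show ?thesis using wt3(1)[OF that True] by (simp add: weight_vector_def A_def k_def)
          next
            case False
            then show ?thesis using v2(2)[OF that] by (simp add: v3_def)
          qed
          have kA: "int p dvd k t \<Longrightarrow> t \<in> A" for t using k0 by (simp add: A_def)
          have xg: "act g (v3 t) = emb (Zt (int (f1 t))) * v3 t" if "t \<in> T" "int p dvd k t" for t
            using wt3(1)[OF that(1) kA[OF that(2)]] by (simp add: weight_vector_def)
          have yh: "act h (v3 t) = emb (Zt (int (f2 t))) * v3 t" if "t \<in> T" "int p dvd k t" for t
            by (rule wt3(2)[OF that(1) kA[OF that(2)]])
          have "int p dvd k t0" using t0(2) k0 by blast
          from zero_class_product[where k = k and x = "\<lambda>t. int (f1 t)" and y = "\<lambda>t. int (f2 t)",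
              OF gh T v3 v3c xg yh t0(1) this]
          show "\<phi> (\<Prod>t\<in>T. if t \<in> A then proj h (f2 t) (v2 t) else v2 t) = 0" by (simp add: v3_def)
        qed
        then show "\<phi> (\<Prod>t\<in>T. if t \<in> A then proj g (f1 t) (v1 t) else v1 t) = 0" by (simp add: v2_def)
      qed
    qed
    then show "\<phi> (\<Prod>t\<in>T. if t \<in> UNIV then proj c (f t) (v t) else v t) = 0" by (simp add: v1_def)
  qed
qed

end

section \<open>Evaluating polynomials\<close>

abbreviation "mkeys \<equiv> Poly_Mapping.keys"
abbreviation "coeff_at \<equiv> Poly_Mapping.lookup"

text \<open>Evaluation of a monomial at elements of an arbitrary commutative ring; \<open>poly_value\<close> does the same for
polynomials, with a separate map for the coefficients. It covers substitution, the group action and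
the extension of scalars.\<close>

definition monomial_value :: "(nat \<Rightarrow> 'r::comm_ring_1) \<Rightarrow> (nat \<Rightarrow>\<^sub>0 nat) \<Rightarrow> 'r" where
  "monomial_value \<sigma> m = (\<Prod>i\<in>mkeys m. \<sigma> i ^ coeff_at m i)"

definition poly_value :: "('a::comm_ring_1 \<Rightarrow> 'r::comm_ring_1) \<Rightarrow> (nat \<Rightarrow> 'r) \<Rightarrow> 'a mpoly \<Rightarrow> 'r" where
  "poly_value c \<sigma> f = (\<Sum>m\<in>mkeys f. c (coeff_at f m) * monomial_value \<sigma> m)"

definition ring_hom_fun :: "('a::comm_ring_1 \<Rightarrow> 'b::comm_ring_1) \<Rightarrow> bool" where
  "ring_hom_fun c \<longleftrightarrow> c 1 = 1 \<and> (\<forall>x y. c (x + y) = c x + c y) \<and> (\<forall>x y. c (x * y) = c x * c y)"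

lemma ring_hom_fun_D:
  assumes "ring_hom_fun c"
  shows "c 1 = 1" "c (x + y) = c x + c y" "c (x * y) = c x * c y" "c 0 = 0"
proof -
  show "c 1 = 1" "c (x + y) = c x + c y" "c (x * y) = c x * c y" using assms by (auto simp: ring_hom_fun_def)
  have "c (0 + 0) = c 0 + c 0" using assms unfolding ring_hom_fun_def by blast
  then show "c 0 = 0" by simp
qed

lemma ring_hom_fun_sum: "ring_hom_fun c \<Longrightarrow> c (sum f A) = (\<Sum>x\<in>A. c (f x))"
  by (induction A rule: infinite_finite_induct) (auto simp: ring_hom_fun_D[of c])

lemma ring_hom_fun_prod: "ring_hom_fun c \<Longrightarrow> c (prod f A) = (\<Prod>x\<in>A. c (f x))"
  by (induction A rule: infinite_finite_induct) (auto simp: ring_hom_fun_D[of c])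

lemma ring_hom_fun_power: "ring_hom_fun c \<Longrightarrow> c (x ^ n) = c x ^ n"
  by (induction n) (auto simp: ring_hom_fun_D[of c])

lemma monomial_value_superset:
  assumes "finite S" "mkeys m \<subseteq> S"
  shows "monomial_value \<sigma> m = (\<Prod>i\<in>S. \<sigma> i ^ coeff_at m i)"
  unfolding monomial_value_def
  by (rule prod.mono_neutral_left) (use assms in \<open>auto simp: in_keys_iff\<close>)

lemma monomial_value_add: "monomial_value \<sigma> (m + n) = monomial_value \<sigma> m * monomial_value \<sigma> n"
proof -
  have "monomial_value \<sigma> (m + n) = (\<Prod>i\<in>mkeys m \<union> mkeys n. \<sigma> i ^ coeff_at (m + n) i)"
    by (rule monomial_value_superset) (auto dest: subsetD[OF keys_add])
  also have "\<dots> = (\<Prod>i\<in>mkeys m \<union> mkeys n. \<sigma> i ^ coeff_at m i) * (\<Prod>i\<in>mkeys m \<union> mkeys n. \<sigma> i ^ coeff_at n i)"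
    by (simp add: lookup_add power_add prod.distrib)
  also have "\<dots> = monomial_value \<sigma> m * monomial_value \<sigma> n"
    by (subst (1 2) monomial_value_superset[of "mkeys m \<union> mkeys n"]) auto
  finally show ?thesis .
qed

lemma monomial_value_0: "monomial_value \<sigma> 0 = 1"
  by (simp add: monomial_value_def)

lemma monomial_value_hom:
  "ring_hom_fun H \<Longrightarrow> H (monomial_value \<sigma> m) = monomial_value (\<lambda>i. H (\<sigma> i)) m"
  by (simp add: monomial_value_def ring_hom_fun_prod[of H] ring_hom_fun_power[of H])

lemma sum_of_singles: "f = (\<Sum>m\<in>mkeys f. Poly_Mapping.single m (coeff_at f m))"
proof (rule poly_mapping_eqI)
  fix k
  have "coeff_at (\<Sum>m\<in>mkeys f. Poly_Mapping.single m (coeff_at f m)) k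
      = (\<Sum>m\<in>mkeys f. if m = k then coeff_at f k else 0)"
    unfolding lookup_sum by (rule sum.cong) (auto simp: lookup_single when_def)
  then show "coeff_at f k = coeff_at (\<Sum>m\<in>mkeys f. Poly_Mapping.single m (coeff_at f m)) k"
    by (simp add: sum.delta in_keys_iff)
qed

lemma single_induct [case_names single zero add]:
  fixes f :: "'b \<Rightarrow>\<^sub>0 'a::comm_monoid_add"
  assumes "\<And>m a. P (Poly_Mapping.single m a)" "P 0" "\<And>f g. P f \<Longrightarrow> P g \<Longrightarrow> P (f + g)"
  shows "P f"
proof -
  have "P (\<Sum>m\<in>A. Poly_Mapping.single m (coeff_at f m))" if "finite A" for A
    using that by (induction A rule: finite_induct) (auto intro: assms)
  then show ?thesis using sum_of_singles[of f] by (metis finite_keys)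
qed

lemma poly_value_superset:
  assumes "ring_hom_fun c" "finite S" "mkeys f \<subseteq> S"
  shows "poly_value c \<sigma> f = (\<Sum>m\<in>S. c (coeff_at f m) * monomial_value \<sigma> m)"
  unfolding poly_value_def
  by (rule sum.mono_neutral_left) (use assms(2,3) in \<open>auto simp: in_keys_iff ring_hom_fun_D[OF assms(1)]\<close>)

lemma poly_value_add:
  assumes "ring_hom_fun c"
  shows "poly_value c \<sigma> (f + g) = poly_value c \<sigma> f + poly_value c \<sigma> g"
proof -
  let ?S = "mkeys f \<union> mkeys g"
  have "poly_value c \<sigma> (f + g) = (\<Sum>m\<in>?S. c (coeff_at (f + g) m) * monomial_value \<sigma> m)"
    by (rule poly_value_superset[OF assms]) (auto dest: subsetD[OF keys_add])
  also have "\<dots> = (\<Sum>m\<in>?S. c (coeff_at f m) * monomial_value \<sigma> m) + (\<Sum>m\<in>?S. c (coeff_at g m) * monomial_value \<sigma> m)"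
    by (simp add: lookup_add ring_hom_fun_D[OF assms] distrib_right sum.distrib)
  also have "\<dots> = poly_value c \<sigma> f + poly_value c \<sigma> g"
    by (subst (1 2) poly_value_superset[OF assms, of ?S]) auto
  finally show ?thesis .
qed

lemma poly_value_single:
  assumes "ring_hom_fun c"
  shows "poly_value c \<sigma> (Poly_Mapping.single m a) = c a * monomial_value \<sigma> m"
  by (cases "a = 0") (auto simp: poly_value_def ring_hom_fun_D[OF assms])

lemma poly_value_0: "poly_value c \<sigma> 0 = 0"
  by (simp add: poly_value_def)

lemma poly_value_mult:
  assumes c: "ring_hom_fun c"
  shows "poly_value c \<sigma> (f * g) = poly_value c \<sigma> f * poly_value c \<sigma> g"
proof (induction f rule: single_induct)
  case (single m a)
  show ?case
  proof (induction g rule: single_induct)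
    case (single n b)
    show ?case by (simp add: mult_single poly_value_single[OF c] ring_hom_fun_D[OF c] monomial_value_add ac_simps)
  next
    case (add g h)
    then show ?case by (simp add: distrib_left poly_value_add[OF c])
  qed (simp add: poly_value_0)
next
  case (add f h)
  then show ?case by (simp add: distrib_right poly_value_add[OF c])
qed (simp add: poly_value_0)

lemma poly_value_Const: "ring_hom_fun c \<Longrightarrow> poly_value c \<sigma> (Const a) = c a"
  by (simp add: Const_def poly_value_single monomial_value_0)

lemma poly_value_Var: "ring_hom_fun c \<Longrightarrow> poly_value c \<sigma> (Var i) = \<sigma> i"
  by (simp add: Var_def poly_value_single ring_hom_fun_D[of c] monomial_value_def)

lemma one_eq_Const: "(1 :: 'a::comm_ring_1 mpoly) = Const 1"
  by (simp add: Const_def)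

lemma ring_hom_poly_value: "ring_hom_fun c \<Longrightarrow> ring_hom_fun (poly_value c \<sigma>)"
  by (simp add: ring_hom_fun_def[of "poly_value c \<sigma>"] poly_value_add poly_value_mult one_eq_Const
      poly_value_Const ring_hom_fun_D[of c])

lemma Const_add: "Const (a + b) = Const a + Const b" by (simp add: Const_def single_add)
lemma Const_mult: "Const (a * b :: 'a::comm_ring_1) = Const a * Const b" by (simp add: Const_def mult_single)
lemma Const_0: "Const 0 = 0" by (simp add: Const_def)

lemma ring_hom_Const: "ring_hom_fun (Const :: 'a::comm_ring_1 \<Rightarrow> _)"
  by (simp add: ring_hom_fun_def Const_add Const_mult one_eq_Const)

lemma hom_poly_value:
  assumes "ring_hom_fun H"
  shows "H (poly_value c \<sigma> f) = poly_value (\<lambda>a. H (c a)) (\<lambda>i. H (\<sigma> i)) f"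
  by (simp add: poly_value_def ring_hom_fun_sum[OF assms] ring_hom_fun_D[OF assms] monomial_value_hom[OF assms])

lemma Var_power: "(Var i :: 'a::comm_ring_1 mpoly) ^ k = Poly_Mapping.single (Poly_Mapping.single i k) 1"
proof (induction k)
  case (Suc k)
  then show ?case by (simp add: Var_def mult_single single_add[symmetric])
qed simp

lemma monomial_value_Var: "monomial_value Var m = Poly_Mapping.single m (1::'a::comm_ring_1)"
proof -
  have "(\<Prod>i\<in>A. (Var i :: 'a mpoly) ^ coeff_at m i)
      = Poly_Mapping.single (\<Sum>i\<in>A. Poly_Mapping.single i (coeff_at m i)) 1" if "finite A" for A
    using that by (induction A rule: finite_induct) (auto simp: Var_power mult_single)
  then show ?thesis using sum_of_singles[of m] by (simp add: monomial_value_def)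
qed

lemma single_eq: "Poly_Mapping.single m a = Const a * monomial_value Var m"
  by (simp add: Const_def monomial_value_Var mult_single)

lemma poly_value_Const_Var: "poly_value Const Var f = f"
proof -
  have "poly_value Const Var f = (\<Sum>m\<in>mkeys f. Poly_Mapping.single m (coeff_at f m))"
    by (simp add: poly_value_def single_eq)
  then show ?thesis using sum_of_singles[of f] by simp
qed

lemma poly_subst_eq: "poly_subst \<sigma> f = poly_value Const \<sigma> f"
  by (simp add: poly_subst_def poly_value_def monomial_value_def)

section \<open>Forms and homogeneous components\<close>

lemma monomial_degree_superset:
  assumes "finite S" "mkeys m \<subseteq> S"
  shows "monomial_degree m = (\<Sum>i\<in>S. coeff_at m i)"
  unfolding monomial_degree_def
  by (rule sum.mono_neutral_left) (use assms in \<open>auto simp: in_keys_iff\<close>)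

lemma monomial_degree_add: "monomial_degree (m + n) = monomial_degree m + monomial_degree n"
proof -
  let ?S = "mkeys m \<union> mkeys n"
  have "monomial_degree (m + n) = (\<Sum>i\<in>?S. coeff_at (m + n) i)"
    by (rule monomial_degree_superset) (auto dest: subsetD[OF keys_add])
  also have "\<dots> = (\<Sum>i\<in>?S. coeff_at m i) + (\<Sum>i\<in>?S. coeff_at n i)"
    by (simp add: lookup_add sum.distrib)
  also have "\<dots> = monomial_degree m + monomial_degree n"
    by (subst (1 2) monomial_degree_superset[of ?S]) auto
  finally show ?thesis .
qed

definition forms :: "nat \<Rightarrow> nat \<Rightarrow> 'a::comm_ring_1 mpoly set" where
  "forms n d = {f \<in> polynomials n. \<forall>m\<in>mkeys f. monomial_degree m = d}"

lemma forms_iff: "f \<in> forms n d \<longleftrightarrow> (\<forall>m\<in>mkeys f. mkeys m \<subseteq> {..<n} \<and> monomial_degree m = d)"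
  by (auto simp: forms_def polynomials_def)

lemma forms_0: "0 \<in> forms n d" by (simp add: forms_iff)

lemma forms_add: "f \<in> forms n d \<Longrightarrow> g \<in> forms n d \<Longrightarrow> f + g \<in> forms n d"
  using keys_add[of f g] by (auto simp: forms_iff subset_iff)

lemma forms_mult:
  assumes "f \<in> forms n d" "g \<in> forms n e" shows "f * g \<in> forms n (d + e)"
  unfolding forms_iff
proof
  fix m assume "m \<in> mkeys (f * g)"
  then obtain a b where m: "m = a + b" "a \<in> mkeys f" "b \<in> mkeys g" using keys_mult[of f g] by blast
  have "mkeys m \<subseteq> mkeys a \<union> mkeys b" unfolding m(1) by (rule keys_add)
  then show "mkeys m \<subseteq> {..<n} \<and> monomial_degree m = d + e"
    using assms m by (auto simp: forms_iff monomial_degree_add)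
qed

lemma forms_Const: "Const a \<in> forms n 0"
  by (cases "a = 0") (auto simp: forms_iff Const_def monomial_degree_def)

lemma forms_scale: "f \<in> forms n d \<Longrightarrow> Const a * f \<in> forms n d"
  using forms_mult[OF forms_Const, of f n d a] by simp

lemma forms_Var: "i < n \<Longrightarrow> Var i \<in> forms n 1"
  by (simp add: forms_iff Var_def monomial_degree_def)

lemma forms_sum: "(\<And>x. x \<in> A \<Longrightarrow> f x \<in> forms n d) \<Longrightarrow> sum f A \<in> forms n d"
  by (induction A rule: infinite_finite_induct) (auto simp: forms_0 forms_add)

lemma forms_1: "1 \<in> forms n 0" using forms_Const[of 1] by (simp add: one_eq_Const)

lemma forms_power: "f \<in> forms n d \<Longrightarrow> f ^ k \<in> forms n (d * k)"
  by (induction k) (auto simp: forms_1 intro: forms_mult)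

lemma forms_prod: "finite A \<Longrightarrow> (\<And>x. x \<in> A \<Longrightarrow> f x \<in> forms n (e x)) \<Longrightarrow> prod f A \<in> forms n (sum e A)"
  by (induction A rule: finite_induct) (auto simp: forms_1 forms_mult)

lemma forms_poly_value:
  assumes f: "f \<in> forms n d" and \<sigma>: "\<And>i. i < n \<Longrightarrow> \<sigma> i \<in> forms n 1"
  shows "poly_value (\<lambda>a. Const (c a)) \<sigma> f \<in> forms n d"
  unfolding poly_value_def
proof (rule forms_sum)
  fix m assume m: "m \<in> mkeys f"
  then have mk: "mkeys m \<subseteq> {..<n}" "monomial_degree m = d" using f by (auto simp: forms_iff)
  have "monomial_value \<sigma> m \<in> forms n (\<Sum>i\<in>mkeys m. 1 * coeff_at m i)"
    unfolding monomial_value_def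
  proof (rule forms_prod)
    fix i assume "i \<in> mkeys m"
    then have "i < n" using mk(1) by blast
    then show "\<sigma> i ^ coeff_at m i \<in> forms n (1 * coeff_at m i)" by (rule forms_power[OF \<sigma>])
  qed simp
  then show "Const (c (coeff_at f m)) * monomial_value \<sigma> m \<in> forms n d"
    using mk(2) by (intro forms_scale) (simp add: monomial_degree_def)
qed

lemma poly_value_cong:
  assumes "f \<in> polynomials n" "\<And>i. i < n \<Longrightarrow> \<sigma> i = \<tau> i"
  shows "poly_value c \<sigma> f = poly_value c \<tau> f"
proof -
  have "monomial_value \<sigma> m = monomial_value \<tau> m" if "m \<in> mkeys f" for m
    unfolding monomial_value_def
  proof (rule prod.cong[OF refl])
    fix i assume "i \<in> mkeys m"
    then have "i < n" using assms(1) that by (auto simp: polynomials_def)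
    then show "\<sigma> i ^ coeff_at m i = \<tau> i ^ coeff_at m i" using assms(2) by simp
  qed
  then show ?thesis unfolding poly_value_def by (intro sum.cong) auto
qed

lemma forms_polynomials: "f \<in> forms n d \<Longrightarrow> f \<in> polynomials n" by (simp add: forms_def)

lemma monomial_forms: "mkeys m \<subseteq> {..<n} \<Longrightarrow> monomial_degree m = d \<Longrightarrow> Poly_Mapping.single m a \<in> forms n d"
  by (cases "a = 0") (auto simp: forms_iff)

lemma monomial_as_product:
  "monomial_value \<sigma> m = (\<Prod>t\<in>(SIGMA i:mkeys m. {..<coeff_at m i}). \<sigma> (fst t))"
proof -
  have "(\<Prod>t\<in>(SIGMA i:mkeys m. {..<coeff_at m i}). \<sigma> (fst t)) = (\<Prod>i\<in>mkeys m. \<Prod>r\<in>{..<coeff_at m i}. \<sigma> i)"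
    by (subst prod.Sigma) (auto simp: case_prod_unfold)
  then show ?thesis by (simp add: monomial_value_def)
qed

definition component :: "nat \<Rightarrow> 'a::comm_ring_1 mpoly \<Rightarrow> 'a mpoly" where
  "component e f = (\<Sum>m\<in>{m\<in>mkeys f. monomial_degree m = e}. Poly_Mapping.single m (coeff_at f m))"

lemma coeff_component: "coeff_at (component e f) k = (if monomial_degree k = e then coeff_at f k else 0)"
proof -
  have "coeff_at (component e f) k
      = (\<Sum>m\<in>{m\<in>mkeys f. monomial_degree m = e}. if m = k then coeff_at f k else 0)"
    unfolding component_def lookup_sum by (rule sum.cong) (auto simp: lookup_single when_def)
  then show ?thesis by (simp add: sum.delta in_keys_iff)
qed

lemma component_add: "component e (f + g) = component e f + component e g"
  by (rule poly_mapping_eqI) (simp add: coeff_component lookup_add)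

lemma component_0: "component e 0 = 0"
  by (rule poly_mapping_eqI) (simp add: coeff_component)

lemma component_single:
  "component e (Poly_Mapping.single m a) = (if monomial_degree m = e then Poly_Mapping.single m a else 0)"
  by (rule poly_mapping_eqI) (auto simp: coeff_component lookup_single when_def)

lemma component_mult: "component e (f * g) = (\<Sum>i\<le>e. component i f * component (e - i) g)"
proof (induction f rule: single_induct)
  case (single m a)
  show ?case
  proof (induction g rule: single_induct)
    case (single n b)
    have "(\<Sum>i\<le>e. component i (Poly_Mapping.single m a) * component (e - i) (Poly_Mapping.single n b))
      = (\<Sum>i\<le>e. if i = monomial_degree m then (if monomial_degree n = e - i then Poly_Mapping.single (m + n) (a * b) else 0) else 0)"
      by (rule sum.cong) (auto simp: component_single mult_single)
    also have "\<dots> = component e (Poly_Mapping.single m a * Poly_Mapping.single n b)"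
      by (auto simp: sum.delta mult_single component_single monomial_degree_add)
    finally show ?case by simp
  next
    case (add g h)
    then show ?case by (simp only: distrib_left component_add sum.distrib)
  qed (simp only: component_0 mult_zero_right sum.neutral_const)
next
  case (add f h)
  then show ?case by (simp only: distrib_right component_add sum.distrib)
qed (simp only: component_0 mult_zero_left sum.neutral_const)

lemma component_homogeneous:
  assumes f: "\<forall>m\<in>mkeys f. monomial_degree m = d"
  shows "component e f = (if e = d then f else 0)"
proof (rule poly_mapping_eqI)
  fix k
  have "coeff_at f k = 0 \<or> monomial_degree k = d" using f by (metis in_keys_iff)
  then show "coeff_at (component e f) k = coeff_at (if e = d then f else 0) k"
    unfolding coeff_component by (cases "e = d"; cases "monomial_degree k = e") simp_all
qed

section \<open>Matrix actions and orbit sums\<close>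

text \<open>The action on polynomials that a matrix representation induces by \<open>f\<^sup>g(v) = f(g v)\<close>, whence the order of
the factors in \<open>act_mult\<close>.\<close>

locale matrix_action = group G for G :: "('g, 'b) monoid_scheme" (structure) +
  fixes n :: nat and A :: "'g \<Rightarrow> nat \<Rightarrow> nat \<Rightarrow> 'f::field"
  assumes A_one: "i < n \<Longrightarrow> j < n \<Longrightarrow> A \<one> i j = (if i = j then 1 else 0)"
    and A_mult: "g \<in> carrier G \<Longrightarrow> h \<in> carrier G \<Longrightarrow> i < n \<Longrightarrow> j < n \<Longrightarrow>
      A (g \<otimes> h) i j = (\<Sum>l<n. A g i l * A h l j)"
begin

definition row :: "'g \<Rightarrow> nat \<Rightarrow> 'f mpoly" where
  "row g i = (\<Sum>j<n. Const (A g i j) * Var j)"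

definition act :: "'g \<Rightarrow> 'f mpoly \<Rightarrow> 'f mpoly" where
  "act g = poly_value Const (row g)"

lemma act_hom: "ring_hom_fun (act g)"
  unfolding act_def by (rule ring_hom_poly_value[OF ring_hom_Const])

lemma act_Const: "act g (Const a) = Const a"
  unfolding act_def by (rule poly_value_Const[OF ring_hom_Const])

lemma act_Var: "act g (Var i) = row g i"
  unfolding act_def by (rule poly_value_Var[OF ring_hom_Const])

lemma row_forms: "row g i \<in> forms n 1"
  unfolding row_def by (intro forms_sum forms_scale forms_Var) simp

lemma act_forms: "f \<in> forms n d \<Longrightarrow> act g f \<in> forms n d"
  unfolding act_def using forms_poly_value[of f n d "row g" "\<lambda>a. a"] row_forms by simp

lemma act_one: "f \<in> polynomials n \<Longrightarrow> act \<one> f = f"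
proof -
  assume f: "f \<in> polynomials n"
  have "row \<one> i = Var i" if i: "i < n" for i
  proof -
    have "row \<one> i = (\<Sum>j<n. if j = i then Var i else 0)"
      unfolding row_def by (rule sum.cong) (use A_one[OF i] in \<open>auto simp: Const_0 one_eq_Const[symmetric]\<close>)
    then show ?thesis using i by (simp add: sum.delta)
  qed
  then have "act \<one> f = poly_value Const Var f" unfolding act_def by (rule poly_value_cong[OF f])
  then show ?thesis by (simp add: poly_value_Const_Var)
qed

lemma act_mult:
  assumes f: "f \<in> polynomials n" and g: "g \<in> carrier G" "h \<in> carrier G"
  shows "act (g \<otimes> h) f = act h (act g f)"
proof -
  have "act h (act g f) = poly_value Const (\<lambda>i. act h (row g i)) f"
    unfolding act_def[of g] hom_poly_value[OF act_hom] by (simp add: act_Const)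
  also have "\<dots> = poly_value Const (row (g \<otimes> h)) f"
  proof (rule poly_value_cong[OF f])
    fix i assume i: "i < n"
    have "act h (row g i) = (\<Sum>l<n. Const (A g i l) * row h l)"
      unfolding row_def[of g] ring_hom_fun_sum[OF act_hom] by (simp add: ring_hom_fun_D[OF act_hom] act_Const act_Var)
    also have "\<dots> = (\<Sum>l<n. \<Sum>j<n. Const (A g i l * A h l j) * Var j)"
      by (simp add: row_def sum_distrib_left Const_mult mult.assoc)
    also have "\<dots> = (\<Sum>j<n. \<Sum>l<n. Const (A g i l * A h l j) * Var j)" by (rule sum.swap)
    also have "\<dots> = row (g \<otimes> h) i"
      unfolding row_def
    proof (rule sum.cong[OF refl])
      fix j assume "j \<in> {..<n}"
      then have "Const (A (g \<otimes> h) i j) = (\<Sum>l<n. Const (A g i l * A h l j) :: 'f mpoly)"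
        using A_mult[OF g i, of j] by (simp add: ring_hom_fun_sum[OF ring_hom_Const])
      then show "(\<Sum>l<n. Const (A g i l * A h l j) * Var j) = Const (A (g \<otimes> h) i j) * Var j"
        by (simp add: sum_distrib_right)
    qed
    finally show "act h (row g i) = row (g \<otimes> h) i" .
  qed
  finally show ?thesis by (simp add: act_def)
qed

definition orbit_sum :: "'f mpoly \<Rightarrow> 'f mpoly" where
  "orbit_sum f = (\<Sum>g\<in>carrier G. act g f)"

lemma orbit_sum_add: "orbit_sum (f + h) = orbit_sum f + orbit_sum h"
  by (simp add: orbit_sum_def ring_hom_fun_D[OF act_hom] sum.distrib)

lemma orbit_sum_scale: "orbit_sum (Const a * f) = Const a * orbit_sum f"
  by (simp add: orbit_sum_def ring_hom_fun_D[OF act_hom] act_Const sum_distrib_left)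

lemma orbit_sum_forms: "f \<in> forms n d \<Longrightarrow> orbit_sum f \<in> forms n d"
  unfolding orbit_sum_def by (intro forms_sum act_forms)

lemma orbit_sum_act:
  assumes f: "f \<in> polynomials n" and h: "h \<in> carrier G"
  shows "orbit_sum (act h f) = orbit_sum f"
proof -
  have "orbit_sum (act h f) = (\<Sum>g\<in>carrier G. act (h \<otimes> g) f)"
    unfolding orbit_sum_def using act_mult[OF f h] by (intro sum.cong) auto
  also have "\<dots> = (\<Sum>g\<in>(\<lambda>g. h \<otimes> g) ` carrier G. act g f)"
    using h by (subst sum.reindex) (auto simp: inj_on_def)
  also have "(\<lambda>g. h \<otimes> g) ` carrier G = carrier G"
  proof
    show "(\<lambda>g. h \<otimes> g) ` carrier G \<subseteq> carrier G" using h by auto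
    show "carrier G \<subseteq> (\<lambda>g. h \<otimes> g) ` carrier G"
    proof
      fix g assume g: "g \<in> carrier G"
      have "g = h \<otimes> (inv h \<otimes> g)" using g h by (simp add: m_assoc[symmetric])
      then show "g \<in> (\<lambda>g. h \<otimes> g) ` carrier G" using g h by blast
    qed
  qed
  finally show ?thesis by (simp add: orbit_sum_def)
qed

lemma act_orbit_sum:
  assumes f: "f \<in> polynomials n" and h: "h \<in> carrier G"
  shows "act h (orbit_sum f) = orbit_sum f"
proof -
  have "act h (orbit_sum f) = (\<Sum>g\<in>carrier G. act (g \<otimes> h) f)"
    unfolding orbit_sum_def ring_hom_fun_sum[OF act_hom] using act_mult[OF f _ h] by (intro sum.cong) auto
  also have "\<dots> = (\<Sum>g\<in>(\<lambda>g. g \<otimes> h) ` carrier G. act g f)"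
    using h by (subst sum.reindex) (auto simp: inj_on_def)
  also have "(\<lambda>g. g \<otimes> h) ` carrier G = carrier G"
  proof
    show "(\<lambda>g. g \<otimes> h) ` carrier G \<subseteq> carrier G" using h by auto
    show "carrier G \<subseteq> (\<lambda>g. g \<otimes> h) ` carrier G"
    proof
      fix g assume g: "g \<in> carrier G"
      have "g = (g \<otimes> inv h) \<otimes> h" using g h by (simp add: m_assoc)
      then show "g \<in> (\<lambda>g. g \<otimes> h) ` carrier G" using g h by blast
    qed
  qed
  finally show ?thesis by (simp add: orbit_sum_def)
qed

lemma orbit_sum_invariant:
  assumes u: "\<And>g. g \<in> carrier G \<Longrightarrow> act g u = u"
  shows "orbit_sum (u * f) = u * orbit_sum f" and "orbit_sum u = of_nat (card (carrier G)) * u"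
proof -
  have "orbit_sum (u * f) = (\<Sum>g\<in>carrier G. u * act g f)"
    unfolding orbit_sum_def
  proof (rule sum.cong[OF refl])
    fix g assume "g \<in> carrier G"
    then show "act g (u * f) = u * act g f" using ring_hom_fun_D(3)[OF act_hom, of g u f] u by metis
  qed
  then show "orbit_sum (u * f) = u * orbit_sum f" by (simp only: sum_distrib_left orbit_sum_def)
  have "orbit_sum u = (\<Sum>g\<in>carrier G. u)"
    unfolding orbit_sum_def by (rule sum.cong[OF refl]) (rule u)
  then show "orbit_sum u = of_nat (card (carrier G)) * u" by (simp only: sum_constant)
qed

lemma Const_of_nat: "Const (of_nat k) = (of_nat k :: 'f mpoly)"
proof (induction k)
  case 0 show ?case by (simp only: of_nat_0 Const_0)
next
  case (Suc k) then show ?case by (simp only: of_nat_Suc Const_add one_eq_Const)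
qed

lemma orbit_sum_0: "orbit_sum 0 = 0"
  by (simp only: orbit_sum_def ring_hom_fun_D(4)[OF act_hom] sum.neutral_const)

lemma orbit_sum_sum: "orbit_sum (sum h S) = (\<Sum>x\<in>S. orbit_sum (h x))"
  by (induction S rule: infinite_finite_induct) (auto simp: orbit_sum_0 orbit_sum_add)

end

section \<open>Extension of scalars and linear functionals\<close>

definition extend_scalars :: "'a::field mpoly \<Rightarrow> 'a alg_closure mpoly" where
  "extend_scalars = poly_value (\<lambda>a. Const (to_ac a)) Var"

lemma ring_hom_Const_to_ac: "ring_hom_fun (\<lambda>a. Const (to_ac a))"
  by (simp add: ring_hom_fun_def Const_add Const_mult one_eq_Const)

lemma extend_scalars_hom: "ring_hom_fun extend_scalars"
  unfolding extend_scalars_def by (rule ring_hom_poly_value[OF ring_hom_Const_to_ac])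

lemma extend_scalars_single: "extend_scalars (Poly_Mapping.single m a) = Poly_Mapping.single m (to_ac a)"
  by (simp only: extend_scalars_def poly_value_single[OF ring_hom_Const_to_ac] single_eq[symmetric])

lemma extend_scalars_Const: "extend_scalars (Const a) = Const (to_ac a)"
  unfolding extend_scalars_def by (rule poly_value_Const[OF ring_hom_Const_to_ac])

lemma extend_scalars_Var: "extend_scalars (Var i) = Var i"
  unfolding extend_scalars_def by (rule poly_value_Var[OF ring_hom_Const_to_ac])

lemma extend_scalars_forms: "f \<in> forms n d \<Longrightarrow> extend_scalars f \<in> forms n d"
  unfolding extend_scalars_def by (rule forms_poly_value) (auto simp del: One_nat_def intro: forms_Var)

definition linear_value :: "((nat \<Rightarrow>\<^sub>0 nat) \<Rightarrow> 'a::comm_ring_1) \<Rightarrow> 'a mpoly \<Rightarrow> 'a" where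
  "linear_value w f = (\<Sum>m\<in>mkeys f. coeff_at f m * w m)"

lemma linear_value_superset:
  assumes "finite S" "mkeys f \<subseteq> S"
  shows "linear_value w f = (\<Sum>m\<in>S. coeff_at f m * w m)"
  unfolding linear_value_def
  by (rule sum.mono_neutral_left) (use assms in \<open>auto simp: in_keys_iff\<close>)

lemma linear_value_add: "linear_value w (f + g) = linear_value w f + linear_value w g"
proof -
  let ?S = "mkeys f \<union> mkeys g"
  have "linear_value w (f + g) = (\<Sum>m\<in>?S. coeff_at (f + g) m * w m)"
    by (rule linear_value_superset) (auto dest: subsetD[OF keys_add])
  also have "\<dots> = (\<Sum>m\<in>?S. coeff_at f m * w m) + (\<Sum>m\<in>?S. coeff_at g m * w m)"
    by (simp only: lookup_add distrib_right sum.distrib)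
  also have "\<dots> = linear_value w f + linear_value w g"
    by (subst (1 2) linear_value_superset[of ?S]) auto
  finally show ?thesis .
qed

lemma linear_value_0: "linear_value w 0 = 0" by (simp add: linear_value_def)

lemma linear_value_single: "linear_value w (Poly_Mapping.single m a) = a * w m"
  by (cases "a = 0") (auto simp: linear_value_def)

lemma linear_value_scale: "linear_value w (Const x * f) = x * linear_value w f"
proof (induction f rule: single_induct)
  case (single m a)
  show ?case by (simp add: Const_def mult_single linear_value_single mult.assoc)
next
  case (add f g)
  then show ?case by (simp only: distrib_left linear_value_add)
qed (simp add: linear_value_0)

lemma linear_value_sum: "linear_value w (sum h A) = (\<Sum>x\<in>A. linear_value w (h x))"
  by (induction A rule: infinite_finite_induct) (auto simp: linear_value_0 linear_value_add)

text \<open>Extend a basis of \<open>D\<close> by \<open>f\<close> to a basis of the space of all polynomials.\<close>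

lemma separating_functional:
  fixes D :: "'a::field mpoly set"
  assumes D: "0 \<in> D" "\<And>u v. u \<in> D \<Longrightarrow> v \<in> D \<Longrightarrow> u + v \<in> D" "\<And>x u. u \<in> D \<Longrightarrow> Const x * u \<in> D"
    and f: "f \<notin> D"
  obtains l :: "'a mpoly \<Rightarrow> 'a" where "\<And>u v. l (u + v) = l u + l v" "\<And>x u. l (Const x * u) = x * l u"
    "\<And>u. u \<in> D \<Longrightarrow> l u = 0" "l f = 1"
proof -
  interpret V: vector_space "\<lambda>x (u::'a mpoly). Const x * u"
    by unfold_locales (simp_all add: distrib_left Const_add distrib_right Const_mult mult.assoc one_eq_Const[symmetric])
  interpret W: vector_space "(*) :: 'a \<Rightarrow> 'a \<Rightarrow> 'a"
    by unfold_locales (simp_all add: algebra_simps)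
  interpret VP: vector_space_pair "\<lambda>x (u::'a mpoly). Const x * u" "(*) :: 'a \<Rightarrow> 'a \<Rightarrow> 'a"
    by unfold_locales
  have sub: "V.subspace D" by (rule V.subspaceI) (use D in auto)
  obtain B where B: "B \<subseteq> D" "V.independent B" "D \<subseteq> V.span B" using V.maximal_independent_subset .
  have sp: "V.span B = D" using V.span_subspace[OF B(1,3) sub] .
  then have ind: "V.independent (insert f B)" using B(2) f by (intro V.independent_insertI) auto
  obtain l where l: "Vector_Spaces.linear (\<lambda>x (u::'a mpoly). Const x * u) (*) l"
    "\<forall>x\<in>insert f B. l x = (if x = f then 1 else 0)"
    using VP.linear_independent_extend[OF ind, of "\<lambda>x. if x = f then 1 else 0"] by blast
  interpret L: Vector_Spaces.linear "\<lambda>x (u::'a mpoly). Const x * u" "(*)" l by (rule l(1))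
  show thesis
  proof (rule that[of l])
    show "l (u + v) = l u + l v" for u v by (rule L.add)
    show "l (Const x * u) = x * l u" for x u by (rule L.scale)
    show "l f = 1" using l(2) by simp
    have "l x = 0" if "x \<in> B" for x using l(2) that B(1) f by auto
    then show "l u = 0" if "u \<in> D" for u using L.eq_0_on_span[of B u] that sp by blast
  qed
qed

section \<open>Roots of unity and the structure of the Heisenberg group\<close>

text \<open>A root of \<open>1 + z + \<dots> + z ^ (p - 1)\<close> differs from \<open>1\<close>, where the value is \<open>p\<close>.\<close>

lemma exists_root_of_unity:
  assumes p: "Factorial_Ring.prime p" and nz: "of_nat p \<noteq> (0::'k::alg_closed_field)"
  obtains \<zeta> where "\<zeta> ^ p = (1::'k)" "\<zeta> \<noteq> 1"
proof -
  have p2: "2 \<le> p" using p by (rule prime_ge_2_nat)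
  obtain z where z: "(\<Sum>k\<le>p - 1. 1 * z ^ k) = (0::'k)"
    using alg_closed[of "p - 1" "\<lambda>_. 1 :: 'k"] p2 by auto
  have set: "{..p - 1} = {..<p}" using p2 by auto
  have s: "(\<Sum>k<p. z ^ k) = 0" using z unfolding set by simp
  have "z ^ p - 1 = (z - 1) * (\<Sum>k<p. z ^ k)" by (rule power_diff_1_eq)
  then have "z ^ p = 1" by (simp add: s)
  moreover have "z \<noteq> 1" using s nz by auto
  ultimately show thesis using that by blast
qed

lemma heisenberg_group_generators:
  fixes G (structure)
  assumes H: "heisenberg_group p G"
  obtains a b c where "a \<in> carrier G" "b \<in> carrier G" "c \<in> carrier G"
    "\<And>g. g \<in> carrier G \<Longrightarrow> g \<otimes> c = c \<otimes> g"
    "a \<otimes> b = b \<otimes> a \<otimes> c" "generate G {a, b} = carrier G"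
proof -
  obtain a b c where abc: "a \<in> carrier G" "b \<in> carrier G" "c \<in> carrier G" "generate G {a, b, c} = carrier G"
    and r: "inv a \<otimes> inv b \<otimes> a \<otimes> b = c" "inv a \<otimes> inv c \<otimes> a \<otimes> c = \<one>" "inv b \<otimes> inv c \<otimes> b \<otimes> c = \<one>"
    using heisenberg_group_presentation[OF H] by metis
  interpret group G using H by (simp add: heisenberg_group_def extraspecial_def)
  have comm: "x \<otimes> y = y \<otimes> x \<otimes> (inv x \<otimes> inv y \<otimes> x \<otimes> y)" if "x \<in> carrier G" "y \<in> carrier G" for x y
  proof -
    have "inv x \<otimes> inv y \<otimes> x \<otimes> y = inv (y \<otimes> x) \<otimes> (x \<otimes> y)"
      using that by (simp add: inv_mult_group m_assoc)
    moreover have "y \<otimes> x \<otimes> (inv (y \<otimes> x) \<otimes> (x \<otimes> y)) = x \<otimes> y"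
      using that by (simp only: m_assoc[symmetric] m_closed inv_closed r_inv l_one)
    ultimately show ?thesis by simp
  qed
  have ac: "a \<otimes> c = c \<otimes> a" and bc: "b \<otimes> c = c \<otimes> b"
    using comm[of a c] comm[of b c] r abc by auto
  have central: "g \<otimes> c = c \<otimes> g" if "g \<in> generate G {a, b, c}" for g
    using that
  proof (induction rule: generate.induct)
    case one then show ?case using abc by simp
  next
    case (incl h) then show ?case using ac bc by auto
  next
    case (inv h)
    then have "h \<in> carrier G" "h \<otimes> c = c \<otimes> h" using abc ac bc by auto
    then show ?case using inv_commute[of h c] abc(3) by blast
  next
    case (eng h k)
    then have "h \<in> carrier G" "k \<in> carrier G" unfolding abc(4) by auto
    then show ?case using mult_commute[of h k c] eng.IH abc(3) by blast
  qed
  have sub: "subgroup (generate G {a, b}) G" using generate_is_subgroup[of "{a, b}"] abc by auto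
  have mem: "a \<in> generate G {a, b}" "b \<in> generate G {a, b}" by (auto intro: generate.incl)
  have "c \<in> generate G {a, b}"
    unfolding r(1)[symmetric]
    using mem sub by (intro subgroup.m_closed[OF sub] subgroup.m_inv_closed[OF sub]) auto
  then have "generate G {a, b, c} \<subseteq> generate G {a, b}"
    using mem by (intro generate_subgroup_incl[OF _ sub]) auto
  moreover have "generate G {a, b} \<subseteq> carrier G" using sub by (rule subgroup.subset)
  ultimately have "generate G {a, b} = carrier G" using abc(4) by blast
  moreover have "a \<otimes> b = b \<otimes> a \<otimes> c" using comm[of a b] r(1) abc by simp
  ultimately show thesis using that abc central by metis
qed

lemma heisenberg_group_exponent:
  fixes G (structure)
  assumes H: "heisenberg_group p G"
  shows "group G" "finite (carrier G)" "card (carrier G) = p ^ 3" "g \<in> carrier G \<Longrightarrow> g [^] p = \<one>"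
proof -
  have p: "Factorial_Ring.prime p" using H by (simp add: heisenberg_group_def extraspecial_def)
  show g: "group G" using H by (simp add: heisenberg_group_def extraspecial_def)
  show c: "card (carrier G) = p ^ 3" using H by (simp add: heisenberg_group_def Coset.order_def)
  have "0 < p ^ 3" using prime_gt_0_nat[OF p] by simp
  then show fin: "finite (carrier G)" using c by (metis card_ge_0_finite)
  show "g \<in> carrier G \<Longrightarrow> g [^] p = \<one>"
    using group_exponent_pow[OF g fin, of g] H by (simp add: heisenberg_group_def)
qed

section \<open>Indecomposable invariants have degree less than the square of p\<close>

context matrix_action
begin

interpretation K: matrix_action G n "\<lambda>g i j. to_ac (A g i j)"
proof
  fix i j assume "i < n" "j < n"
  then show "to_ac (A \<one> i j) = (if i = j then 1 else 0)" by (simp add: A_one)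
next
  fix g h i j assume "g \<in> carrier G" "h \<in> carrier G" "i < n" "j < n"
  then show "to_ac (A (g \<otimes> h) i j) = (\<Sum>l<n. to_ac (A g i l) * to_ac (A h l j))"
    by (simp add: A_mult to_ac_sum)
qed

lemma extend_scalars_act: "extend_scalars (act g f) = K.act g (extend_scalars f)"
proof -
  have row: "extend_scalars (row g i) = K.row g i" for i
    unfolding row_def K.row_def ring_hom_fun_sum[OF extend_scalars_hom]
    by (simp only: ring_hom_fun_D(3)[OF extend_scalars_hom] extend_scalars_Const extend_scalars_Var)
  have "extend_scalars (act g f) = poly_value (\<lambda>a. Const (to_ac a)) (K.row g) f"
    unfolding act_def hom_poly_value[OF extend_scalars_hom] by (simp only: row extend_scalars_Const)
  also have "\<dots> = K.act g (extend_scalars f)"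
    unfolding extend_scalars_def hom_poly_value[OF K.act_hom] by (simp only: K.act_Const K.act_Var)
  finally show ?thesis .
qed

lemma extend_scalars_orbit_sum: "extend_scalars (orbit_sum f) = K.orbit_sum (extend_scalars f)"
  by (simp only: orbit_sum_def K.orbit_sum_def ring_hom_fun_sum[OF extend_scalars_hom] extend_scalars_act)

text \<open>Over the larger field, orbit sums are linear combinations of orbit sums over the smaller one. This is
why decomposability descends.\<close>

lemma extended_orbit_sum:
  "K.orbit_sum q = (\<Sum>m\<in>mkeys q. Const (coeff_at q m) * extend_scalars (orbit_sum (Poly_Mapping.single m 1)))"
proof -
  have "K.orbit_sum q = K.orbit_sum (\<Sum>m\<in>mkeys q. Poly_Mapping.single m (coeff_at q m))"
    by (simp only: sum_of_singles[of q, symmetric])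
  also have "\<dots> = (\<Sum>m\<in>mkeys q. K.orbit_sum (Const (coeff_at q m) * extend_scalars (Poly_Mapping.single m 1)))"
    unfolding K.orbit_sum_sum by (simp add: extend_scalars_single Const_def mult_single)
  also have "\<dots> = (\<Sum>m\<in>mkeys q. Const (coeff_at q m) * extend_scalars (orbit_sum (Poly_Mapping.single m 1)))"
    by (simp only: K.orbit_sum_scale extend_scalars_orbit_sum)
  finally show ?thesis .
qed

text \<open>If \<open>f\<close> were not in \<open>D\<close>, take a functional that separates it from \<open>D\<close>, extend it to the algebraic
closure by linearity, and compose it with the orbit sum. The result satisfies the assumptions of
\<open>heisenberg_action\<close> and hence vanishes on all monomials of degree \<open>N\<close>; but at \<open>f\<close> its value is
the order of the group.\<close>

theorem invariant_forms_decomposable: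
  assumes H: "heisenberg_group p G" and p5: "5 \<le> p" and CH: "CHAR('f) = 0 \<or> p < CHAR('f)"
    and N: "p\<^sup>2 \<le> N" and f: "f \<in> forms n N" and inv: "\<And>g. g \<in> carrier G \<Longrightarrow> act g f = f"
    and D: "0 \<in> D" "\<And>u v. u \<in> D \<Longrightarrow> v \<in> D \<Longrightarrow> u + v \<in> D" "\<And>x u. u \<in> D \<Longrightarrow> Const x * u \<in> D"
      "\<And>u v. u \<in> D \<Longrightarrow> v \<in> D \<Longrightarrow> u * v \<in> D"
    and low: "\<And>d u. d < N \<Longrightarrow> u \<in> forms n d \<Longrightarrow> (\<And>g. g \<in> carrier G \<Longrightarrow> act g u = u) \<Longrightarrow> u \<in> D"
  shows "f \<in> D"
proof (rule ccontr)
  assume nf: "f \<notin> D"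
  obtain l :: "'f mpoly \<Rightarrow> 'f" where l: "\<And>u v. l (u + v) = l u + l v" "\<And>x u. l (Const x * u) = x * l u"
    "\<And>u. u \<in> D \<Longrightarrow> l u = 0" "l f = 1"
    using separating_functional[OF D(1-3) nf] by metis
  \<comment> \<open>The values at monomials determine the extension of \<open>l\<close> to the algebraic closure.\<close>
  define w where "w m = to_ac (l (Poly_Mapping.single m 1))" for m
  have l0: "l 0 = 0" using l(3)[OF D(1)] .
  have lw: "linear_value w (extend_scalars u) = to_ac (l u)" for u
  proof (induction u rule: single_induct)
    case (single m a)
    have "Poly_Mapping.single m a = Const a * Poly_Mapping.single m 1" by (simp add: Const_def mult_single)
    then have "l (Poly_Mapping.single m a) = a * l (Poly_Mapping.single m 1)" using l(2) by metis
    then show ?case by (simp add: extend_scalars_single linear_value_single w_def)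
  next
    case zero
    show ?case by (simp add: ring_hom_fun_D(4)[OF extend_scalars_hom] linear_value_0 l0)
  next
    case (add u v)
    then show ?case by (simp add: ring_hom_fun_D(2)[OF extend_scalars_hom] linear_value_add l(1))
  qed
  define \<phi> where "\<phi> q = linear_value w (K.orbit_sum q)" for q
  have p: "Factorial_Ring.prime p" using H by (simp add: heisenberg_group_def extraspecial_def)
  have "\<not> CHAR('f) dvd p"
    using CH p5 by (auto dest: dvd_imp_le)
  then have nz: "of_nat p \<noteq> (0::'f)" by (simp add: of_nat_eq_0_iff_char_dvd)
  then have nzK: "of_nat p \<noteq> (0::'f alg_closure)" by (metis to_ac_eq_0_iff to_ac_of_nat)
  have cardnz: "of_nat (card (carrier G)) \<noteq> (0::'f)" "of_nat (card (carrier G)) \<noteq> (0::'f alg_closure)"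
    using nz nzK heisenberg_group_exponent(3)[OF H] by simp_all
  obtain \<zeta> :: "'f alg_closure" where \<zeta>: "\<zeta> ^ p = 1" "\<zeta> \<noteq> 1" using exists_root_of_unity[OF p nzK] .
  obtain a b c where abc: "a \<in> carrier G" "b \<in> carrier G" "c \<in> carrier G"
    "\<And>g. g \<in> carrier G \<Longrightarrow> g \<otimes> c = c \<otimes> g" "a \<otimes> b = b \<otimes> a \<otimes> c" "generate G {a, b} = carrier G"
    using heisenberg_group_generators[OF H] by metis
  have basic: "orbit_sum (Poly_Mapping.single m 1) \<in> D"
    if x: "x \<in> forms n d" "d < N" "m \<in> mkeys x" for x :: "'f alg_closure mpoly" and m d
  proof (rule low[OF \<open>d < N\<close>])
    have m: "Poly_Mapping.single m (1::'f) \<in> forms n d"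
      using x(1,3) by (intro monomial_forms) (auto simp: forms_iff)
    show "orbit_sum (Poly_Mapping.single m 1) \<in> forms n d" by (rule orbit_sum_forms[OF m])
    show "act g (orbit_sum (Poly_Mapping.single m 1)) = orbit_sum (Poly_Mapping.single m 1)" if "g \<in> carrier G" for g
      by (rule act_orbit_sum[OF forms_polynomials[OF m] that])
  qed
  have vanish: "linear_value w (K.orbit_sum x * K.orbit_sum y) = 0"
    if x: "x \<in> forms n d" "d < N" and y: "y \<in> forms n e" "e < N" for x y d e
  proof -
    let ?o = "\<lambda>m. orbit_sum (Poly_Mapping.single m 1)"
    have t: "linear_value w (Const s * extend_scalars (?o m) * (Const r * extend_scalars (?o k))) = 0"
      if mk: "m \<in> mkeys x" "k \<in> mkeys y" for s r m k
    proof -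
      have "?o m * ?o k \<in> D" by (rule D(4)[OF basic[OF x mk(1)] basic[OF y mk(2)]])
      then have z: "linear_value w (extend_scalars (?o m * ?o k)) = 0" by (simp only: lw l(3) to_ac_0)
      have "Const s * extend_scalars (?o m) * (Const r * extend_scalars (?o k))
          = Const (s * r) * extend_scalars (?o m * ?o k)"
        unfolding ring_hom_fun_D(3)[OF extend_scalars_hom] Const_mult by (simp only: ac_simps)
      then show ?thesis by (simp only: linear_value_scale z mult_zero_right)
    qed
    have "K.orbit_sum x * K.orbit_sum y = (\<Sum>m\<in>mkeys x. \<Sum>k\<in>mkeys y.
        Const (coeff_at x m) * extend_scalars (?o m) * (Const (coeff_at y k) * extend_scalars (?o k)))"
      unfolding extended_orbit_sum[of x] extended_orbit_sum[of y] by (rule sum_product)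
    then have "linear_value w (K.orbit_sum x * K.orbit_sum y) = (\<Sum>m\<in>mkeys x. \<Sum>k\<in>mkeys y. linear_value w
        (Const (coeff_at x m) * extend_scalars (?o m) * (Const (coeff_at y k) * extend_scalars (?o k))))"
      by (simp only: linear_value_sum)
    also have "\<dots> = 0" using t by (intro sum.neutral ballI) auto
    finally show ?thesis .
  qed
  interpret heisenberg_action G p N \<zeta> Const K.act "forms n" \<phi> c
  proof
    show "Factorial_Ring.prime p" "5 \<le> p" "p\<^sup>2 \<le> N" by (fact p, fact p5, fact N)
    show "of_nat p \<noteq> (0 :: 'f alg_closure)" "\<zeta> ^ p = 1" "\<zeta> \<noteq> 1" by (fact nzK, fact \<zeta>(1), fact \<zeta>(2))
    show "Const (x + y) = Const x + Const y" "Const (x * y) = Const x * Const y" for x y :: "'f alg_closure"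
      by (rule Const_add, rule Const_mult)
    show "Const 1 = (1 :: 'f alg_closure mpoly)" by (rule one_eq_Const[symmetric])
    show "K.act g (u + v) = K.act g u + K.act g v" "K.act g (u * v) = K.act g u * K.act g v"
      "K.act g (Const x) = Const x" for g u v x
      by (rule ring_hom_fun_D[OF K.act_hom], rule ring_hom_fun_D[OF K.act_hom], rule K.act_Const)
    show "K.act \<one> u = u" if "u \<in> forms n d" for u d by (rule K.act_one[OF forms_polynomials[OF that]])
    show "K.act (g \<otimes> h) u = K.act h (K.act g u)"
      if "g \<in> carrier G" "h \<in> carrier G" "u \<in> forms n d" for g h u d
      by (rule K.act_mult[OF forms_polynomials[OF that(3)] that(1,2)])
    show "K.act g u \<in> forms n d" if "u \<in> forms n d" for g u d by (rule K.act_forms[OF that])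
    show "u + v \<in> forms n d" if "u \<in> forms n d" "v \<in> forms n d" for u v :: "'f alg_closure mpoly" and d
      by (rule forms_add[OF that])
    show "Const x * u \<in> forms n d" if "u \<in> forms n d" for x and u :: "'f alg_closure mpoly" and d
      by (rule forms_scale[OF that])
    show "u * v \<in> forms n (d + e)" if "u \<in> forms n d" "v \<in> forms n e" for u v :: "'f alg_closure mpoly" and d e
      by (rule forms_mult[OF that])
    show "(1 :: 'f alg_closure mpoly) \<in> forms n 0" by (rule forms_1)
    show "\<phi> (u + v) = \<phi> u + \<phi> v" for u v by (simp only: \<phi>_def K.orbit_sum_add linear_value_add)
    show "\<phi> (Const x * u) = x * \<phi> u" for x u by (simp only: \<phi>_def K.orbit_sum_scale linear_value_scale)
    show "\<phi> (K.act g u) = \<phi> u" if "g \<in> carrier G" "u \<in> forms n N" for g u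
      by (simp only: \<phi>_def K.orbit_sum_act[OF forms_polynomials[OF that(2)] that(1)])
    show "\<phi> (u * v) = 0" if u: "u \<in> forms n d" and v: "v \<in> forms n e" and de: "0 < d" "0 < e" "d + e = N"
      and i: "\<And>g. g \<in> carrier G \<Longrightarrow> K.act g u = u" for u v d e
    proof -
      have "of_nat (card (carrier G)) * \<phi> (u * v)
          = linear_value w (Const (of_nat (card (carrier G))) * (u * K.orbit_sum v))"
        by (simp only: \<phi>_def K.orbit_sum_invariant(1)[OF i] linear_value_scale)
      also have "\<dots> = linear_value w (K.orbit_sum u * K.orbit_sum v)"
        by (simp only: K.orbit_sum_invariant(2)[OF i] K.Const_of_nat mult.assoc)
      also have "\<dots> = 0" using de by (intro vanish[OF u _ v]) auto
      finally show ?thesis using cardnz(2) by simp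
    qed
    show "c \<in> carrier G" by (fact abc(3))
    show "g \<otimes> c = c \<otimes> g" if "g \<in> carrier G" for g by (rule abc(4)[OF that])
    show "g [^] p = \<one>" if "g \<in> carrier G" for g by (rule heisenberg_group_exponent(4)[OF H that])
  qed
  have pair: "pair a b" unfolding pair_def using abc by blast
  have mono: "\<phi> (monomial_value Var m) = 0" if "mkeys m \<subseteq> {..<n}" "monomial_degree m = N" for m
    unfolding monomial_as_product
  proof (rule product_of_linear_forms[OF pair])
    show "finite (SIGMA i:mkeys m. {..<coeff_at m i})" by auto
    show "card (SIGMA i:mkeys m. {..<coeff_at m i}) = N" using that(2) by (simp add: monomial_degree_def)
    show "Var (fst t) \<in> forms n 1" if "t \<in> (SIGMA i:mkeys m. {..<coeff_at m i})" for t
      using that \<open>mkeys m \<subseteq> {..<n}\<close> by (intro forms_Var) auto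
  qed
  let ?q = "extend_scalars f"
  have q: "?q \<in> forms n N" by (rule extend_scalars_forms[OF f])
  have \<phi>_sum: "\<phi> (sum h S) = (\<Sum>x\<in>S. \<phi> (h x))" for h and S :: "(nat \<Rightarrow>\<^sub>0 nat) set"
    unfolding \<phi>_def K.orbit_sum_sum linear_value_sum ..
  have "\<phi> ?q = \<phi> (\<Sum>m\<in>mkeys ?q. Poly_Mapping.single m (coeff_at ?q m))"
    by (simp only: sum_of_singles[of ?q, symmetric])
  also have "\<dots> = (\<Sum>m\<in>mkeys ?q. coeff_at ?q m * \<phi> (monomial_value Var m))"
    unfolding \<phi>_sum by (simp only: single_eq \<phi>_scale)
  also have "\<dots> = 0"
  proof (rule sum.neutral, rule ballI)
    fix m assume "m \<in> mkeys ?q"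
    then have "\<phi> (monomial_value Var m) = 0" using q by (intro mono) (auto simp: forms_iff)
    then show "coeff_at ?q m * \<phi> (monomial_value Var m) = 0" by simp
  qed
  finally have "\<phi> ?q = 0" .
  moreover have "\<phi> ?q = to_ac (l (orbit_sum f))"
    by (simp only: \<phi>_def extend_scalars_orbit_sum[symmetric] lw)
  moreover have "l (orbit_sum f) = of_nat (card (carrier G))"
    by (simp only: orbit_sum_invariant(2)[OF inv] Const_of_nat[symmetric] l(2) l(4) mult_1_right)
  ultimately show False using cardnz(2) by simp
qed

end

lemma generated_algebra_least:
  assumes "u \<in> generated_algebra S" "S \<subseteq> generated_algebra T"
  shows "u \<in> generated_algebra T"
  using assms(1) by induction (use assms(2) in \<open>auto intro: generated_algebra.intros\<close>)

lemma generated_algebra_0: "0 \<in> generated_algebra S"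
  using generated_algebra.const[of 0 S] by (simp add: Const_0)

lemma generated_algebra_sum:
  "(\<And>x. x \<in> A \<Longrightarrow> h x \<in> generated_algebra S) \<Longrightarrow> sum h A \<in> generated_algebra S"
  by (induction A rule: infinite_finite_induct) (auto intro: generated_algebra.add generated_algebra_0)

text \<open>A generator of degree \<open>N\<close> does not contribute to components of degree below \<open>N\<close>.\<close>

lemma low_component_generated:
  assumes S: "\<And>s. s \<in> S \<Longrightarrow> homogeneous s" and f: "\<forall>m\<in>mkeys f. monomial_degree m = N"
    and u: "u \<in> generated_algebra S" and e: "e < N"
  shows "component e u \<in> generated_algebra (S - {f})"
  using u e
proof (induction arbitrary: e)
  case (const c)
  show ?case
    unfolding Const_def component_single
    using generated_algebra.const[of c] generated_algebra_0 by (auto simp: Const_def)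
next
  case (gen s)
  obtain d where d: "\<forall>m\<in>mkeys s. monomial_degree m = d" using S[OF gen(1)] by (auto simp: homogeneous_def)
  show ?case
  proof (cases "s = f")
    case True
    then show ?thesis using component_homogeneous[OF f, of e] gen(2) generated_algebra_0 by simp
  next
    case False
    then show ?thesis using component_homogeneous[OF d, of e] gen(1)
      by (simp add: generated_algebra.gen generated_algebra_0)
  qed
next
  case (add u v)
  then show ?case unfolding component_add by (intro generated_algebra.add) auto
next
  case (mult u v)
  show ?case unfolding component_mult
  proof (rule generated_algebra_sum)
    fix i assume "i \<in> {..e}"
    then have "i < N" "e - i < N" using mult.prems by auto
    then show "component i u * component (e - i) v \<in> generated_algebra (S - {f})"
      using mult.IH by (intro generated_algebra.mult) auto
  qed
qed

lemma representation_matrix_action: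
  fixes G :: "('g, 'b) monoid_scheme" and \<rho> :: "'g \<Rightarrow> 'a::field mat"
  assumes G: "group G" and R: "representation G n \<rho>"
  shows "matrix_action G n (\<lambda>g i j. \<rho> g $$ (i, j))"
    and "\<And>g f. g \<in> carrier G \<Longrightarrow> mat_act (\<rho> g) f = matrix_action.act n (\<lambda>g i j. \<rho> g $$ (i, j)) g f"
proof -
  interpret group G by (rule G)
  interpret M: ring "ring_mat TYPE('a) n ()" by (rule ring_mat)
  have hom: "\<rho> \<in> hom G (units_of (ring_mat TYPE('a) n ()))" using R by (simp add: representation_def)
  have car: "\<rho> g \<in> carrier_mat n n" if "g \<in> carrier G" for g
    using hom that by (auto simp: hom_def units_of_def Units_def ring_mat_simps)
  have one: "\<rho> \<one>\<^bsub>G\<^esub> = 1\<^sub>m n"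
    using hom_one[OF hom G M.units_group] by (simp add: units_of_def ring_mat_simps)
  have mul: "\<rho> (g \<otimes>\<^bsub>G\<^esub> h) = \<rho> g * \<rho> h" if "g \<in> carrier G" "h \<in> carrier G" for g h
    using hom_mult[OF hom that] by (simp add: units_of_def ring_mat_simps)
  show ma: "matrix_action G n (\<lambda>g i j. \<rho> g $$ (i, j))"
  proof
    show "\<rho> \<one>\<^bsub>G\<^esub> $$ (i, j) = (if i = j then 1 else 0)" if "i < n" "j < n" for i j
      using that by (simp add: one)
    show "\<rho> (g \<otimes>\<^bsub>G\<^esub> h) $$ (i, j) = (\<Sum>l<n. \<rho> g $$ (i, l) * \<rho> h $$ (l, j))"
      if "g \<in> carrier G" "h \<in> carrier G" "i < n" "j < n" for g h i j
      using that car[of g] car[of h] by (auto simp: mul scalar_prod_def lessThan_atLeast0 intro!: sum.cong)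
  qed
  interpret matrix_action G n "\<lambda>g i j. \<rho> g $$ (i, j)" by (rule ma)
  show "mat_act (\<rho> g) f = act g f" if "g \<in> carrier G" for g f
    using car[OF that] by (simp add: mat_act_def act_def poly_subst_eq row_def[abs_def])
qed

text \<open>If the degree were \<open>p\<^sup>2\<close> or more, \<open>f\<close> would be a polynomial in the other generators by
\<open>invariant_forms_decomposable\<close>, so that the generating set would not be minimal.\<close>

lemma minimal_generator_degree:
  fixes G :: "('g, 'b) monoid_scheme" and \<rho> :: "'g \<Rightarrow> 'a::field mat"
  assumes H: "heisenberg_group p G" and p5: "5 \<le> p" and CH: "CHAR('a) = 0 \<or> p < CHAR('a)"
    and R: "representation G n \<rho>"
    and S: "minimal_homogeneous_generating_set (invariants G n \<rho>) S" and f: "f \<in> S"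
  shows "total_degree f < p\<^sup>2"
proof (rule ccontr)
  assume "\<not> total_degree f < p\<^sup>2"
  then have large: "p\<^sup>2 \<le> total_degree f" by simp
  have hom: "homogeneous s" if "s \<in> S" for s
    using S that by (simp add: minimal_homogeneous_generating_set_def homogeneous_generating_set_def)
  have gen: "generated_algebra S = invariants G n \<rho>"
    using S by (simp add: minimal_homogeneous_generating_set_def homogeneous_generating_set_def)
  obtain N where N: "\<forall>m\<in>mkeys f. monomial_degree m = N" using hom[OF f] by (auto simp: homogeneous_def)
  have "mkeys f \<noteq> {}" using large p5 by (auto simp: total_degree_def)
  then have "monomial_degree ` mkeys f = {N}" using N by (metis (no_types, lifting) image_cong image_constant_conv)
  then have "total_degree f = N" by (simp add: total_degree_def)
  then have pN: "p\<^sup>2 \<le> N" using large by simp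
  note G = heisenberg_group_exponent(1)[OF H]
  interpret matrix_action G n "\<lambda>g i j. \<rho> g $$ (i, j)" by (rule representation_matrix_action(1)[OF G R])
  note act = representation_matrix_action(2)[OF G R]
  have finv: "f \<in> invariants G n \<rho>" using generated_algebra.gen[OF f] gen by simp
  have "f \<in> generated_algebra (S - {f})"
  proof (rule invariant_forms_decomposable[OF H p5 CH pN])
    show "f \<in> forms n N" using finv N by (simp add: forms_def invariants_def)
    show "act g f = f" if "g \<in> carrier G" for g
      using finv that act[OF that, of f] by (simp add: invariants_def)
    show "u \<in> generated_algebra (S - {f})"
      if d: "d < N" and u: "u \<in> forms n d" and i: "\<And>g. g \<in> carrier G \<Longrightarrow> act g u = u" for d u
    proof -
      have "u \<in> invariants G n \<rho>" using forms_polynomials[OF u] i act by (simp add: invariants_def)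
      then have "component d u \<in> generated_algebra (S - {f})"
        using low_component_generated[OF hom N _ d] gen by blast
      then show ?thesis using u component_homogeneous[of u d d] by (simp add: forms_def)
    qed
  qed (auto intro: generated_algebra_0 generated_algebra.intros)
  then have sub: "S \<subseteq> generated_algebra (S - {f})" by (auto intro: generated_algebra.gen)
  have "generated_algebra (S - {f}) = generated_algebra S"
    using generated_algebra_least[OF _ sub] generated_algebra_least[of _ "S - {f}" S]
    by (auto intro: generated_algebra.gen)
  then have "homogeneous_generating_set (invariants G n \<rho>) (S - {f})"
    using hom gen by (simp add: homogeneous_generating_set_def)
  then show False using S f unfolding minimal_homogeneous_generating_set_def by blast
qed

theorem theorem2:
  fixes p :: nat and G :: "('g, 'b) monoid_scheme"
  assumes "Factorial_Ring.prime p" and "p \<ge> 5"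
    and "CHAR('a::field) = 0 \<or> CHAR('a) > p"
    and "heisenberg_group p G"
  shows "noether_number TYPE('a) G < enat (p ^ 2)"
proof -
  have le: "enat (total_degree f) \<le> enat (p\<^sup>2 - 1)"
    if "representation G n \<rho>" "minimal_homogeneous_generating_set (invariants G n \<rho>) S" "f \<in> S"
    for n S f and \<rho> :: "'g \<Rightarrow> 'a mat"
    using minimal_generator_degree[OF assms(4,2,3) that] by simp
  have "noether_number TYPE('a) G \<le> enat (p\<^sup>2 - 1)"
    unfolding noether_number_def module_noether_number_def
    by (intro SUP_least) (auto simp only: case_prod_conv mem_Collect_eq intro!: SUP_least intro: le)
  also have "\<dots> < enat (p ^ 2)" using assms(2) by simp
  finally show ?thesis .
qed

end
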